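(* If $W$ is a finite irreducible Coxeter group of rank $n\geq 2$, then $|\mathcal{P}(W)|=n$.
   Context: $W$ has set $R$ of fundamental reflections (so $n=|R|$) and length function $\ell$ with respect to $R$; $\mathcal{I}(W)$ is the set of elements of $W$ of order exactly $2$. For $x\in\mathcal{I}(W)$, $\Delta_1(x)=\{y\in\mathcal{I}(W) : \ell(xy)=\ell(x)+\ell(y)\}$. A pendant element of $W$ is a $w\in\mathcal{I}(W)$ with $|\Delta_1(w)|=1$, and $\mathcal{P}(W)$ is the set of pendant elements. *)

theory Defs
  imports "HOL-Algebra.Elementary_Groups" "HOL-Algebra.Multiplicative_Group"
begin

text \<open>Entries of a Coxeter matrix are natural numbers, with \<open>0\<close> standing for \<open>\<infinity>\<close>.\<close>

definition coxeter_matrix :: "'a set \<Rightarrow> ('a \<Rightarrow> 'a \<Rightarrow> nat) \<Rightarrow> bool" where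
  "coxeter_matrix R m \<longleftrightarrow>
     (\<forall>r\<in>R. m r r = 1) \<and>
     (\<forall>r\<in>R. \<forall>s\<in>R. m r s = m s r) \<and>
     (\<forall>r\<in>R. \<forall>s\<in>R. r \<noteq> s \<longrightarrow> m r s = 0 \<or> m r s \<ge> 2)"

text \<open>The relator \<open>(r s)\<close> raised to the power \<open>m r s\<close>, as a word. For \<open>m r s = 0\<close> it is the
  empty word, that is, no relation is imposed.\<close>

definition relator :: "('a \<Rightarrow> 'a \<Rightarrow> nat) \<Rightarrow> 'a \<Rightarrow> 'a \<Rightarrow> 'a list" where
  "relator m r s = concat (replicate (m r s) [r, s])"

text \<open>Since the relators \<open>r r\<close> make every generator its own inverse, the group presented by
  generators \<open>R\<close> and these relators is the monoid presented by them, so positive words suffice: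
  two words over \<open>R\<close> denote the same element of the presented group iff they are related by
  finitely many insertions and deletions of relators.\<close>

definition insert_relator ::
  "'a set \<Rightarrow> ('a \<Rightarrow> 'a \<Rightarrow> nat) \<Rightarrow> 'a list \<Rightarrow> 'a list \<Rightarrow> bool" where
  "insert_relator R m u v \<longleftrightarrow>
     (\<exists>p\<in>lists R. \<exists>q\<in>lists R. \<exists>r\<in>R. \<exists>s\<in>R. u = p @ q \<and> v = p @ relator m r s @ q)"

definition coxeter_equiv ::
  "'a set \<Rightarrow> ('a \<Rightarrow> 'a \<Rightarrow> nat) \<Rightarrow> 'a list \<Rightarrow> 'a list \<Rightarrow> bool" where
  "coxeter_equiv R m = equivclp (insert_relator R m)"

definition word_val :: "('a, 'b) monoid_scheme \<Rightarrow> 'a list \<Rightarrow> 'a" where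
  "word_val G w = foldr (\<otimes>\<^bsub>G\<^esub>) w \<one>\<^bsub>G\<^esub>"

text \<open>\<open>G\<close> is a Coxeter group with fundamental reflections \<open>R\<close>: it is generated by \<open>R\<close> and
  presented by the relators of a Coxeter matrix \<open>m\<close>.\<close>

locale coxeter_system = group G for G (structure) +
  fixes R :: "'a set" and m :: "'a \<Rightarrow> 'a \<Rightarrow> nat"
  assumes R_closed: "R \<subseteq> carrier G"
    and coxeter_matrix: "coxeter_matrix R m"
    and generated: "generate G R = carrier G"
    and presentation: "\<lbrakk>u \<in> lists R; v \<in> lists R\<rbrakk> \<Longrightarrow>
          word_val G u = word_val G v \<longleftrightarrow> coxeter_equiv R m u v"

definition coxeter_graph :: "'a set \<Rightarrow> ('a \<Rightarrow> 'a \<Rightarrow> nat) \<Rightarrow> ('a \<times> 'a) set" where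
  "coxeter_graph R m = {(r, s). r \<in> R \<and> s \<in> R \<and> r \<noteq> s \<and> m r s \<noteq> 2}"

text \<open>Irreducibility: the Coxeter graph is connected.\<close>

definition coxeter_irreducible :: "'a set \<Rightarrow> ('a \<Rightarrow> 'a \<Rightarrow> nat) \<Rightarrow> bool" where
  "coxeter_irreducible R m \<longleftrightarrow>
     R \<noteq> {} \<and> (\<forall>r\<in>R. \<forall>s\<in>R. (r, s) \<in> (coxeter_graph R m)\<^sup>*)"

definition cox_length :: "('a, 'b) monoid_scheme \<Rightarrow> 'a set \<Rightarrow> 'a \<Rightarrow> nat" where
  "cox_length G R x = (LEAST k. \<exists>w\<in>lists R. length w = k \<and> word_val G w = x)"

definition involutions :: "('a, 'b) monoid_scheme \<Rightarrow> 'a set" where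
  "involutions G = {x \<in> carrier G. group.ord G x = 2}"

definition Delta1 :: "('a, 'b) monoid_scheme \<Rightarrow> 'a set \<Rightarrow> 'a \<Rightarrow> 'a set" where
  "Delta1 G R x = {y \<in> involutions G.
     cox_length G R (x \<otimes>\<^bsub>G\<^esub> y) = cox_length G R x + cox_length G R y}"

definition pendants :: "('a, 'b) monoid_scheme \<Rightarrow> 'a set \<Rightarrow> 'a set" where
  "pendants G R = {w \<in> involutions G. card (Delta1 G R w) = 1}"

end

theory Submission
  imports Defs
begin

text \<open>Let \<open>w\<^sub>0\<close> be the longest element, and write a pendant element as \<open>w = u w\<^sub>0\<close>. Then \<open>w\<close> is an
  involution iff conjugation by \<open>w\<^sub>0\<close> (the opposition \<open>opp\<close>) inverts \<open>u\<close>, and \<open>\<Delta>\<^sub>1(w)\<close> consists of the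
  involutions that are prefixes of \<open>u\<close>. So one has to show that for every \<open>s \<in> R\<close> exactly one \<open>u\<close> with
  \<open>opp u = u\<^sup>-\<^sup>1\<close> has \<open>s\<close> as its only involutive prefix. If \<open>opp\<close> is trivial on \<open>R\<close>, then \<open>u\<close> is itself an
  involution, so \<open>u = s\<close>. Otherwise the rank is 2, or positivity of the canonical form makes the group
  simply laced, and \<open>u\<close> turns out to be the product of the generators along the unique path from
  \<open>s\<close> to \<open>opp s\<close> in the Coxeter graph: a second occurrence of \<open>s\<close> in a reduced word of \<open>u\<close> would produce
  a longer involutive prefix \<open>s v s\<close>, and positivity of the form then forces the word, stripped of
  its two ends, to begin and end with a single neighbour of \<open>s\<close> and of \<open>opp s\<close> that is not repeated.\<close>

section \<open>Words, lengths and the exchange condition\<close>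

text \<open>No classification of finite Coxeter groups is used. Finiteness enters through the
  longest element and through averaging a scalar product over the group, which together with
  irreducibility makes the canonical form positive definite; a forbidden configuration is excluded
  by a nonzero vector of nonpositive norm. The opposition permutes \<open>R\<close> and preserves
  the Cartan entries, so a multiple edge comes with its image: the two joined by a path, or one
  fixed edge joined to a swapped pair, already contain an affine diagram. An edge swapped by the
  opposition is the exception: the Coxeter graph of type F4 has such a symmetry and is positive, so
  for even labels a parity character separating the two ends is used instead. Being simply laced
  then makes root coordinates integers, so that a positive one is at least 1; the sharp estimates
  rest on this. Inner occurrences of \<open>s\<close> and of \<open>opp s\<close> are excluded by
  one lemma, since a reduced word of \<open>u\<close>, reversed and mapped by \<open>opp\<close>, is
  again a reduced word of \<open>u\<close>.\<close>

declare in_listsI [rule del] in_listsD [rule del]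

lemma rev_in_lists_iff [simp]: "rev w \<in> lists A \<longleftrightarrow> w \<in> lists A"
  by (simp add: in_lists_conv_set)

lemma take_in_lists [simp]: "w \<in> lists A \<Longrightarrow> take i w \<in> lists A"
  by (auto simp: in_lists_conv_set dest: in_set_takeD)

lemma drop_in_lists [simp]: "w \<in> lists A \<Longrightarrow> drop i w \<in> lists A"
  by (auto simp: in_lists_conv_set dest: in_set_dropD)

lemma sum_lessThan_add:
  fixes f :: "nat \<Rightarrow> 'c::comm_monoid_add"
  shows "(\<Sum>i<a + b. f i) = (\<Sum>i<a. f i) + (\<Sum>i<b. f (a + i))"
  by (induction b) (simp_all add: add.assoc)

context coxeter_system
begin

abbreviation ev :: "'a list \<Rightarrow> 'a" where "ev \<equiv> word_val G"
abbreviation len :: "'a \<Rightarrow> nat" where "len \<equiv> cox_length G R"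

lemma ev_Nil [simp]: "ev [] = \<one>"
  and ev_Cons [simp]: "ev (r # w) = r \<otimes> ev w"
  by (simp_all add: word_val_def)

lemma inv_mult_cancel [simp]:
  "x \<in> carrier G \<Longrightarrow> y \<in> carrier G \<Longrightarrow> inv x \<otimes> (x \<otimes> y) = y"
  "x \<in> carrier G \<Longrightarrow> y \<in> carrier G \<Longrightarrow> x \<otimes> (inv x \<otimes> y) = y"
  by (simp_all flip: m_assoc)

lemma gen_closed [simp]: "r \<in> R \<Longrightarrow> r \<in> carrier G"
  using R_closed by auto

lemma ev_closed [simp]: "w \<in> lists R \<Longrightarrow> ev w \<in> carrier G"
  by (induction w) auto

lemma ev_append [simp]: "u \<in> lists R \<Longrightarrow> v \<in> lists R \<Longrightarrow> ev (u @ v) = ev u \<otimes> ev v"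
  by (induction u) (auto simp: m_assoc)

lemma relator_in_lists: "r \<in> R \<Longrightarrow> s \<in> R \<Longrightarrow> relator m r s \<in> lists R"
  by (auto simp: relator_def in_lists_conv_set)

lemma ev_relator: "r \<in> R \<Longrightarrow> s \<in> R \<Longrightarrow> ev (relator m r s) = \<one>"
proof -
  assume "r \<in> R" "s \<in> R"
  then have "insert_relator R m [] (relator m r s)"
    unfolding insert_relator_def by force
  then have "coxeter_equiv R m [] (relator m r s)"
    unfolding coxeter_equiv_def by blast
  with presentation[of "[]" "relator m r s"] relator_in_lists \<open>r \<in> R\<close> \<open>s \<in> R\<close>
  show ?thesis by auto
qed

lemma m_diag: "r \<in> R \<Longrightarrow> m r r = 1"
  using coxeter_matrix by (auto simp: coxeter_matrix_def)

lemma m_sym: "r \<in> R \<Longrightarrow> s \<in> R \<Longrightarrow> m r s = m s r"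
  using coxeter_matrix by (auto simp: coxeter_matrix_def)

lemma m_off_diag: "r \<in> R \<Longrightarrow> s \<in> R \<Longrightarrow> r \<noteq> s \<Longrightarrow> m r s = 0 \<or> m r s \<ge> 2"
  using coxeter_matrix by (auto simp: coxeter_matrix_def)

lemma gen_sq [simp]: "r \<in> R \<Longrightarrow> r \<otimes> r = \<one>"
  using ev_relator[of r r] by (simp add: m_diag relator_def)

lemma gen_inv [simp]: "r \<in> R \<Longrightarrow> inv r = r"
  by (simp add: inv_equality)

lemma gen_cancel [simp]: "r \<in> R \<Longrightarrow> x \<in> carrier G \<Longrightarrow> r \<otimes> (r \<otimes> x) = x"
  by (simp flip: m_assoc)

lemma gen_cancel_right [simp]: "r \<in> R \<Longrightarrow> x \<in> carrier G \<Longrightarrow> x \<otimes> r \<otimes> r = x"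
  by (simp add: m_assoc)

lemma ev_rev: "w \<in> lists R \<Longrightarrow> ev (rev w) = inv (ev w)"
  by (induction w) (auto simp: inv_mult_group)

lemma ex_word: "x \<in> carrier G \<Longrightarrow> \<exists>w\<in>lists R. ev w = x"
proof -
  assume "x \<in> carrier G"
  then have "x \<in> generate G R" by (simp add: generated)
  then show ?thesis
  proof induction
    case one
    show ?case by (intro bexI[of _ "[]"]) auto
  next
    case (incl h)
    then show ?case by (intro bexI[of _ "[h]"]) auto
  next
    case (inv h)
    then show ?case by (intro bexI[of _ "[h]"]) auto
  next
    case (eng h1 h2)
    then show ?case by (metis append_in_lists_conv ev_append)
  qed
qed

section \<open>The reflection cocycle and the exchange condition\<close>

text \<open>The number of times the reflection \<open>t\<close> occurs among
  \<open>s\<^sub>1 \<cdots> s\<^sub>i\<^sub>-\<^sub>1 s\<^sub>i s\<^sub>i\<^sub>-\<^sub>1 \<cdots> s\<^sub>1\<close>. Only its parity depends on the group element alone.\<close>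

primrec refl_count :: "'a list \<Rightarrow> 'a \<Rightarrow> nat" where
  "refl_count [] t = 0"
| "refl_count (r # w) t = (if t = r then 1 else 0) + refl_count w (r \<otimes> t \<otimes> r)"

text \<open>The letters after \<open>p\<close> contribute reflections conjugated by
  \<open>ev p\<close>, so \<open>t\<close> is conjugated back before it is counted in
  \<open>q\<close>. When \<open>p\<close> has value \<open>\<one>\<close> the shift
  disappears.\<close>

lemma refl_count_append:
  "p \<in> lists R \<Longrightarrow> t \<in> carrier G \<Longrightarrow>
    refl_count (p @ q) t = refl_count p t + refl_count q (inv (ev p) \<otimes> t \<otimes> ev p)"
  by (induction p arbitrary: t) (auto simp: inv_mult_group m_assoc)

text \<open>Conjugating each letter of the alternating word by the letters before it gives the
  reflections \<open>(r \<otimes> s) [^] i \<otimes> r\<close>, one for each position. Peeling off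
  two letters shifts \<open>i\<close> by 2, which is the content of \<open>eq2\<close>.\<close>

lemma refl_count_alternating:
  assumes "r \<in> R" "s \<in> R" "t \<in> carrier G"
  shows "refl_count (concat (replicate k [r, s])) t =
    (\<Sum>i<2 * k. if t = (r \<otimes> s) [^] i \<otimes> r then 1 else 0)"
  using assms(3)
proof (induction k arbitrary: t)
  case (Suc k)
  have eq1: "r \<otimes> t \<otimes> r = s \<longleftrightarrow> t = (r \<otimes> s) [^] (1::nat) \<otimes> r"
    using assms Suc.prems by (auto simp: m_assoc) 
  have eq2: "s \<otimes> (r \<otimes> t \<otimes> r) \<otimes> s = (r \<otimes> s) [^] i \<otimes> r \<longleftrightarrow> t = (r \<otimes> s) [^] (Suc (Suc i)) \<otimes> r"
    for i :: nat
  proof -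
    define c where "c = r \<otimes> s"
    have c: "c \<in> carrier G" "inv c = s \<otimes> r" and rc: "r \<otimes> inv c = c \<otimes> r"
      using assms by (auto simp: c_def inv_mult_group m_assoc)
    have "s \<otimes> (r \<otimes> t \<otimes> r) \<otimes> s = inv c \<otimes> t \<otimes> c"
      using assms Suc.prems by (simp add: c(2) m_assoc) (simp add: c_def m_assoc)
    moreover have "inv c \<otimes> t \<otimes> c = c [^] i \<otimes> r \<longleftrightarrow> t = c \<otimes> (c [^] i \<otimes> r) \<otimes> inv c"
    proof
      assume "inv c \<otimes> t \<otimes> c = c [^] i \<otimes> r"
      then have "c \<otimes> (c [^] i \<otimes> r) \<otimes> inv c = c \<otimes> (inv c \<otimes> t \<otimes> c) \<otimes> inv c"
        by simp
      then show "t = c \<otimes> (c [^] i \<otimes> r) \<otimes> inv c"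
        using c(1) Suc.prems by (simp add: m_assoc)
    next
      assume "t = c \<otimes> (c [^] i \<otimes> r) \<otimes> inv c"
      then show "inv c \<otimes> t \<otimes> c = c [^] i \<otimes> r"
        using c(1) assms by (simp add: m_assoc)
    qed
    moreover have "c \<otimes> (c [^] i \<otimes> r) \<otimes> inv c = c [^] (Suc (Suc i)) \<otimes> r"
    proof -
      have "c \<otimes> (c [^] i \<otimes> r) \<otimes> inv c = c \<otimes> c [^] i \<otimes> (r \<otimes> inv c)"
        using c(1) assms by (simp add: m_assoc)
      also have "\<dots> = (c \<otimes> c [^] i) \<otimes> c \<otimes> r"
        using c(1) assms by (simp only: rc) (simp add: m_assoc)
      finally show ?thesis
        using c(1) by (simp add: nat_pow_Suc2[symmetric])
    qed
    ultimately show ?thesis unfolding c_def by simp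
  qed
  have "refl_count (concat (replicate (Suc k) [r, s])) t =
     (if t = r then 1 else 0) + ((if r \<otimes> t \<otimes> r = s then 1 else 0) +
      refl_count (concat (replicate k [r, s])) (s \<otimes> (r \<otimes> t \<otimes> r) \<otimes> s))"
    by simp
  also have "\<dots> = (\<Sum>i<2 * Suc k. if t = (r \<otimes> s) [^] i \<otimes> r then 1 else 0)"
    using assms Suc by (simp add: eq1 eq2 sum.lessThan_Suc_shift del: sum.lessThan_Suc)
  finally show ?case .
qed simp

text \<open>As \<open>(r \<otimes> s) [^] m r s\<close> is \<open>\<one>\<close>, the
  \<open>2 * m r s\<close> reflections of a relator are the same \<open>m r s\<close> reflections
  listed twice.\<close>

lemma even_refl_count_relator:
  assumes "r \<in> R" "s \<in> R" "t \<in> carrier G"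
  shows "even (refl_count (relator m r s) t)"
proof -
  let ?f = "\<lambda>i. if t = (r \<otimes> s) [^] i \<otimes> r then 1 else (0::nat)"
  have ev_alt: "ev (concat (replicate k [r, s])) = (r \<otimes> s) [^] k" for k
  proof (induction k)
    case (Suc k)
    then show ?case
      using assms nat_pow_Suc2[of "r \<otimes> s" k] by (simp add: m_assoc del: nat_pow_Suc)
  qed simp
  have one: "(r \<otimes> s) [^] m r s = \<one>"
    using ev_relator[OF assms(1,2)] ev_alt by (simp add: relator_def)
  have "(r \<otimes> s) [^] (m r s + i) = (r \<otimes> s) [^] i" for i
    using assms one by (simp flip: nat_pow_mult)
  then have per: "?f (m r s + i) = ?f i" for i by presburger
  have "(\<Sum>i<2 * m r s. ?f i) = (\<Sum>i<m r s. ?f i) + (\<Sum>i<m r s. ?f (m r s + i))"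
    unfolding mult_2 by (rule sum_lessThan_add)
  then have "(\<Sum>i<2 * m r s. ?f i) = 2 * (\<Sum>i<m r s. ?f i)"
    by (simp only: per)
  then show ?thesis
    using refl_count_alternating[OF assms] by (simp add: relator_def)
qed

text \<open>A relator contributes an even number and has value \<open>\<one>\<close>, so inserting
  it shifts nothing behind it.\<close>

lemma even_refl_count_cong:
  assumes "u \<in> lists R" "v \<in> lists R" "ev u = ev v" "t \<in> carrier G"
  shows "even (refl_count u t) = even (refl_count v t)"
proof -
  have ins: "even (refl_count x t) = even (refl_count y t)" if "insert_relator R m x y" for x y
  proof -
    obtain p q r s where *: "p \<in> lists R" "q \<in> lists R" "r \<in> R" "s \<in> R"
      "x = p @ q" "y = p @ relator m r s @ q"
      using \<open>insert_relator R m x y\<close> by (auto simp: insert_relator_def)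
    then show ?thesis
      using assms(4) even_refl_count_relator[OF *(3,4), of "inv (ev p) \<otimes> t \<otimes> ev p"]
        relator_in_lists[OF *(3,4)]
      by (simp add: refl_count_append ev_relator m_assoc)
  qed
  have "coxeter_equiv R m u v"
    using presentation assms by blast
  then have "equivclp (insert_relator R m) u v"
    by (simp add: coxeter_equiv_def)
  then show ?thesis
    by (induction rule: equivclp_induct) (use ins in blast)+
qed

text \<open>If \<open>t\<close> is counted at position \<open>i\<close>, then
  \<open>t = p \<otimes> r \<otimes> inv p\<close>, with \<open>p\<close> the value of the letters
  before \<open>i\<close> and \<open>r\<close> the letter itself; multiplying by \<open>t\<close> on
  the left cancels that letter.\<close>

lemma refl_count_deletion:
  assumes "w \<in> lists R" "t \<in> carrier G" "refl_count w t > 0"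
  shows "\<exists>i<length w. t \<otimes> ev w = ev (take i w @ drop (Suc i) w)"
  using assms
proof (induction w arbitrary: t)
  case (Cons r w)
  show ?case
  proof (cases "t = r")
    case True
    then have "t \<otimes> ev (r # w) = ev w" using Cons.hyps by simp
    then show ?thesis by (auto intro!: exI[of _ "0::nat"])
  next
    case False
    then obtain i where i: "i < length w" "(r \<otimes> t \<otimes> r) \<otimes> ev w = ev (take i w @ drop (Suc i) w)"
      using Cons.IH[of "r \<otimes> t \<otimes> r"] Cons.hyps Cons.prems by auto
    have "r \<otimes> ((r \<otimes> t \<otimes> r) \<otimes> ev w) = t \<otimes> ev (r # w)"
      using Cons.prems Cons.hyps by (simp add: m_assoc)
    then show ?thesis
      using i by (intro exI[of _ "Suc i"]) (metis append_Cons drop_Suc_Cons ev_Cons length_Cons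
          not_less_eq take_Suc_Cons)
  qed
qed simp

section \<open>Length and reduced words\<close>

lemma len_le: "w \<in> lists R \<Longrightarrow> len (ev w) \<le> length w"
  unfolding cox_length_def by (intro Least_le) auto

definition reduced :: "'a list \<Rightarrow> bool" where
  "reduced w \<longleftrightarrow> w \<in> lists R \<and> len (ev w) = length w"

lemma ex_reduced: "x \<in> carrier G \<Longrightarrow> \<exists>w. reduced w \<and> ev w = x"
proof -
  assume "x \<in> carrier G"
  then have "\<exists>k. \<exists>w\<in>lists R. length w = k \<and> ev w = x"
    using ex_word by blast
  from LeastI_ex[OF this] show ?thesis
    unfolding reduced_def cox_length_def[symmetric] by auto
qed

lemma len_one [simp]: "len \<one> = 0"
  using len_le[of "[]"] by simp

lemma len_eq_0_iff: "x \<in> carrier G \<Longrightarrow> len x = 0 \<longleftrightarrow> x = \<one>"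
  using ex_reduced[of x] by (auto simp: reduced_def)

lemma len_eq_1: "x \<in> carrier G \<Longrightarrow> len x = 1 \<Longrightarrow> x \<in> R"
  using ex_reduced[of x] by (auto simp: reduced_def length_Suc_conv)

lemma len_inv [simp]: "x \<in> carrier G \<Longrightarrow> len (inv x) = len x"
proof -
  have "len (inv y) \<le> len y" if y: "y \<in> carrier G" for y
  proof -
    obtain w where "reduced w" "ev w = y" using ex_reduced[OF y] by blast
    then show ?thesis using len_le[of "rev w"] by (auto simp: reduced_def ev_rev)
  qed
  from this[of x] this[of "inv x"] show "x \<in> carrier G \<Longrightarrow> ?thesis" by simp
qed

lemma len_mult_le: "x \<in> carrier G \<Longrightarrow> y \<in> carrier G \<Longrightarrow> len (x \<otimes> y) \<le> len x + len y"
proof -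
  assume xy: "x \<in> carrier G" "y \<in> carrier G"
  obtain u where "reduced u" "ev u = x" using ex_reduced[OF xy(1)] by blast
  moreover obtain v where "reduced v" "ev v = y" using ex_reduced[OF xy(2)] by blast
  ultimately show ?thesis using len_le[of "u @ v"] by (auto simp: reduced_def)
qed

lemma len_gen_le: "r \<in> R \<Longrightarrow> len r \<le> 1"
  using len_le[of "[r]"] by (simp add: Cons_in_lists_iff del: One_nat_def)

text \<open>An odd count persists in a reduced word of the same element, where it is positive and
  allows a deletion. For an even count the word \<open>s # w\<close> has an odd one, and the first
  case applies to it.\<close>

lemma left_descent_iff_odd:
  assumes "w \<in> lists R" "s \<in> R"
  shows "len (s \<otimes> ev w) < len (ev w) \<longleftrightarrow> odd (refl_count w s)"
    and "len (s \<otimes> ev w) \<noteq> len (ev w)"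
proof -
  have odd_less: "len (s \<otimes> ev v) < len (ev v)" if v: "v \<in> lists R" "odd (refl_count v s)" for v
  proof -
    obtain v' where v': "reduced v'" "ev v' = ev v" using ex_reduced[of "ev v"] v by auto
    then have "odd (refl_count v' s)"
      using even_refl_count_cong[of v' v s] v assms by (auto simp: reduced_def)
    then obtain i where "i < length v'" "s \<otimes> ev v' = ev (take i v' @ drop (Suc i) v')"
      using refl_count_deletion[of v' s] v' assms by (auto simp: reduced_def odd_pos)
    moreover have "take i v' @ drop (Suc i) v' \<in> lists R"
      using v' by (simp add: reduced_def)
    ultimately show ?thesis
      using v' len_le[of "take i v' @ drop (Suc i) v'"] by (auto simp: reduced_def)
  qed
  have "len (ev w) < len (s \<otimes> ev w)" if "even (refl_count w s)"
    using odd_less[of "s # w"] that assms by (simp add: m_assoc)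
  with odd_less[OF assms(1)] show "len (s \<otimes> ev w) < len (ev w) \<longleftrightarrow> odd (refl_count w s)"
    and "len (s \<otimes> ev w) \<noteq> len (ev w)" by (cases "even (refl_count w s)"; simp)+
qed

lemma len_gen_mult_cases:
  assumes "x \<in> carrier G" "s \<in> R"
  shows "len (s \<otimes> x) = len x + 1 \<or> len x = len (s \<otimes> x) + 1"
proof -
  obtain w where w: "reduced w" "ev w = x" using ex_reduced assms by blast
  have "len (s \<otimes> x) \<le> len x + 1"
    using len_mult_le[of s x] len_gen_le[of s] assms by auto
  moreover have "len x \<le> len (s \<otimes> x) + 1"
    using len_mult_le[of s "s \<otimes> x"] len_gen_le[of s] assms by auto
  moreover have "len (s \<otimes> x) \<noteq> len x"
    using left_descent_iff_odd(2)[of w s] w assms by (auto simp: reduced_def)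
  ultimately show ?thesis by linarith
qed

lemma len_mult_gen_cases:
  assumes "x \<in> carrier G" "s \<in> R"
  shows "len (x \<otimes> s) = len x + 1 \<or> len x = len (x \<otimes> s) + 1"
proof -
  have "len (x \<otimes> s) = len (s \<otimes> inv x)"
    using assms len_inv[of "x \<otimes> s"] by (simp add: inv_mult_group)
  then show ?thesis
    using len_gen_mult_cases[of "inv x" s] assms by simp
qed

lemma exchange:
  assumes "w \<in> lists R" "s \<in> R" "len (s \<otimes> ev w) < len (ev w)"
  shows "\<exists>i<length w. s \<otimes> ev w = ev (take i w @ drop (Suc i) w)"
proof (rule refl_count_deletion)
  show "refl_count w s > 0"
    using left_descent_iff_odd(1)[OF assms(1,2)] assms(3) odd_pos by blast
qed (use assms in simp_all)

lemma exchange_right: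
  assumes "w \<in> lists R" "s \<in> R" "len (ev w \<otimes> s) < len (ev w)"
  shows "\<exists>i<length w. ev w \<otimes> s = ev (take i w @ drop (Suc i) w)"
proof -
  have "len (s \<otimes> ev (rev w)) < len (ev (rev w))"
    using assms len_inv[of "ev w \<otimes> s"] by (simp add: ev_rev inv_mult_group)
  then obtain i where i: "i < length w" "s \<otimes> ev (rev w) = ev (take i (rev w) @ drop (Suc i) (rev w))"
    using exchange[of "rev w" s] assms by auto
  let ?j = "length w - Suc i"
  have l: "take ?j w @ drop (Suc ?j) w \<in> lists R"
    using assms by simp
  have "take i (rev w) @ drop (Suc i) (rev w) = rev (take ?j w @ drop (Suc ?j) w)"
    using i by (simp add: take_rev drop_rev Suc_diff_Suc)
  then have "s \<otimes> inv (ev w) = inv (ev (take ?j w @ drop (Suc ?j) w))"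
    using i ev_rev[OF l] ev_rev[OF assms(1)] by metis
  then have "ev w \<otimes> s = ev (take ?j w @ drop (Suc ?j) w)"
    using assms l inv_mult_group[of s "inv (ev w)"] by simp
  then show ?thesis using i by (intro exI[of _ ?j]) auto
qed

lemma len_gen [simp]: "r \<in> R \<Longrightarrow> len r = 1"
  using len_gen_mult_cases[of \<one> r] by auto

lemma gen_neq_one [simp]: "r \<in> R \<Longrightarrow> r \<noteq> \<one>"
  using len_gen by fastforce

lemma reduced_Nil [simp]: "reduced []"
  by (simp add: reduced_def)

lemma reduced_in_lists: "reduced w \<Longrightarrow> w \<in> lists R"
  by (simp add: reduced_def)

lemma reduced_append: "reduced (u @ v) \<Longrightarrow> reduced u \<and> reduced v"
  using len_mult_le[of "ev u" "ev v"] len_le[of u] len_le[of v] by (auto simp: reduced_def)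

lemma reduced_ConsD: "reduced (r # w) \<Longrightarrow> reduced w"
  using reduced_append[of "[r]" w] by simp

lemma reduced_rev [simp]: "reduced (rev w) = reduced w"
  by (auto simp: reduced_def ev_rev)

lemma reduced_Cons_iff:
  "reduced (r # w) \<longleftrightarrow> r \<in> R \<and> reduced w \<and> len (ev w) < len (r \<otimes> ev w)"
  using reduced_ConsD[of r w] len_gen_mult_cases[of "ev w" r]
  by (auto simp: reduced_def)

lemma reduced_snoc_iff:
  "reduced (w @ [r]) \<longleftrightarrow> r \<in> R \<and> reduced w \<and> len (ev w) < len (ev w \<otimes> r)"
  using reduced_append[of w "[r]"] len_mult_gen_cases[of "ev w" r]
  by (auto simp: reduced_def)

text \<open>This is the right weak order.\<close>

definition prefix_of :: "'a \<Rightarrow> 'a \<Rightarrow> bool" where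
  "prefix_of y u \<longleftrightarrow> len y + len (inv y \<otimes> u) = len u"

lemma prefix_ofI:
  assumes "y \<in> carrier G" "z \<in> carrier G" "len y + len z \<le> len (y \<otimes> z)"
  shows "prefix_of y (y \<otimes> z)"
  using assms len_mult_le[of y z] by (simp add: prefix_of_def m_assoc[symmetric])

lemma prefix_of_gen_iff: "r \<in> R \<Longrightarrow> u \<in> carrier G \<Longrightarrow> prefix_of r u \<longleftrightarrow> len (r \<otimes> u) < len u"
  using len_gen_mult_cases[of u r] by (auto simp: prefix_of_def)

lemma prefix_of_trans:
  assumes "x \<in> carrier G" "y \<in> carrier G" "z \<in> carrier G" "prefix_of x y" "prefix_of y z"
  shows "prefix_of x z"
proof -
  have "len (inv x \<otimes> z) \<le> len (inv x \<otimes> y) + len (inv y \<otimes> z)"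
    using len_mult_le[of "inv x \<otimes> y" "inv y \<otimes> z"] assms
    by (simp add: m_assoc)
  moreover have "len z \<le> len x + len (inv x \<otimes> z)"
    using len_mult_le[of x "inv x \<otimes> z"] assms by (simp flip: m_assoc)
  ultimately show ?thesis using assms by (simp add: prefix_of_def)
qed

lemma prefix_of_reduced_append:
  assumes "reduced (u @ v)"
  shows "prefix_of (ev u) (ev (u @ v))"
  using assms reduced_append[OF assms] prefix_ofI[of "ev u" "ev v"]
  by (auto simp: reduced_def)

lemma ex_left_descent:
  assumes "x \<in> carrier G" "x \<noteq> \<one>"
  obtains r where "r \<in> R" "len (r \<otimes> x) < len x"
proof -
  obtain w where w: "reduced w" "ev w = x" using assms ex_reduced by blast
  then obtain r v where "w = r # v" using assms by (cases w) auto
  with w show ?thesis using that[of r] by (auto simp: reduced_Cons_iff reduced_in_lists)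
qed

lemma reduced_word_starting:
  assumes "x \<in> carrier G" "r \<in> R" "len (r \<otimes> x) < len x"
  obtains w where "reduced (r # w)" "ev (r # w) = x"
proof -
  obtain w where "reduced w" "ev w = r \<otimes> x" using assms ex_reduced[of "r \<otimes> x"] by auto
  then show ?thesis using that[of w] assms by (simp add: reduced_Cons_iff)
qed

lemma involutions_iff: "x \<in> involutions G \<longleftrightarrow> x \<in> carrier G \<and> x \<noteq> \<one> \<and> x \<otimes> x = \<one>"
proof -
  have "ord x = 2 \<longleftrightarrow> x \<noteq> \<one> \<and> x \<otimes> x = \<one>" if x: "x \<in> carrier G"
  proof
    assume o: "ord x = 2"
    then have "x [^] (2::nat) = \<one>" using x pow_ord_eq_1[OF x] by simp
    with o x show "x \<noteq> \<one> \<and> x \<otimes> x = \<one>" by (auto simp: numeral_2_eq_2)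
  next
    assume a: "x \<noteq> \<one> \<and> x \<otimes> x = \<one>"
    then have "x [^] (2::nat) = \<one>" using x by (simp add: numeral_2_eq_2)
    then have d: "ord x dvd 2" using x pow_eq_id by blast
    have "ord x \<noteq> 0" using d by (intro notI) simp
    moreover have "ord x \<le> 2" using d by (simp add: dvd_imp_le)
    moreover have "ord x \<noteq> 1" using a x ord_eq_1 by auto
    ultimately show "ord x = 2" by linarith
  qed
  then show ?thesis by (auto simp: involutions_def)
qed

lemma gen_involution [simp]: "r \<in> R \<Longrightarrow> r \<in> involutions G"
  by (simp add: involutions_iff)

end

section \<open>The longest element and the opposition\<close>

locale finite_coxeter_system = coxeter_system +
  assumes finite_carrier: "finite (carrier G)"
begin

lemma finite_R: "finite R"
  using R_closed finite_carrier finite_subset by blast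

lemma ex_longest: "\<exists>x. x \<in> carrier G \<and> (\<forall>y\<in>carrier G. len y \<le> len x)"
proof -
  have "finite (len ` carrier G)" "len ` carrier G \<noteq> {}"
    using finite_carrier by auto
  then have "Max (len ` carrier G) \<in> len ` carrier G" by (rule Max_in)
  then obtain x where "x \<in> carrier G" "Max (len ` carrier G) = len x" by blast
  then show ?thesis
    using Max_ge[OF \<open>finite (len ` carrier G)\<close>] by (intro exI[of _ x]) auto
qed

definition w0 :: 'a where
  "w0 = (SOME x. x \<in> carrier G \<and> (\<forall>y\<in>carrier G. len y \<le> len x))"

lemma w0_closed [simp]: "w0 \<in> carrier G"
  and w0_max: "y \<in> carrier G \<Longrightarrow> len y \<le> len w0"
  using someI_ex[OF ex_longest] unfolding w0_def by auto

lemma w0_left_descent: "r \<in> R \<Longrightarrow> len (r \<otimes> w0) < len w0"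
  using w0_max[of "r \<otimes> w0"] len_gen_mult_cases[of w0 r] by force

text \<open>Multiplying by \<open>r\<close> deletes a letter from the reduced word
  \<open>w @ v\<close> of \<open>w0\<close>. It cannot be a letter of \<open>w\<close>, since
  \<open>r # w\<close> would then have a shorter expression; so it lies in \<open>v\<close>, and
  putting \<open>r\<close> in front restores the length.\<close>

lemma w0_reduced_extend:
  assumes "reduced w"
  shows "\<exists>v. reduced (w @ v) \<and> ev (w @ v) = w0"
  using assms
proof (induction w)
  case Nil
  then show ?case using ex_reduced[of w0] by auto
next
  case (Cons r w)
  then obtain v where v: "reduced (w @ v)" "ev (w @ v) = w0" using reduced_ConsD by blast
  have r: "r \<in> R" using Cons.prems by (simp add: reduced_Cons_iff)
  then obtain i where i: "i < length (w @ v)"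
    "r \<otimes> ev (w @ v) = ev (take i (w @ v) @ drop (Suc i) (w @ v))"
    using exchange[of "w @ v" r] w0_left_descent[of r] v reduced_in_lists by force
  have lists: "w \<in> lists R" "v \<in> lists R" using v by (auto dest: reduced_in_lists)
  show ?case
  proof (cases "i < length w")
    case True
    let ?w' = "take i w @ drop (Suc i) w"
    have l': "?w' \<in> lists R" using lists by simp
    have "r \<otimes> ev w \<otimes> ev v = ev (?w' @ v)"
      using i True lists r by (simp add: m_assoc)
    also have "\<dots> = ev ?w' \<otimes> ev v" using l' lists by (simp only: ev_append)
    finally have "ev (r # w) = ev ?w'" using l' lists r by simp
    then have "len (ev (r # w)) \<le> length ?w'" using len_le[OF l'] by simp
    with True Cons.prems show ?thesis by (simp add: reduced_def)
  next
    case False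
    let ?v' = "take (i - length w) v @ drop (Suc i - length w) v"
    have l': "?v' \<in> lists R" using lists by simp
    have "r \<otimes> w0 = ev (w @ ?v')"
      using i False v by simp
    then have "r \<otimes> (r \<otimes> w0) = ev ((r # w) @ ?v')" by simp
    then have eq: "ev ((r # w) @ ?v') = w0" using r by simp
    moreover have "length ((r # w) @ ?v') = length (w @ v)"
      using i False by simp
    ultimately have "reduced ((r # w) @ ?v')"
      using v l' lists r by (simp add: reduced_def)
    with eq show ?thesis by blast
  qed
qed

lemma len_w0_diff: "x \<in> carrier G \<Longrightarrow> len (inv x \<otimes> w0) + len x = len w0"
proof -
  assume x: "x \<in> carrier G"
  then obtain w where w: "reduced w" "ev w = x" using ex_reduced by blast
  then obtain v where "reduced (w @ v)" "ev (w @ v) = w0" using w0_reduced_extend by blast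
  then have "prefix_of x w0" using prefix_of_reduced_append[of w v] w by simp
  then show ?thesis by (simp add: prefix_of_def)
qed

lemma w0_sq [simp]: "w0 \<otimes> w0 = \<one>"
  using len_w0_diff[of "inv w0"] len_eq_0_iff[of "w0 \<otimes> w0"] by simp

lemma w0_inv [simp]: "inv w0 = w0"
  by (simp add: inv_equality)

lemma w0_cancel [simp]: "x \<in> carrier G \<Longrightarrow> w0 \<otimes> (w0 \<otimes> x) = x"
  by (simp flip: m_assoc)

lemma len_mult_w0: "x \<in> carrier G \<Longrightarrow> len (x \<otimes> w0) + len x = len w0"
  using len_w0_diff[of "inv x"] by simp

lemma len_w0_mult: "x \<in> carrier G \<Longrightarrow> len (w0 \<otimes> x) + len x = len w0"
  using len_mult_w0[of "inv x"] len_inv[of "inv x \<otimes> w0"] by (simp add: inv_mult_group)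

definition opp :: "'a \<Rightarrow> 'a" where
  "opp x = w0 \<otimes> x \<otimes> w0"

lemma opp_closed [simp]: "x \<in> carrier G \<Longrightarrow> opp x \<in> carrier G"
  by (simp add: opp_def)

lemma opp_one [simp]: "opp \<one> = \<one>"
  by (simp add: opp_def)

lemma opp_mult: "x \<in> carrier G \<Longrightarrow> y \<in> carrier G \<Longrightarrow> opp (x \<otimes> y) = opp x \<otimes> opp y"
  by (simp add: opp_def m_assoc)

lemma opp_opp [simp]: "x \<in> carrier G \<Longrightarrow> opp (opp x) = x"
  by (simp add: opp_def m_assoc)

lemma len_opp [simp]: "x \<in> carrier G \<Longrightarrow> len (opp x) = len x"
  using len_mult_w0[of "w0 \<otimes> x"] len_w0_mult[of x] by (simp add: opp_def)

lemma opp_gen [simp]: "r \<in> R \<Longrightarrow> opp r \<in> R"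
  using len_eq_1[of "opp r"] by simp

lemma opp_word: "w \<in> lists R \<Longrightarrow> map opp w \<in> lists R \<and> ev (map opp w) = opp (ev w)"
  by (induction w) (auto simp: opp_mult)

lemma reduced_map_opp: "reduced w \<Longrightarrow> reduced (map opp w)"
  using opp_word[of w] by (simp add: reduced_def)

end

section \<open>The geometric representation\<close>

context coxeter_system
begin

text \<open>For \<open>m r s = 0\<close>, which encodes \<open>\<infinity>\<close>, division by zero yields the required value \<open>-2\<close>.\<close>

definition cart :: "'a \<Rightarrow> 'a \<Rightarrow> real" where
  "cart r s = - 2 * cos (pi / real (m r s))"

text \<open>Vectors are functions on the whole type, read as coordinates with respect to the simple
  roots \<open>alpha r\<close>. This is the pairing with the simple coroot of
  \<open>r\<close>.\<close>

definition coroot :: "'a \<Rightarrow> ('a \<Rightarrow> real) \<Rightarrow> real" where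
  "coroot r v = (\<Sum>s\<in>R. cart r s * v s)"

text \<open>Twice the usual canonical form, so that simple roots have norm 2 and
  \<open>coroot s\<close> is the pairing with \<open>alpha s\<close>.\<close>

definition form :: "('a \<Rightarrow> real) \<Rightarrow> ('a \<Rightarrow> real) \<Rightarrow> real" where
  "form x y = (\<Sum>r\<in>R. x r * coroot r y)"

definition alpha :: "'a \<Rightarrow> 'a \<Rightarrow> real" where
  "alpha r = (\<lambda>i. if i = r then 1 else 0)"

definition refl :: "'a \<Rightarrow> ('a \<Rightarrow> real) \<Rightarrow> 'a \<Rightarrow> real" where
  "refl s v = (\<lambda>i. v i - coroot s v * alpha s i)"

definition act :: "'a list \<Rightarrow> ('a \<Rightarrow> real) \<Rightarrow> 'a \<Rightarrow> real" where
  "act w v = foldr refl w v"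

text \<open>The chosen word does not matter, by \<open>act_cong\<close>. For \<open>x\<close>
  outside the group it is an arbitrary list, so that linearity holds for all
  \<open>x\<close>.\<close>

definition rho :: "'a \<Rightarrow> ('a \<Rightarrow> real) \<Rightarrow> 'a \<Rightarrow> real" where
  "rho x = act (SOME w. w \<in> lists R \<and> ev w = x)"

lemma act_Nil [simp]: "act [] v = v"
  and act_Cons [simp]: "act (s # w) v = refl s (act w v)"
  and act_append [simp]: "act (u @ w) v = act u (act w v)"
  by (simp_all add: act_def)

lemma cart_diag [simp]: "r \<in> R \<Longrightarrow> cart r r = 2"
  by (simp add: cart_def m_diag)

lemma cart_sym: "r \<in> R \<Longrightarrow> s \<in> R \<Longrightarrow> cart r s = cart s r"
  by (simp add: cart_def m_sym)

lemma coroot_add [simp]: "coroot r (\<lambda>i. x i + y i) = coroot r x + coroot r y"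
  and coroot_diff [simp]: "coroot r (\<lambda>i. x i - y i) = coroot r x - coroot r y"
  and coroot_scale [simp]: "coroot r (\<lambda>i. c * x i) = c * coroot r x"
  and coroot_uminus [simp]: "coroot r (\<lambda>i. - x i) = - coroot r x"
  and coroot_zero [simp]: "coroot r (\<lambda>i. 0) = 0"
  by (simp_all add: coroot_def algebra_simps sum.distrib sum_subtractf sum_distrib_left sum_negf)

lemma form_add_left [simp]: "form (\<lambda>i. x i + y i) z = form x z + form y z"
  and form_diff_left [simp]: "form (\<lambda>i. x i - y i) z = form x z - form y z"
  and form_scale_left [simp]: "form (\<lambda>i. c * x i) z = c * form x z"
  and form_zero_left [simp]: "form (\<lambda>i. 0) z = 0"
  and form_add_right [simp]: "form z (\<lambda>i. x i + y i) = form z x + form z y"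
  and form_diff_right [simp]: "form z (\<lambda>i. x i - y i) = form z x - form z y"
  and form_scale_right [simp]: "form z (\<lambda>i. c * x i) = c * form z x"
  and form_zero_right [simp]: "form z (\<lambda>i. 0) = 0"
  by (simp_all add: form_def algebra_simps sum.distrib sum_subtractf sum_distrib_left)

lemma form_sym: "form x y = form y x"
proof -
  have "form x y = (\<Sum>r\<in>R. \<Sum>s\<in>R. x r * (cart r s * y s))"
    by (simp add: form_def coroot_def sum_distrib_left)
  also have "\<dots> = (\<Sum>s\<in>R. \<Sum>r\<in>R. x r * (cart r s * y s))"
    by (rule sum.swap)
  also have "\<dots> = (\<Sum>s\<in>R. \<Sum>r\<in>R. y s * (cart s r * x r))"
    by (intro sum.cong refl) (simp add: cart_sym)
  also have "\<dots> = form y x"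
    by (simp add: form_def coroot_def sum_distrib_left)
  finally show ?thesis .
qed

lemma refl_add: "refl s (\<lambda>i. x i + y i) = (\<lambda>i. refl s x i + refl s y i)"
  and refl_diff: "refl s (\<lambda>i. x i - y i) = (\<lambda>i. refl s x i - refl s y i)"
  and refl_scale: "refl s (\<lambda>i. c * x i) = (\<lambda>i. c * refl s x i)"
  and refl_uminus: "refl s (\<lambda>i. - x i) = (\<lambda>i. - refl s x i)"
  and refl_zero [simp]: "refl s (\<lambda>i. 0) = (\<lambda>i. 0)"
  by (simp_all add: refl_def fun_eq_iff algebra_simps)

lemma act_add: "act w (\<lambda>i. x i + y i) = (\<lambda>i. act w x i + act w y i)"
  and act_diff: "act w (\<lambda>i. x i - y i) = (\<lambda>i. act w x i - act w y i)"
  and act_scale: "act w (\<lambda>i. c * x i) = (\<lambda>i. c * act w x i)"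
  and act_uminus: "act w (\<lambda>i. - x i) = (\<lambda>i. - act w x i)"
  and act_zero: "act w (\<lambda>i. 0) = (\<lambda>i. 0)"
  by (induction w) (simp_all add: refl_add refl_diff refl_scale refl_uminus)

end

section \<open>The dihedral relations in the geometric representation\<close>

lemma two_sin_sin_telescope:
  fixes x d :: real
  shows "2 * sin x * (\<Sum>i<n. sin ((2 * real i + d) * x)) =
    cos ((d - 1) * x) - cos ((2 * real n + d - 1) * x)"
proof (induction n)
  case (Suc n)
  have "2 * sin x * sin ((2 * real n + d) * x) =
      cos ((2 * real n + d) * x - x) - cos ((2 * real n + d) * x + x)"
    by (simp add: cos_add cos_diff)
  also have "(2 * real n + d) * x - x = (2 * real n + d - 1) * x"
    by (simp add: algebra_simps)
  also have "(2 * real n + d) * x + x = (2 * real (Suc n) + d - 1) * x"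
    by (simp add: algebra_simps)
  finally show ?case
    using Suc by (simp add: distrib_left)
qed simp

text \<open>The angles at the two ends of the telescoping sum differ by a full turn; this is the
  vanishing of the sum over the vertices of a regular polygon.\<close>

lemma sum_sin_regular_eq_0:
  assumes "n \<ge> 2"
  shows "(\<Sum>i<n. sin ((2 * real i + d) * (pi / real n))) = 0"
proof -
  have "(2 * real n + d - 1) * (pi / real n) = (d - 1) * (pi / real n) + 2 * pi"
    using assms by (simp add: field_simps)
  then have "2 * sin (pi / real n) * (\<Sum>i<n. sin ((2 * real i + d) * (pi / real n))) = 0"
    unfolding two_sin_sin_telescope by simp
  moreover have "sin (pi / real n) > 0"
    using assms by (intro sin_gt_zero) (simp_all add: field_simps)
  ultimately show ?thesis by simp
qed

context finite_coxeter_system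
begin

lemma coroot_alpha [simp]: "s \<in> R \<Longrightarrow> coroot r (alpha s) = cart r s"
proof -
  assume "s \<in> R"
  have "coroot r (alpha s) = (\<Sum>i\<in>R. if i = s then cart r i else 0)"
    unfolding coroot_def alpha_def by (intro sum.cong) auto
  with \<open>s \<in> R\<close> show ?thesis using finite_R by simp
qed

lemma coroot_refl: "s \<in> R \<Longrightarrow> coroot r (refl s v) = coroot r v - coroot s v * cart r s"
  by (simp add: refl_def)

lemma form_alpha_left [simp]: "s \<in> R \<Longrightarrow> form (alpha s) y = coroot s y"
proof -
  assume "s \<in> R"
  have "form (alpha s) y = (\<Sum>r\<in>R. if r = s then coroot r y else 0)"
    unfolding form_def alpha_def by (intro sum.cong) auto
  with \<open>s \<in> R\<close> show ?thesis using finite_R by simp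
qed

lemma form_alpha_right [simp]: "s \<in> R \<Longrightarrow> form y (alpha s) = coroot s y"
  by (subst form_sym) simp

lemma form_refl [simp]: "s \<in> R \<Longrightarrow> form (refl s x) (refl s y) = form x y"
proof -
  assume s: "s \<in> R"
  have "form (refl s x) (refl s y) = form x (refl s y) - coroot s x * coroot s (refl s y)"
    using s by (subst refl_def) simp
  also have "form x (refl s y) = form x y - coroot s y * coroot s x"
    using s by (simp add: refl_def)
  finally show ?thesis using s by (simp add: coroot_refl)
qed

lemma form_act [simp]: "w \<in> lists R \<Longrightarrow> form (act w x) (act w y) = form x y"
  by (induction w) auto

lemma refl_refl [simp]: "s \<in> R \<Longrightarrow> refl s (refl s v) = v"
  by (subst refl_def, subst coroot_refl) (simp_all add: refl_def)

text \<open>The reflections, applied alternately, subtract multiples of the two simple roots;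
  \<open>S v x\<close> is the multiple at step \<open>x\<close>, counted from 0. It solves the
  recurrence \<open>S v (x + 1) = 2 * cos \<phi> * S v x - S v (x - 1)\<close> with
  \<open>S v 0 = coroot s v\<close> and \<open>S v (-1) = - coroot r v\<close>, hence the
  sines.\<close>

lemma act_alternating:
  assumes rs: "r \<in> R" "s \<in> R" and c: "cart r s = - 2 * cos \<phi>" and "sin \<phi> \<noteq> 0"
  defines "S v x \<equiv> (coroot s v * sin ((x + 1) * \<phi>) + coroot r v * sin (x * \<phi>)) / sin \<phi>"
  shows "act (concat (replicate k [r, s])) v =
      (\<lambda>i. v i - (\<Sum>j<k. S v (2 * real j + 1)) * alpha r i - (\<Sum>j<k. S v (2 * real j)) * alpha s i)
    \<and> coroot s (act (concat (replicate k [r, s])) v) = S v (2 * real k)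
    \<and> coroot r (act (concat (replicate k [r, s])) v) = - S v (2 * real k - 1)"
proof (induction k)
  case 0
  show ?case using \<open>sin \<phi> \<noteq> 0\<close> by (simp add: S_def)
next
  case (Suc k)
  have rec: "2 * cos \<phi> * S v x = S v (x + 1) + S v (x - 1)" for x
  proof -
    have s: "2 * cos \<phi> * sin y = sin (y + \<phi>) + sin (y - \<phi>)" for y
      by (simp add: sin_add sin_diff)
    have "2 * cos \<phi> * S v x =
      (coroot s v * (2 * cos \<phi> * sin ((x + 1) * \<phi>)) + coroot r v * (2 * cos \<phi> * sin (x * \<phi>))) / sin \<phi>"
      by (simp add: S_def algebra_simps)
    also have "\<dots> = S v (x + 1) + S v (x - 1)"
      unfolding s by (simp add: S_def algebra_simps add_divide_distrib)
    finally show ?thesis .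
  qed
  let ?u = "act (concat (replicate k [r, s])) v"
  have c': "cart s r = - 2 * cos \<phi>" using cart_sym rs c by simp
  have IH: "?u = (\<lambda>i. v i - (\<Sum>j<k. S v (2 * real j + 1)) * alpha r i
        - (\<Sum>j<k. S v (2 * real j)) * alpha s i)"
    "coroot s ?u = S v (2 * real k)" "coroot r ?u = - S v (2 * real k - 1)"
    using Suc by auto
  have cr: "coroot r (refl s ?u) = S v (2 * real k + 1)"
    using rec[of "2 * real k"] rs by (simp add: coroot_refl IH(2,3) c algebra_simps)
  have cs: "coroot s (refl s ?u) = - S v (2 * real k)"
    using rs by (simp add: coroot_refl IH(2))
  have e: "act (concat (replicate (Suc k) [r, s])) v = refl r (refl s ?u)"
    by simp
  have e2: "refl r (refl s ?u) =
      (\<lambda>i. ?u i - S v (2 * real k) * alpha s i - S v (2 * real k + 1) * alpha r i)"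
    by (subst refl_def) (simp add: cr, simp add: refl_def IH(2))
  have "refl r (refl s ?u) = (\<lambda>i. v i - (\<Sum>j<Suc k. S v (2 * real j + 1)) * alpha r i
      - (\<Sum>j<Suc k. S v (2 * real j)) * alpha s i)"
    unfolding e2 by (subst IH(1)) (simp add: algebra_simps)
  moreover have "coroot s (refl r (refl s ?u)) = S v (2 * real (Suc k))"
    using rec[of "2 * real k + 1"] rs
    by (simp add: coroot_refl[of r s "refl s ?u"] cr cs c' algebra_simps)
  moreover have "coroot r (refl r (refl s ?u)) = - S v (2 * real (Suc k) - 1)"
    using rs by (simp add: coroot_refl[of r r "refl s ?u"] cr algebra_simps)
  ultimately show ?case unfolding e by blast
qed

lemma act_relator:
  assumes "r \<in> R" "s \<in> R"
  shows "act (relator m r s) v = v"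
proof (cases "r = s")
  case True
  then show ?thesis using assms by (simp add: relator_def m_diag)
next
  case False
  show ?thesis
  proof (cases "m r s = 0")
    case True
    then show ?thesis by (simp add: relator_def)
  next
    case False
    with m_off_diag[OF assms \<open>r \<noteq> s\<close>] have m2: "m r s \<ge> 2" by simp
    let ?\<phi> = "pi / real (m r s)"
    have "sin ?\<phi> > 0"
      using m2 by (intro sin_gt_zero) (simp_all add: field_simps)
    then have nz: "sin ?\<phi> \<noteq> 0" by simp
    \<comment> \<open>\<open>d = 1\<close> yields the coefficient of \<open>alpha r\<close> and
      \<open>d = 0\<close> that of \<open>alpha s\<close>.\<close>
    have z: "(\<Sum>j<m r s. (A * sin ((2 * real j + d + 1) * ?\<phi>) + B * sin ((2 * real j + d) * ?\<phi>)) / sin ?\<phi>) = 0"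
      for A B d
    proof -
      have "(\<Sum>j<m r s. A * sin ((2 * real j + (d + 1)) * ?\<phi>) + B * sin ((2 * real j + d) * ?\<phi>)) = 0"
        unfolding sum.distrib sum_distrib_left[symmetric] sum_sin_regular_eq_0[OF m2] by simp
      then show ?thesis by (simp add: sum_divide_distrib[symmetric] add.assoc)
    qed
    show ?thesis
      unfolding relator_def
      using act_alternating[OF assms _ nz, of "m r s" v] z[of "coroot s v" 1 "coroot r v"]
        z[of "coroot s v" 0 "coroot r v"]
      by (simp add: cart_def)
  qed
qed

lemma act_cong:
  assumes "u \<in> lists R" "v \<in> lists R" "ev u = ev v"
  shows "act u = act v"
proof -
  have ins: "act x = act y" if "insert_relator R m x y" for x y
    using that by (auto simp: insert_relator_def act_relator fun_eq_iff)
  have "coxeter_equiv R m u v"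
    using presentation assms by blast
  then have "equivclp (insert_relator R m) u v"
    by (simp add: coxeter_equiv_def)
  then show ?thesis
  proof (induction rule: equivclp_induct)
    case (step y z)
    then show ?case using ins[of y z] ins[of z y] by auto
  qed simp
qed

lemma rho_ev: "w \<in> lists R \<Longrightarrow> rho (ev w) = act w"
proof -
  assume w: "w \<in> lists R"
  let ?w = "SOME u. u \<in> lists R \<and> ev u = ev w"
  have "?w \<in> lists R \<and> ev ?w = ev w"
    using w by (intro someI[of "\<lambda>u. u \<in> lists R \<and> ev u = ev w" w]) simp
  then show ?thesis
    using act_cong[of ?w w] w by (simp add: rho_def)
qed

lemma rho_gen [simp]: "r \<in> R \<Longrightarrow> rho r = refl r"
  using rho_ev[of "[r]"] by (simp add: fun_eq_iff)

lemma rho_one [simp]: "rho \<one> v = v"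
  using rho_ev[of "[]"] by simp

lemma rho_mult: "x \<in> carrier G \<Longrightarrow> y \<in> carrier G \<Longrightarrow> rho (x \<otimes> y) v = rho x (rho y v)"
proof -
  assume xy: "x \<in> carrier G" "y \<in> carrier G"
  obtain u where "u \<in> lists R" "ev u = x" using ex_word[OF xy(1)] by blast
  moreover obtain w where "w \<in> lists R" "ev w = y" using ex_word[OF xy(2)] by blast
  ultimately show ?thesis
    using rho_ev[of "u @ w"] rho_ev[of u] rho_ev[of w] by auto
qed

lemma rho_inv_cancel [simp]: "x \<in> carrier G \<Longrightarrow> rho (inv x) (rho x v) = v"
  and rho_cancel_inv [simp]: "x \<in> carrier G \<Longrightarrow> rho x (rho (inv x) v) = v"
  by (simp_all flip: rho_mult)

lemma rho_add: "rho x (\<lambda>i. a i + c i) = (\<lambda>i. rho x a i + rho x c i)"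
  and rho_diff: "rho x (\<lambda>i. a i - c i) = (\<lambda>i. rho x a i - rho x c i)"
  and rho_scale: "rho x (\<lambda>i. k * a i) = (\<lambda>i. k * rho x a i)"
  and rho_uminus: "rho x (\<lambda>i. - a i) = (\<lambda>i. - rho x a i)"
  and rho_zero: "rho x (\<lambda>i. 0) = (\<lambda>i. 0)"
  by (simp_all add: rho_def act_add act_diff act_scale act_uminus act_zero)

lemma form_rho [simp]: "x \<in> carrier G \<Longrightarrow> form (rho x a) (rho x c) = form a c"
proof -
  assume "x \<in> carrier G"
  then obtain u where "u \<in> lists R" "ev u = x" using ex_word by blast
  then show ?thesis using rho_ev[of u] by auto
qed

section \<open>An invariant scalar product and positivity of the form\<close>

definition supported :: "('a \<Rightarrow> real) \<Rightarrow> bool" where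
  "supported v \<longleftrightarrow> (\<forall>i. i \<notin> R \<longrightarrow> v i = 0)"

lemma supported_alpha [simp]: "r \<in> R \<Longrightarrow> supported (alpha r)"
  by (auto simp: supported_def alpha_def)

lemma supported_refl [simp]: "s \<in> R \<Longrightarrow> supported v \<Longrightarrow> supported (refl s v)"
  by (auto simp: supported_def alpha_def refl_def)

lemma supported_act [simp]: "w \<in> lists R \<Longrightarrow> supported v \<Longrightarrow> supported (act w v)"
  by (induction w) auto

lemma supported_rho [simp]: "x \<in> carrier G \<Longrightarrow> supported v \<Longrightarrow> supported (rho x v)"
  using ex_word[of x] rho_ev supported_act by fastforce

lemma supported_expand:
  assumes "supported v"
  shows "v = (\<lambda>i. \<Sum>r\<in>R. v r * alpha r i)"
proof
  fix i
  have "(\<Sum>r\<in>R. v r * alpha r i) = (\<Sum>r\<in>R. if r = i then v r else 0)"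
    unfolding alpha_def by (intro sum.cong) auto
  then show "v i = (\<Sum>r\<in>R. v r * alpha r i)"
    using finite_R assms by (simp add: supported_def)
qed

lemma rho_sum: "finite A \<Longrightarrow> rho x (\<lambda>i. \<Sum>r\<in>A. c r * v r i) = (\<lambda>i. \<Sum>r\<in>A. c r * rho x (v r) i)"
  by (induction A rule: finite_induct) (simp_all add: rho_zero rho_add rho_scale)

lemma rho_expand:
  assumes "supported v"
  shows "rho x v i = (\<Sum>r\<in>R. v r * rho x (alpha r) i)"
  by (subst supported_expand[OF assms]) (simp add: rho_sum finite_R)

text \<open>The invariant scalar product that finiteness provides: the dot product of coordinates
  summed over the group. Comparing it with \<open>form\<close> shows the latter to be positive
  definite.\<close>

definition avg_form :: "('a \<Rightarrow> real) \<Rightarrow> ('a \<Rightarrow> real) \<Rightarrow> real" where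
  "avg_form x y = (\<Sum>g\<in>carrier G. \<Sum>i\<in>R. rho g x i * rho g y i)"

lemma avg_form_rho:
  assumes h: "h \<in> carrier G"
  shows "avg_form (rho h x) (rho h y) = avg_form x y"
proof -
  have "avg_form (rho h x) (rho h y) =
      (\<Sum>g\<in>carrier G. \<Sum>i\<in>R. rho (g \<otimes> h) x i * rho (g \<otimes> h) y i)"
    using h by (simp add: avg_form_def rho_mult)
  also have "\<dots> = avg_form x y"
    unfolding avg_form_def
    by (rule sum.reindex_bij_witness[where i = "\<lambda>g. g \<otimes> inv h" and j = "\<lambda>g. g \<otimes> h"])
       (use h in \<open>simp_all add: m_assoc\<close>)
  finally show ?thesis .
qed

lemma avg_form_diff_right: "avg_form x (\<lambda>i. y i - z i) = avg_form x y - avg_form x z"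
  and avg_form_scale_right: "avg_form x (\<lambda>i. c * y i) = c * avg_form x y"
  and avg_form_uminus_left: "avg_form (\<lambda>i. - x i) y = - avg_form x y"
  and avg_form_sym: "avg_form x y = avg_form y x"
  by (simp_all add: avg_form_def rho_diff rho_scale rho_uminus algebra_simps sum_subtractf
      sum_distrib_left sum_negf)

lemma avg_form_sum_left:
  "avg_form (\<lambda>i. \<Sum>r\<in>R. c r * v r i) y = (\<Sum>r\<in>R. c r * avg_form (v r) y)"
proof -
  have "avg_form (\<lambda>i. \<Sum>r\<in>R. c r * v r i) y =
    (\<Sum>g\<in>carrier G. \<Sum>i\<in>R. \<Sum>r\<in>R. c r * (rho g (v r) i * rho g y i))"
    by (simp add: avg_form_def rho_sum finite_R sum_distrib_right mult.assoc)
  also have "\<dots> = (\<Sum>g\<in>carrier G. \<Sum>r\<in>R. \<Sum>i\<in>R. c r * (rho g (v r) i * rho g y i))"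
    by (intro sum.cong refl sum.swap)
  also have "\<dots> = (\<Sum>r\<in>R. \<Sum>g\<in>carrier G. \<Sum>i\<in>R. c r * (rho g (v r) i * rho g y i))"
    by (rule sum.swap)
  also have "\<dots> = (\<Sum>r\<in>R. c r * avg_form (v r) y)"
    by (simp add: avg_form_def sum_distrib_left)
  finally show ?thesis .
qed

lemma avg_form_pos:
  assumes "i \<in> R" "x i \<noteq> 0"
  shows "avg_form x x > 0"
proof -
  have "0 < (\<Sum>j\<in>R. rho \<one> x j * rho \<one> x j)"
    using assms finite_R by (intro sum_pos2[of R i]) (auto simp: zero_less_mult_iff linorder_neq_iff)
  then show ?thesis
    unfolding avg_form_def using finite_carrier
    by (intro sum_pos2[of "carrier G" \<one>]) (auto intro: sum_nonneg)
qed

text \<open>The reflection \<open>refl s\<close> preserves the averaged product and negates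
  \<open>alpha s\<close>.\<close>

lemma avg_form_alpha:
  assumes "s \<in> R"
  shows "2 * avg_form (alpha s) v = coroot s v * avg_form (alpha s) (alpha s)"
proof -
  have "refl s (alpha s) = (\<lambda>i. - alpha s i)"
    using assms by (simp add: refl_def fun_eq_iff)
  then have "avg_form (alpha s) v = avg_form (\<lambda>i. - alpha s i) (refl s v)"
    using avg_form_rho[of s "alpha s" v] assms by simp
  also have "\<dots> = - avg_form (alpha s) v + coroot s v * avg_form (alpha s) (alpha s)"
    by (simp add: refl_def avg_form_uminus_left avg_form_diff_right avg_form_scale_right)
  finally show ?thesis by simp
qed

definition adj :: "'a \<Rightarrow> 'a \<Rightarrow> bool" where
  "adj r s \<longleftrightarrow> r \<in> R \<and> s \<in> R \<and> r \<noteq> s \<and> m r s \<noteq> 2"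

lemma adj_sym: "adj r s \<Longrightarrow> adj s r"
  using m_sym by (auto simp: adj_def)

text \<open>The label 0 fits in: \<open>pi / 0\<close> is 0, where the cosine is largest, as befits
  an infinite label.\<close>

lemma cos_pi_div_ge:
  assumes "n = 0 \<or> k \<le> n" "k > 0"
  shows "cos (pi / real k) \<le> cos (pi / real n)"
proof (cases "n = 0")
  case False
  with assms show ?thesis
    by (intro cos_monotone_0_pi_le) (auto simp: field_simps)
qed simp

lemma cart_le:
  assumes "m r s = 0 \<or> k \<le> m r s" "k > 0"
  shows "cart r s \<le> - 2 * cos (pi / real k)"
  using cos_pi_div_ge[OF assms] by (simp add: cart_def)

lemma adj_cart: "adj r s \<Longrightarrow> cart r s \<le> -1"
  using cart_le[of r s 3] m_off_diag[of r s] cos_60 by (auto simp: adj_def)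

lemma not_adj_cart: "r \<in> R \<Longrightarrow> s \<in> R \<Longrightarrow> r \<noteq> s \<Longrightarrow> \<not> adj r s \<Longrightarrow> cart r s = 0"
  by (auto simp: adj_def cart_def)

lemma cart_nonpos: "r \<in> R \<Longrightarrow> s \<in> R \<Longrightarrow> r \<noteq> s \<Longrightarrow> cart r s \<le> 0"
  using adj_cart[of r s] not_adj_cart[of r s] by fastforce

lemma cart_3: "m r s = 3 \<Longrightarrow> cart r s = -1"
  using cos_60 by (simp add: cart_def)

end

locale irreducible_finite_coxeter_system = finite_coxeter_system +
  assumes irreducible: "coxeter_irreducible R m"
begin

text \<open>For an edge \<open>y z\<close>, \<open>avg_form_alpha\<close> evaluates the pairing of
  the two simple roots in two ways; as the Cartan entry is nonzero, the norms agree, and the graph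
  is connected.\<close>

lemma avg_form_alpha_const:
  assumes "r \<in> R" "s \<in> R"
  shows "avg_form (alpha r) (alpha r) = avg_form (alpha s) (alpha s)"
proof -
  have "(r, s) \<in> (coxeter_graph R m)\<^sup>*"
    using irreducible assms by (simp add: coxeter_irreducible_def)
  then show ?thesis
  proof induction
    case (step y z)
    then have yz: "adj y z" by (auto simp: coxeter_graph_def adj_def)
    then have "y \<in> R" "z \<in> R" by (auto simp: adj_def)
    then have "cart y z * avg_form (alpha y) (alpha y) = cart y z * avg_form (alpha z) (alpha z)"
      using avg_form_alpha[of y "alpha z"] avg_form_alpha[of z "alpha y"]
      by (simp add: avg_form_sym[of "alpha z" "alpha y"] cart_sym[of z y])
    then show ?case using adj_cart[OF yz] step by simp
  qed simp
qed

text \<open>Multiplied by the common norm \<open>N\<close> of the simple roots, the form becomes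
  twice the averaged scalar product.\<close>

lemma form_pos:
  assumes "supported x" "i \<in> R" "x i \<noteq> 0"
  shows "form x x > 0"
proof -
  define N where "N = avg_form (alpha i) (alpha i)"
  have N: "N > 0" unfolding N_def
    using avg_form_pos[of i "alpha i"] assms by (simp add: alpha_def)
  have "N * form x x = (\<Sum>s\<in>R. x s * (coroot s x * avg_form (alpha s) (alpha s)))"
    unfolding form_def sum_distrib_left
    by (intro sum.cong refl) (use avg_form_alpha_const[OF assms(2)] in \<open>simp add: N_def\<close>)
  also have "\<dots> = 2 * (\<Sum>s\<in>R. x s * avg_form (alpha s) x)"
    by (simp add: avg_form_alpha[symmetric] sum_distrib_left mult.left_commute)
  also have "(\<Sum>s\<in>R. x s * avg_form (alpha s) x) = avg_form x x"
    using avg_form_sum_left[of x alpha x] supported_expand[OF assms(1)] by simp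
  finally have "N * form x x > 0"
    using avg_form_pos[of i x] assms by simp
  with N show ?thesis by (simp add: zero_less_mult_iff)
qed

lemma form_nonneg_imp_zero: "supported x \<Longrightarrow> form x x \<le> 0 \<Longrightarrow> x i = 0"
  using form_pos[of x i] by (force simp: supported_def)

end

section \<open>Coxeter graphs\<close>

lemma rtrancl_ex_list:
  "(a, b) \<in> E\<^sup>* \<Longrightarrow> \<exists>p. p \<noteq> [] \<and> successively (\<lambda>x y. (x, y) \<in> E) p \<and> hd p = a \<and> last p = b"
proof (induction rule: rtrancl_induct)
  case base
  show ?case by (intro exI[of _ "[a]"]) simp
next
  case (step y z)
  then obtain p where "p \<noteq> []" "successively (\<lambda>x y. (x, y) \<in> E) p" "hd p = a" "last p = y" by blast
  with step show ?case
    by (intro exI[of _ "p @ [z]"]) (simp add: successively_append_iff)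
qed

text \<open>A walk of minimal length from \<open>A\<close> to \<open>B\<close> will do: a repeated
  vertex, a later visit to \<open>A\<close> or an earlier visit to \<open>B\<close> would allow a
  shorter one. Where \<open>A\<close> and \<open>B\<close> meet, the walk is a single
  vertex.\<close>

lemma ex_geodesic:
  assumes "a \<in> A" "b \<in> B" "(a, b) \<in> E\<^sup>*"
  shows "\<exists>p. p \<noteq> [] \<and> distinct p \<and> successively (\<lambda>x y. (x, y) \<in> E) p \<and>
    set p \<inter> A = {hd p} \<and> set p \<inter> B = {last p}"
proof -
  define W where "W p \<longleftrightarrow> p \<noteq> [] \<and> successively (\<lambda>x y. (x, y) \<in> E) p \<and> hd p \<in> A \<and> last p \<in> B" for p
  obtain p where "W p" and min: "\<And>q. W q \<Longrightarrow> length p \<le> length q"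
    using rtrancl_ex_list[OF assms(3)] assms ex_has_least_nat[of W _ length] unfolding W_def by blast
  then have p: "p \<noteq> []" "successively (\<lambda>x y. (x, y) \<in> E) p" "hd p \<in> A" "last p \<in> B"
    by (auto simp: W_def)
  have "distinct p"
  proof (rule ccontr)
    assume "\<not> distinct p"
    then obtain xs ys zs y where d: "p = xs @ [y] @ ys @ [y] @ zs"
      using not_distinct_decomp by blast
    have "W (xs @ [y] @ zs)"
      using p unfolding W_def d by (cases xs; cases zs)
        (auto simp: successively_append_iff successively_Cons hd_append split: if_splits)
    from min[OF this] show False by (simp add: d)
  qed
  moreover have "x = hd p" if "x \<in> set p" "x \<in> A" for x
  proof -
    obtain u v where uv: "p = u @ x # v" using \<open>x \<in> set p\<close> by (meson split_list)
    have "W (x # v)"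
      using p \<open>x \<in> A\<close> unfolding W_def uv by (auto simp: successively_append_iff)
    from min[OF this] show ?thesis by (cases u) (auto simp: uv)
  qed
  moreover have "x = last p" if "x \<in> set p" "x \<in> B" for x
  proof -
    obtain u v where uv: "p = u @ x # v" using \<open>x \<in> set p\<close> by (meson split_list)
    have "W (u @ [x])"
      using p \<open>x \<in> B\<close> unfolding W_def uv by (cases u)
        (auto simp: successively_append_iff successively_Cons hd_append split: if_splits)
    from min[OF this] show ?thesis by (auto simp: uv)
  qed
  ultimately show ?thesis
    using p by (intro exI[of _ p]) (auto intro: hd_in_set last_in_set)
qed

lemma sum_le_subset_nonpos:
  fixes f :: "'c \<Rightarrow> real"
  assumes "finite A" "B \<subseteq> A" "\<And>x. x \<in> A - B \<Longrightarrow> f x \<le> 0"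
  shows "sum f A \<le> sum f B"
  using sum.subset_diff[OF assms(2,1), of f] sum_nonpos[of "A - B" f] assms(3) by simp

context finite_coxeter_system
begin

definition is_path :: "'a list \<Rightarrow> bool" where
  "is_path p \<longleftrightarrow> p \<noteq> [] \<and> distinct p \<and> successively adj p \<and> set p \<subseteq> R"

definition vsum :: "'a list \<Rightarrow> 'a \<Rightarrow> real" where
  "vsum p = (\<lambda>i. if i \<in> set p then 1 else 0)"

lemma is_path_Cons_iff:
  "is_path (r # p) \<longleftrightarrow> r \<in> R \<and> r \<notin> set p \<and> (p = [] \<or> is_path p \<and> adj r (hd p))"
  by (auto simp: is_path_def successively_Cons)

lemma is_path_append:
  "is_path (p @ q) \<Longrightarrow> (p = [] \<or> is_path p) \<and> (q = [] \<or> is_path q)"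
  by (auto simp: is_path_def successively_append_iff)

lemma is_path_rev: "is_path (rev p) \<longleftrightarrow> is_path p"
proof -
  have eq: "(\<lambda>x y. adj y x) = adj" using adj_sym by blast
  show ?thesis unfolding is_path_def successively_rev eq by simp
qed

lemma supported_vsum [simp]: "set p \<subseteq> R \<Longrightarrow> supported (vsum p)"
  by (auto simp: supported_def vsum_def)

lemma coroot_vsum: "set p \<subseteq> R \<Longrightarrow> coroot r (vsum p) = (\<Sum>s\<in>set p. cart r s)"
proof -
  assume "set p \<subseteq> R"
  have "coroot r (vsum p) = (\<Sum>s\<in>R. if s \<in> set p then cart r s else 0)"
    unfolding coroot_def vsum_def by (intro sum.cong) auto
  also have "\<dots> = (\<Sum>s\<in>R \<inter> set p. cart r s)"
    using finite_R by (simp add: sum.If_cases Collect_mem_eq)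
  also have "R \<inter> set p = set p" using \<open>set p \<subseteq> R\<close> by blast
  finally show ?thesis .
qed

lemma form_vsum_left: "set p \<subseteq> R \<Longrightarrow> form (vsum p) v = (\<Sum>s\<in>set p. coroot s v)"
proof -
  assume "set p \<subseteq> R"
  have "form (vsum p) v = (\<Sum>s\<in>R. if s \<in> set p then coroot s v else 0)"
    unfolding form_def vsum_def by (intro sum.cong) auto
  also have "\<dots> = (\<Sum>s\<in>R \<inter> set p. coroot s v)"
    using finite_R by (simp add: sum.If_cases Collect_mem_eq)
  also have "R \<inter> set p = set p" using \<open>set p \<subseteq> R\<close> by blast
  finally show ?thesis .
qed

lemma coroot_vsum_le:
  assumes "set p \<subseteq> R" "r \<in> R" "r \<notin> set p" "A \<subseteq> set p"
  shows "coroot r (vsum p) \<le> (\<Sum>s\<in>A. cart r s)"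
  unfolding coroot_vsum[OF assms(1)]
  by (rule sum_le_subset_nonpos) (use assms in \<open>auto intro: cart_nonpos\<close>)

lemma coroot_vsum_le1:
  assumes "set p \<subseteq> R" "r \<in> R" "r \<notin> set p" "s \<in> set p"
  shows "coroot r (vsum p) \<le> cart r s"
  using coroot_vsum_le[of p r "{s}"] assms by simp

lemma coroot_vsum_nonpos:
  assumes "set p \<subseteq> R" "r \<in> R" "r \<notin> set p"
  shows "coroot r (vsum p) \<le> 0"
  using coroot_vsum_le[of p r "{}"] assms by simp

text \<open>Prefixing a vertex \<open>r\<close> adds \<open>2 + 2 * coroot r (vsum p)\<close>, which
  is at most 0 because of the edge to the head of \<open>p\<close>; chords and larger labels only
  decrease it.\<close>

lemma form_vsum_le_2: "is_path p \<Longrightarrow> form (vsum p) (vsum p) \<le> 2"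
proof (induction p)
  case (Cons r p)
  then have r: "r \<in> R" "r \<notin> set p" by (auto simp: is_path_Cons_iff)
  have eq: "vsum (r # p) = (\<lambda>i. alpha r i + vsum p i)"
    using r by (auto simp: vsum_def alpha_def fun_eq_iff)
  show ?case
  proof (cases "p = []")
    case True
    have "vsum [r] = alpha r" by (auto simp: vsum_def alpha_def)
    then show ?thesis using r True by simp
  next
    case False
    with Cons have p: "is_path p" "adj r (hd p)" "form (vsum p) (vsum p) \<le> 2"
      by (auto simp: is_path_Cons_iff)
    then have "coroot r (vsum p) \<le> -1"
      using coroot_vsum_le1[of p r "hd p"] adj_cart[of r "hd p"] r by (auto simp: is_path_def)
    then show ?thesis using p r unfolding eq by simp
  qed
qed (simp add: is_path_def)

end

section \<open>The Coxeter graph is a tree, and the opposition acts on it\<close>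

context irreducible_finite_coxeter_system
begin

lemma ex_path:
  assumes "A \<noteq> {}" "B \<noteq> {}" "A \<subseteq> R" "B \<subseteq> R"
  shows "\<exists>p. is_path p \<and> set p \<inter> A = {hd p} \<and> set p \<inter> B = {last p}"
proof -
  obtain a b where ab: "a \<in> A" "b \<in> B" using assms by blast
  then have "(a, b) \<in> (coxeter_graph R m)\<^sup>*"
    using irreducible assms by (auto simp: coxeter_irreducible_def)
  from ex_geodesic[OF ab this] obtain p where
    p: "p \<noteq> []" "distinct p" "successively (\<lambda>x y. (x, y) \<in> coxeter_graph R m) p"
       "set p \<inter> A = {hd p}" "set p \<inter> B = {last p}"
    by blast
  have "successively adj p"
    using p(3) by (rule successively_mono) (auto simp: coxeter_graph_def adj_def)
  moreover have "set p \<subseteq> R"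
  proof
    fix x assume "x \<in> set p"
    then obtain u v where uv: "p = u @ x # v" by (meson split_list)
    show "x \<in> R"
    proof (cases u rule: rev_cases)
      case Nil
      then show ?thesis using p(4) assms(3) uv by auto
    next
      case (snoc u' y)
      then show ?thesis using \<open>successively adj p\<close>
        by (auto simp: uv successively_append_iff adj_def)
    qed
  qed
  ultimately show ?thesis using p by (auto simp: is_path_def)
qed

text \<open>This one test excludes every diagram (cycles and the affine diagrams of types
  \<open>B\<close> and \<open>C\<close>) that has to be ruled out below: the form would not be positive on
  \<open>y + (M/2) (\<Sum>\<^sub>i\<^sub>\<in>\<^sub>z \<alpha>\<^sub>i)\<close>.\<close>

lemma path_exclusion:
  assumes "is_path z" "supported y" "\<And>i. i \<in> set z \<Longrightarrow> y i = 0" "M > 0"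
    and "form y y \<le> M\<^sup>2 / 2" "form y (vsum z) \<le> - M"
  shows False
proof -
  \<comment> \<open>\<open>M / 2\<close> minimizes the bound
    \<open>M^2 / 2 - 2 * c * M + 2 * c^2\<close> for the norm of \<open>?x\<close>, and the minimum
    is 0.\<close>
  define c where "c = M / 2"
  let ?x = "\<lambda>i. y i + c * vsum z i"
  have z: "z \<noteq> []" "set z \<subseteq> R" using assms by (auto simp: is_path_def)
  have "form ?x ?x = form y y + 2 * c * form y (vsum z) + c * c * form (vsum z) (vsum z)"
    by (simp add: form_sym[of "vsum z" y]) (simp add: algebra_simps)
  also have "\<dots> \<le> M\<^sup>2 / 2 + 2 * c * (- M) + c * c * 2"
    using assms form_vsum_le_2[OF assms(1)]
    by (intro add_mono mult_left_mono) (auto simp: c_def)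
  also have "\<dots> = 0" by (simp add: c_def power2_eq_square field_simps)
  finally have "form ?x ?x \<le> 0" .
  moreover have "supported ?x"
    using assms(2) supported_vsum[OF z(2)] by (simp add: supported_def)
  ultimately have "?x (hd z) = 0" using form_nonneg_imp_zero by blast
  then show False using assms(3)[of "hd z"] assms(4) z by (simp add: vsum_def c_def)
qed

text \<open>Two distinct paths with common ends would contain a cycle, cut here into two disjoint
  paths with two edges between them; these edges bring the form of their sums down to -2, the case
  \<open>M = 2\<close> of \<open>path_exclusion\<close>.\<close>

lemma path_unique:
  "is_path p \<Longrightarrow> is_path q \<Longrightarrow> hd p = hd q \<Longrightarrow> last p = last q \<Longrightarrow> p = q"
proof (induction p arbitrary: q)
  case (Cons s p)
  then obtain q' where q: "q = s # q'" by (cases q) (auto simp: is_path_def)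
  note s = Cons.prems(1,2)[unfolded q is_path_Cons_iff]
  show ?case
  proof (cases "p = [] \<or> q' = []")
    case True
    then show ?thesis
      using Cons.prems s q last_in_set[of p] last_in_set[of q'] by (cases p; cases q') auto
  next
    case False
    then have paths: "is_path p" "is_path q'" "adj s (hd p)" "adj s (hd q')" "s \<in> R"
      "s \<notin> set p" "s \<notin> set q'" "last p = last q'" "p \<noteq> []" "q' \<noteq> []"
      using s Cons.prems(4) q by auto
    show ?thesis
    proof (cases "hd p = hd q'")
      case True
      then show ?thesis using Cons.IH[of q'] paths q by simp
    next
      case ne: False
      \<comment> \<open>\<open>Q\<close> follows \<open>q'\<close> until it first meets
        \<open>p\<close>, at \<open>x\<close>. Then \<open>s # Q\<close> and \<open>p\<close> are
        disjoint paths joined by two edges, from \<open>s\<close> to \<open>hd p\<close> and from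
        the end of \<open>s # Q\<close> to \<open>x\<close>. If \<open>Q\<close> is empty, both
        edges start at \<open>s\<close>, and \<open>hd p \<noteq> hd q'\<close> keeps them
        distinct.\<close>
      define Q where "Q = takeWhile (\<lambda>x. x \<notin> set p) q'"
      define Q' where "Q' = dropWhile (\<lambda>x. x \<notin> set p) q'"
      have q': "q' = Q @ Q'" by (simp add: Q_def Q'_def)
      have "last q' \<in> set p" using paths by (metis last_in_set)
      then have "Q' \<noteq> []"
        using paths(10) last_in_set[of q'] by (auto simp: Q'_def dropWhile_eq_Nil_conv)
      then obtain x Q'' where Q': "Q' = x # Q''" by (cases Q') auto
      have x: "x \<in> set p"
        using hd_dropWhile[of "\<lambda>x. x \<notin> set p" q'] \<open>Q' \<noteq> []\<close>
        unfolding Q'_def[symmetric] Q' by simp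
      have Q: "y \<notin> set p" if "y \<in> set Q" for y
        using that set_takeWhileD[of y _ q'] by (auto simp: Q_def)
      have "is_path (s # Q)"
        using Cons.prems(2) is_path_append[of "s # Q" Q'] by (simp add: q q')
      then have sQ: "is_path (s # Q)" "set (s # Q) \<subseteq> R" "distinct (s # Q)"
        by (auto simp: is_path_def)
      have pR: "set p \<subseteq> R" using paths by (simp add: is_path_def)
      have off: "y \<notin> set p" if "y \<in> set (s # Q)" for y
        using that Q paths by auto
      have "form (vsum (s # Q)) (vsum p) \<le> -2"
      proof (cases Q rule: rev_cases)
        case Nil
        then have "x = hd q'" by (simp add: q' Q')
        with ne have "hd p \<noteq> x" by simp
        moreover have "coroot s (vsum p) \<le> (\<Sum>t\<in>{hd p, x}. cart s t)"
          using pR paths x by (intro coroot_vsum_le) auto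
        ultimately show ?thesis
          using adj_cart[OF paths(3)] adj_cart[OF paths(4)] \<open>x = hd q'\<close> sQ(2)
          by (subst form_vsum_left) (simp_all add: Nil)
      next
        case (snoc Q0 y)
        then have "adj y x"
          using paths(2) by (auto simp: is_path_def q' Q' successively_append_iff)
        have "form (vsum (s # Q)) (vsum p) = (\<Sum>t\<in>set (s # Q). coroot t (vsum p))"
          using sQ(2) by (rule form_vsum_left)
        also have "\<dots> \<le> (\<Sum>t\<in>{s, y}. coroot t (vsum p))"
          by (intro sum_le_subset_nonpos coroot_vsum_nonpos)
             (use pR off sQ(2) in \<open>auto simp: snoc\<close>)
        also have "\<dots> = coroot s (vsum p) + coroot y (vsum p)"
          using sQ(3) by (auto simp: snoc)
        also have "\<dots> \<le> cart s (hd p) + cart y x"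
          by (intro add_mono coroot_vsum_le1)
             (use pR paths x off[of y] \<open>adj y x\<close> snoc in \<open>auto simp: adj_def\<close>)
        also have "\<dots> \<le> -2"
          using adj_cart[OF paths(3)] adj_cart[OF \<open>adj y x\<close>] by simp
        finally show ?thesis .
      qed
      moreover have "vsum (s # Q) i = 0" if "i \<in> set p" for i
        using that off by (auto simp: vsum_def)
      ultimately show ?thesis
        using path_exclusion[of p "vsum (s # Q)" 2] paths(1) sQ(1,2) form_vsum_le_2[of "s # Q"]
        by simp
    qed
  qed
qed (simp add: is_path_def)

text \<open>Conjugation by \<open>w0\<close> turns \<open>s\<close> into \<open>opp s\<close>, so
  \<open>rho w0 (alpha s)\<close> is negated by the reflection of \<open>opp s\<close> and is a
  multiple of \<open>alpha (opp s)\<close>; the norm leaves only the sign open.\<close>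

lemma rho_w0_alpha:
  assumes "s \<in> R"
  obtains e where "e\<^sup>2 = 1" "rho w0 (alpha s) = (\<lambda>i. e * alpha (opp s) i)"
proof -
  let ?v = "rho w0 (alpha s)" and ?t = "opp s"
  have t: "?t \<in> R" using assms by simp
  have "?t \<otimes> w0 = w0 \<otimes> s" using assms by (simp add: opp_def m_assoc)
  then have "refl ?t ?v = rho w0 (refl s (alpha s))"
    using rho_mult[of ?t w0 "alpha s"] rho_mult[of w0 s "alpha s"] assms t by simp
  also have "refl s (alpha s) = (\<lambda>i. - alpha s i)"
    using assms by (simp add: refl_def fun_eq_iff)
  finally have "?v i - coroot ?t ?v * alpha ?t i = - ?v i" for i
    by (simp add: refl_def rho_uminus fun_eq_iff)
  then have "2 * ?v i = coroot ?t ?v * alpha ?t i" for i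
    by (simp add: eq_diff_eq diff_eq_eq)
  then have v: "?v i = coroot ?t ?v / 2 * alpha ?t i" for i
    by (simp add: field_simps)
  define e where "e = coroot ?t ?v / 2"
  have v': "?v = (\<lambda>i. e * alpha ?t i)" using v by (simp add: e_def fun_eq_iff)
  have "form ?v ?v = 2" using assms by simp
  then have "e\<^sup>2 = 1" using t by (simp add: v' power2_eq_square)
  with v' show ?thesis using that by blast
qed

text \<open>Invariance of the form under \<open>w0\<close> gives equality up to sign, and two
  nonpositive entries that are equal up to sign are equal.\<close>

lemma cart_opp:
  assumes "r \<in> R" "s \<in> R"
  shows "cart (opp r) (opp s) = cart r s"
proof (cases "r = s")
  case True
  then show ?thesis using assms by simp
next
  case False
  obtain d where d: "d\<^sup>2 = 1" "rho w0 (alpha r) = (\<lambda>i. d * alpha (opp r) i)"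
    using rho_w0_alpha[OF assms(1)] by blast
  obtain e where e: "e\<^sup>2 = 1" "rho w0 (alpha s) = (\<lambda>i. e * alpha (opp s) i)"
    using rho_w0_alpha[OF assms(2)] by blast
  have "cart r s = form (rho w0 (alpha r)) (rho w0 (alpha s))"
    using assms by (simp add: cart_sym)
  also have "\<dots> = d * e * cart (opp r) (opp s)"
    unfolding d(2) e(2) using assms by (simp add: cart_sym)
  finally have eq: "cart r s = d * e * cart (opp r) (opp s)" .
  have "opp r \<noteq> opp s" using False assms opp_opp[of r] opp_opp[of s] by force
  then have "cart r s \<le> 0" "cart (opp r) (opp s) \<le> 0"
    using False assms cart_nonpos by auto
  then show ?thesis using eq d(1) e(1) by (auto simp: power2_eq_1_iff)
qed

lemma adj_iff_cart: "r \<in> R \<Longrightarrow> s \<in> R \<Longrightarrow> adj r s \<longleftrightarrow> r \<noteq> s \<and> cart r s \<noteq> 0"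
  using adj_cart[of r s] not_adj_cart[of r s] by (auto simp: adj_def)

lemma opp_eq_iff: "r \<in> carrier G \<Longrightarrow> s \<in> carrier G \<Longrightarrow> opp r = opp s \<longleftrightarrow> r = s"
  by (auto dest: arg_cong[of "opp r" "opp s" opp])

lemma adj_opp: "adj r s \<Longrightarrow> adj (opp r) (opp s)"
  using adj_iff_cart[of r s] adj_iff_cart[of "opp r" "opp s"] cart_opp[of r s] opp_eq_iff[of r s]
  by (auto simp: adj_def)

lemma is_path_map_opp: "is_path p \<Longrightarrow> is_path (map opp p)"
proof -
  assume p: "is_path p"
  have "inj_on opp (set p)"
    using p by (intro inj_onI) (auto simp: is_path_def opp_eq_iff subset_iff)
  moreover have "successively (\<lambda>x y. adj (opp x) (opp y)) p"
    using p by (auto simp: is_path_def intro: successively_mono[of adj] adj_opp)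
  ultimately show ?thesis
    using p by (auto simp: is_path_def distinct_map successively_map)
qed

text \<open>Counting the generators on the side of \<open>a\<close> of the edge \<open>a b\<close> modulo 2
  is a character of the group that separates \<open>a\<close> from \<open>b\<close>.\<close>

lemma even_edge_not_conjugate:
  assumes ab: "adj a b" "even (m a b)" and x: "x \<in> carrier G"
  shows "x \<otimes> a \<otimes> inv x \<noteq> b"
proof
  assume conj: "x \<otimes> a \<otimes> inv x = b"
  have abR: "a \<in> R" "b \<in> R" "a \<noteq> b" using ab by (auto simp: adj_def)
  define E where "E = {(r, s). adj r s \<and> {r, s} \<noteq> {a, b}}"
  define A where "A = {r. (a, r) \<in> E\<^sup>*}"
  \<comment> \<open>Otherwise there would be a path from \<open>a\<close> to \<open>b\<close>
    besides the edge itself, against \<open>path_unique\<close>.\<close>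
  have b: "b \<notin> A"
  proof
    assume "b \<in> A"
    then obtain p where p: "p \<noteq> []" "distinct p" "successively (\<lambda>x y. (x, y) \<in> E) p"
      "set p \<inter> {a} = {hd p}" "set p \<inter> {b} = {last p}"
      using ex_geodesic[of a "{a}" b "{b}" E] by (auto simp: A_def)
    then have hl: "hd p = a" "last p = b" by auto
    have sp: "successively adj p"
      using p(3) by (rule successively_mono) (auto simp: E_def)
    have "set p \<subseteq> R"
    proof
      fix r assume "r \<in> set p"
      then obtain u v where uv: "p = u @ r # v" by (meson split_list)
      show "r \<in> R"
        using hl abR sp by (cases u rule: rev_cases) (auto simp: uv successively_append_iff adj_def)
    qed
    then have "is_path p" using p sp by (simp add: is_path_def)
    moreover have "is_path [a, b]" using ab abR by (auto simp: is_path_def)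
    ultimately have "p = [a, b]" using path_unique hl by simp
    with p(3) show False by (simp add: E_def)
  qed
  have a: "a \<in> A" by (simp add: A_def)
  have step: "s \<in> A" if "r \<in> A" "r \<in> R" "s \<in> R" "odd (m r s)" for r s
  proof (cases "r = s")
    case False
    then have adj: "adj r s" using that by (auto simp: adj_def)
    have "{r, s} \<noteq> {a, b}" using that ab(2) m_sym[of a b] abR by (auto simp: doubleton_eq_iff)
    with adj have "(r, s) \<in> E" by (simp add: E_def)
    with \<open>r \<in> A\<close> show ?thesis by (auto simp: A_def)
  qed (use that in simp)
  define n where "n w = length (filter (\<lambda>r. r \<in> A) w)" for w
  have n_simps [simp]: "n [] = 0" "n (r # v) = of_bool (r \<in> A) + n v" "n (u @ v) = n u + n v"
    "n (rev v) = n v" for r u v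
    by (simp_all add: n_def rev_filter[symmetric])
  \<comment> \<open>An edge with an odd label is not the one removed, so its ends lie on the same
    side and the factor \<open>[r, s]\<close> has an even count; an even label makes the total even
    anyway.\<close>
  have even_rel: "even (n (relator m r s))" if "r \<in> R" "s \<in> R" for r s
  proof -
    have "n (concat (replicate k [r, s])) = k * n [r, s]" for k
      by (induction k) simp_all
    moreover have "even (m r s) \<or> even (n [r, s])"
      using step[of r s] step[of s r] that m_sym[of r s] by auto
    ultimately show ?thesis by (auto simp: relator_def)
  qed
  have ins: "even (n u) = even (n v)" if "insert_relator R m u v" for u v
    using that even_rel by (auto simp: insert_relator_def)
  obtain w where w: "w \<in> lists R" "ev w = x" using ex_word[OF x] by blast
  have ev_eq: "ev (w @ [a] @ rev w) = ev [b]"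
    using w abR x conj by (simp add: ev_rev m_assoc[symmetric])
  have "w @ [a] @ rev w \<in> lists R" "[b] \<in> lists R" using w abR by auto
  from presentation[OF this] ev_eq have "coxeter_equiv R m (w @ [a] @ rev w) [b]"
    by (rule iffD1)
  then have "equivclp (insert_relator R m) (w @ [a] @ rev w) [b]"
    by (simp add: coxeter_equiv_def)
  then have "even (n (w @ [a] @ rev w)) = even (n [b])"
    by (induction rule: equivclp_induct) (use ins in blast)+
  then show False using a b by simp
qed

section \<open>Multiple edges and the opposition\<close>

lemma cos_pi_div_5_ge: "cos (pi / 5) \<ge> 3 / 4"
proof -
  let ?c = "cos (pi / 5)"
  have "cos (3 * (pi / 5)) = cos (pi - 2 * (pi / 5))" by (rule arg_cong[of _ _ cos]) simp
  also have "\<dots> = - cos (2 * (pi / 5))" by (rule cos_pi_minus)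
  finally have "4 * ?c ^ 3 - 3 * ?c = 1 - 2 * ?c\<^sup>2"
    unfolding cos_treble_cos cos_double_cos by simp
  \<comment> \<open>With the positive factor \<open>?c + 1\<close> removed, the equation determines
    \<open>?c\<close> as (1 + sqrt 5) / 4, slightly above 3/4.\<close>
  then have "(?c + 1) * (4 * ?c\<^sup>2 - 2 * ?c - 1) = 0"
    by (simp add: power2_eq_square power3_eq_cube algebra_simps)
  moreover have half: "?c \<ge> 1 / 2"
    using cos_monotone_0_pi_le[of "pi / 5" "pi / 3"] cos_60 by simp
  ultimately have c: "4 * ?c\<^sup>2 = 2 * ?c + 1" by auto
  show ?thesis
  proof (rule ccontr)
    assume "\<not> ?thesis"
    then have "?c < 3 / 4" by simp
    then have "?c * (4 * ?c - 2) < 1 \<or> ?c * (4 * ?c - 2) = 1 \<and> False"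
      using half mult_strict_mono[of ?c "3 / 4" "4 * ?c - 2" 1] by simp
    then show False using c by (simp add: power2_eq_square algebra_simps)
  qed
qed

lemma heavy_cart: "m a b = 0 \<or> 4 \<le> m a b \<Longrightarrow> cart a b \<le> - sqrt 2"
  using cart_le[of a b 4] cos_45 by auto

text \<open>The vector is the null vector of the affine diagram of type B: the heavy edge at one end
  of the path \<open>z\<close> of fixed vertices, and at the other the fork formed by the first
  moved vertex \<open>t\<close> and its image \<open>opp t\<close>, both joined to
  \<open>last z\<close>. The weights are \<open>sqrt 2\<close> at the free end \<open>e\<close> of
  the edge, 1 at the prongs and 2 on \<open>z\<close>.\<close>

lemma no_heavy_fixed_edge:
  assumes ab: "adj a b" "cart a b \<le> - sqrt 2" and fixed: "opp a = a" "opp b = b"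
    and c: "c \<in> R" "opp c \<noteq> c"
  shows False
proof -
  let ?B = "{i \<in> R. opp i \<noteq> i}"
  have abR: "a \<in> R" "b \<in> R" "a \<noteq> b" using ab by (auto simp: adj_def)
  obtain p where p: "is_path p" "set p \<inter> {a, b} = {hd p}" "set p \<inter> ?B = {last p}"
    using ex_path[of "{a, b}" ?B] abR c by auto
  obtain z t where pz: "p = z @ [t]"
    using p(1) by (cases p rule: rev_cases) (auto simp: is_path_def)
  have t: "t \<in> R" "opp t \<noteq> t" using p(3) pz by auto
  have "z \<noteq> []"
  proof
    assume "z = []"
    then have "t \<in> {a, b}" using p(2) pz by fastforce
    with t fixed show False by blast
  qed
  then have hp: "hd p = hd z" and hz: "hd z \<in> set z" using pz by simp_all
  have ends: "set p \<inter> {a, b} = {hd z}" using p(2) hp by simp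
  then have hab: "hd z \<in> {a, b}" by blast
  define e where "e = (if hd z = a then b else a)"
  have e: "e \<in> R" "opp e = e" "cart e (hd z) \<le> - sqrt 2" "e \<in> {a, b}" "e \<noteq> hd z"
    using abR hab fixed ab(2) cart_sym[of a b] by (auto simp: e_def)
  have "e \<notin> set p" using ends e(4,5) by blast
  then have ez: "e \<notin> set z" using pz by simp
  have z: "is_path z" using p(1) is_path_append[of z "[t]"] pz \<open>z \<noteq> []\<close> by auto
  then have zR: "set z \<subseteq> R" by (simp add: is_path_def)
  have zfix: "opp i = i" if "i \<in> set z" for i
  proof (rule ccontr)
    assume "opp i \<noteq> i"
    then have "i \<in> set p \<inter> {i \<in> R. opp i \<noteq> i}" using \<open>i \<in> set z\<close> zR pz by auto
    then have "i = t" unfolding p(3) using pz by simp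
    then show False using p(1) \<open>i \<in> set z\<close> pz by (simp add: is_path_def)
  qed
  have adj_t: "adj t (last z)"
    using p(1) pz \<open>z \<noteq> []\<close> adj_sym by (auto simp: is_path_def successively_append_iff)
  have adj_t': "adj (opp t) (last z)"
    using adj_opp[OF adj_t] zfix[of "last z"] \<open>z \<noteq> []\<close> by simp
  have tz: "t \<notin> set z" "opp t \<notin> set z"
    using zfix[of t] zfix[of "opp t"] t by auto
  have ne: "e \<noteq> t" "e \<noteq> opp t" using e t by auto
  let ?y = "\<lambda>i. sqrt 2 * alpha e i + (alpha t i + alpha (opp t) i)"
  show False
  proof (rule path_exclusion[OF z, of ?y 4])
    show "supported ?y"
      using supported_alpha[of e] supported_alpha[of t] supported_alpha[of "opp t"] e t
      by (simp add: supported_def)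
    show "?y i = 0" if "i \<in> set z" for i
      using that ez tz by (auto simp: alpha_def)
    have "cart e t \<le> 0" "cart t e \<le> 0" "cart e (opp t) \<le> 0" "cart (opp t) e \<le> 0" "cart t (opp t) \<le> 0"
      "cart (opp t) t \<le> 0"
      using ne e t by (auto intro: cart_nonpos)
    then have h: "sqrt 2 * cart e t \<le> 0" "sqrt 2 * cart t e \<le> 0" "sqrt 2 * cart e (opp t) \<le> 0"
      "sqrt 2 * cart (opp t) e \<le> 0" "cart t (opp t) \<le> 0" "cart (opp t) t \<le> 0"
      by (auto simp: mult_le_0_iff)
    have q: "sqrt 2 * (sqrt 2 * 2) = (4 :: real)"
      by (simp flip: mult.assoc)
    show "form ?y ?y \<le> 4\<^sup>2 / 2"
      using e(1) t by (simp add: distrib_left) (use h q in linarith)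
    have "coroot e (vsum z) \<le> - sqrt 2"
      using coroot_vsum_le1[OF zR e(1) ez hz] e(3) by simp
    then have "sqrt 2 * coroot e (vsum z) \<le> sqrt 2 * (- sqrt 2)"
      by (intro mult_left_mono) auto
    moreover have "coroot t (vsum z) \<le> -1"
      using coroot_vsum_le1[OF zR t(1) tz(1), of "last z"] adj_cart[OF adj_t] \<open>z \<noteq> []\<close> by simp
    moreover have "coroot (opp t) (vsum z) \<le> -1"
      using coroot_vsum_le1[OF zR _ tz(2), of "last z"] adj_cart[OF adj_t'] \<open>z \<noteq> []\<close> t by simp
    ultimately show "form ?y (vsum z) \<le> - 4"
      using e t by simp
  qed simp
qed

text \<open>Here the null vector is that of the affine diagram of type C: weight 1 at the two ends
  and \<open>sqrt 2\<close> on the path. A one-vertex path is allowed, with both heavy edges at that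
  vertex.\<close>

lemma no_two_heavy_ends:
  assumes z: "is_path z" and "e \<in> R" "e' \<in> R" "e \<noteq> e'" "e \<notin> set z" "e' \<notin> set z"
    and "cart e (hd z) \<le> - sqrt 2" "cart e' (last z) \<le> - sqrt 2"
  shows False
proof -
  let ?y = "\<lambda>i. alpha e i + alpha e' i"
  have zR: "set z \<subseteq> R" "z \<noteq> []" using z by (auto simp: is_path_def)
  show False
  proof (rule path_exclusion[OF z, of ?y "2 * sqrt 2"])
    show "supported ?y"
      using supported_alpha[of e] supported_alpha[of e'] assms by (simp add: supported_def)
    show "?y i = 0" if "i \<in> set z" for i
      using that assms by (auto simp: alpha_def)
    have "cart e e' \<le> 0" "cart e' e \<le> 0"
      using assms by (auto intro: cart_nonpos)
    then show "form ?y ?y \<le> (2 * sqrt 2)\<^sup>2 / 2"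
      using assms by (simp add: power_mult_distrib)
    show "form ?y (vsum z) \<le> - (2 * sqrt 2)"
      using coroot_vsum_le1[OF zR(1), of e "hd z"] coroot_vsum_le1[OF zR(1), of e' "last z"] assms zR
      by simp
  qed simp
qed

text \<open>For an even label (an infinite one included), \<open>w0\<close> would conjugate
  \<open>a\<close> into \<open>b\<close>, which the parity character forbids; this case has to cover
  label 4, where the path \<open>c, a, b, opp c\<close> is of type F4 and positive. From label 5 on
  that path is no longer positive. Rank at least 3 supplies the neighbour \<open>c\<close>.\<close>

lemma no_heavy_swapped_edge:
  assumes ab: "adj a b" "m a b = 0 \<or> 4 \<le> m a b" and swap: "opp a = b" and n: "card R \<ge> 3"
  shows False
proof -
  have abR: "a \<in> R" "b \<in> R" "a \<noteq> b" using ab by (auto simp: adj_def)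
  have ba: "opp b = a" using swap abR opp_opp[of a] by simp
  have "card {a, b} < card R" using n abR by simp
  then have "\<not> R \<subseteq> {a, b}" by (metis card_mono finite.emptyI finite.insertI not_less)
  then obtain p where p: "is_path p" "set p \<inter> {a, b} = {hd p}" "set p \<inter> (R - {a, b}) = {last p}"
    using ex_path[of "{a, b}" "R - {a, b}"] abR by auto
  obtain x q where pq: "p = x # q" using p(1) by (cases p) (auto simp: is_path_def)
  have xab: "x \<in> {a, b}" using p(2) unfolding pq list.sel by blast
  moreover have "last p \<notin> {a, b}" using p(3) by blast
  ultimately have "q \<noteq> []" unfolding pq by (cases q) simp_all
  then have path: "adj x (hd q)" "x \<notin> set q" and hq: "hd q \<in> set q"
    using p(1) unfolding pq is_path_Cons_iff by simp_all
  have "hd q \<notin> {a, b}"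
  proof
    assume "hd q \<in> {a, b}"
    then have "hd q \<in> set p \<inter> {a, b}" using hq unfolding pq by simp
    then have "hd q = x" unfolding p(2) unfolding pq by simp
    then show False using path(2) hq by simp
  qed
  then have xc: "adj x (hd q)" "hd q \<notin> {a, b}" "x \<in> {a, b}" using path(1) xab by simp_all
  have "\<exists>c. adj c a \<and> c \<notin> {a, b}"
  proof (cases "x = a")
    case True
    then show ?thesis using xc adj_sym by blast
  next
    case False
    then have "adj (opp (hd q)) a" using xc adj_opp[OF adj_sym[OF xc(1)]] ba by auto
    moreover have "hd q \<in> R" using xc by (simp add: adj_def)
    then have "opp (hd q) \<notin> {a, b}"
      using xc(2) swap ba abR opp_eq_iff[of "hd q" a] opp_eq_iff[of "hd q" b] by simp
    ultimately show ?thesis by blast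
  qed
  then obtain c where c: "adj c a" "c \<notin> {a, b}" by blast
  let ?d = "opp c"
  have cR: "c \<in> R" "?d \<in> R" using c by (auto simp: adj_def)
  have d: "adj ?d b" using adj_opp[OF c(1)] swap by simp
  have dab: "?d \<notin> {a, b}"
    using c(2) swap ba cR(1) abR opp_eq_iff[of c a] opp_eq_iff[of c b] by simp
  have cd: "c \<noteq> ?d"
  proof
    assume "c = ?d"
    then have "adj c b" using d by simp
    have "is_path [a, b]" "is_path [a, c, b]"
      using ab abR cR c \<open>adj c b\<close> adj_sym by (auto simp: is_path_def)
    then show False using path_unique[of "[a, b]" "[a, c, b]"] by simp
  qed
  have "even (m a b) \<or> 5 \<le> m a b" using ab(2) by (cases "m a b = 4") auto
  then consider "even (m a b)" | "m a b \<ge> 5" by blast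
  then show False
  proof cases
    case 1
    then show False using even_edge_not_conjugate[OF ab(1), of w0] swap by (simp add: opp_def)
  next
    case 2
    then have "cart a b \<le> -3/2" using cart_le[of a b 5] cos_pi_div_5_ge by simp
    \<comment> \<open>Weights 1, 2, 2, 1 along the path give the norm 20 - 8 - 12 = 0 when the
      middle Cartan entry is -3/2; the bound 3/4 for the cosine is chosen for this.\<close>
    let ?x = "\<lambda>i. (alpha c i + alpha ?d i) + 2 * (alpha a i + alpha b i)"
    have sym: "cart a c = cart c a" "cart b ?d = cart ?d b" "cart b a = cart a b"
      using abR cR cart_sym by auto
    have nonpos: "cart c ?d \<le> 0" "cart ?d c \<le> 0" "cart c b \<le> 0" "cart b c \<le> 0" "cart ?d a \<le> 0" "cart a ?d \<le> 0"
      using abR cR c dab cd by (auto intro!: cart_nonpos)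
    have "cart c a \<le> -1" "cart ?d b \<le> -1" using adj_cart c d by auto
    then have "form ?x ?x \<le> 0"
      using abR cR sym nonpos \<open>cart a b \<le> -3/2\<close> by simp
    moreover have "supported ?x"
      using supported_alpha[of c] supported_alpha[of ?d] supported_alpha[of a] supported_alpha[of b] cR abR
      by (simp add: supported_def)
    ultimately have "?x a = 0" using form_nonneg_imp_zero by blast
    then show False using c dab abR by (auto simp: alpha_def)
  qed
qed

text \<open>\<open>opp\<close> fixes the edge pointwise, fixes one end, swaps the ends, or moves the
  edge off itself. A fixed end is a one-vertex path between two heavy edges; disjoint heavy edges
  are joined by a longer or shorter path.\<close>

lemma simply_laced_if_opp_nontrivial:
  assumes n: "card R \<ge> 3" and c: "c \<in> R" "opp c \<noteq> c" and ab: "adj a b"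
  shows "m a b = 3"
proof (rule ccontr)
  assume "m a b \<noteq> 3"
  then have heavy: "m a b = 0 \<or> 4 \<le> m a b"
    using ab m_off_diag[of a b] by (auto simp: adj_def)
  have abR: "a \<in> R" "b \<in> R" "a \<noteq> b" using ab by (auto simp: adj_def)
  have ba: "adj b a" using ab adj_sym by blast
  note h = heavy_cart[OF heavy]
  have h': "cart b a \<le> - sqrt 2" using h cart_sym abR by simp
  have oh: "cart (opp a) (opp b) \<le> - sqrt 2" "cart (opp b) (opp a) \<le> - sqrt 2"
    using h h' cart_opp abR by auto
  consider "opp a = a" "opp b = b" | "opp a \<noteq> a" "opp b = b" | "opp a = a" "opp b \<noteq> b"
    | "opp a = b" | "opp a \<noteq> a" "opp b \<noteq> b" "opp a \<noteq> b" by blast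
  then show False
  proof cases
    case 1
    then show ?thesis using no_heavy_fixed_edge[OF ab h _ _ c] by blast
  next
    case 2
    then show ?thesis
      using no_two_heavy_ends[of "[b]" a "opp a"] abR h oh opp_eq_iff[of a b] by (auto simp: is_path_def)
  next
    case 3
    then show ?thesis
      using no_two_heavy_ends[of "[a]" b "opp b"] abR h' oh opp_eq_iff[of b a] by (auto simp: is_path_def)
  next
    case 4
    then show ?thesis using no_heavy_swapped_edge[OF ab heavy _ n] by blast
  next
    case 5
    then have "opp b \<noteq> a" using abR opp_opp[of b] by auto
    with 5 have disj: "{a, b} \<inter> {opp a, opp b} = {}" by auto
    obtain z where z: "is_path z" "set z \<inter> {a, b} = {hd z}" "set z \<inter> {opp a, opp b} = {last z}"
      using ex_path[of "{a, b}" "{opp a, opp b}"] abR by auto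
    \<comment> \<open>The connecting path may leave either edge at either end; \<open>e\<close> and
      \<open>e'\<close> are the ends it does not use.\<close>
    define e where "e = (if hd z = a then b else a)"
    define e' where "e' = (if last z = opp a then opp b else opp a)"
    have ends: "hd z \<in> {a, b}" "last z \<in> {opp a, opp b}" using z by auto
    have "opp a \<noteq> opp b" using abR opp_eq_iff by simp
    then have e: "e \<in> {a, b}" "e \<noteq> hd z" "e' \<in> {opp a, opp b}" "e' \<noteq> last z"
      using abR ends by (auto simp: e_def e'_def)
    then have "e \<notin> set z" "e' \<notin> set z" using z(2,3) by blast+
    moreover have "e \<noteq> e'" "e \<in> R" "e' \<in> R" using e disj abR by auto
    moreover have "cart e (hd z) \<le> - sqrt 2" "cart e' (last z) \<le> - sqrt 2"
      using ends h h' oh by (auto simp: e_def e'_def)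
    ultimately show ?thesis using no_two_heavy_ends[OF z(1)] by blast
  qed
qed

end

section \<open>Simply laced groups\<close>

context finite_coxeter_system
begin

lemma gen_commute: "r \<in> R \<Longrightarrow> s \<in> R \<Longrightarrow> \<not> adj r s \<Longrightarrow> r \<otimes> s = s \<otimes> r"
proof (cases "r = s")
  case False
  assume rs: "r \<in> R" "s \<in> R" "\<not> adj r s"
  with False have "m r s = 2" by (simp add: adj_def)
  then have "r \<otimes> (s \<otimes> (r \<otimes> s)) = \<one>"
    using ev_relator[of r s] rs by (simp add: relator_def numeral_2_eq_2)
  then have "r \<otimes> (s \<otimes> (r \<otimes> s)) \<otimes> s \<otimes> r = s \<otimes> r" using rs by simp
  then show ?thesis using rs by (simp add: m_assoc)
qed simp

definition nonneg :: "('a \<Rightarrow> real) \<Rightarrow> bool" where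
  "nonneg v \<longleftrightarrow> (\<forall>i. 0 \<le> v i)"

section \<open>Parabolic subgroups\<close>

definition parabolic :: "'a set \<Rightarrow> 'a set" where
  "parabolic J = ev ` lists J"

lemma lists_subset: "J \<subseteq> R \<Longrightarrow> w \<in> lists J \<Longrightarrow> w \<in> lists R"
  by (auto simp: in_lists_conv_set)

lemma parabolic_closed: "J \<subseteq> R \<Longrightarrow> x \<in> parabolic J \<Longrightarrow> x \<in> carrier G"
  using lists_subset by (auto simp: parabolic_def)

lemma parabolic_one [simp]: "\<one> \<in> parabolic J"
  unfolding parabolic_def by (rule image_eqI[of _ _ "[]"]) auto

lemma parabolic_gen: "J \<subseteq> R \<Longrightarrow> j \<in> J \<Longrightarrow> j \<in> parabolic J"
  unfolding parabolic_def by (rule image_eqI[of _ _ "[j]"]) auto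

lemma parabolic_mult:
  assumes "J \<subseteq> R" "x \<in> parabolic J" "y \<in> parabolic J"
  shows "x \<otimes> y \<in> parabolic J"
proof -
  obtain u w where "u \<in> lists J" "ev u = x" "w \<in> lists J" "ev w = y"
    using assms by (auto simp: parabolic_def)
  then show ?thesis
    unfolding parabolic_def using lists_subset[OF assms(1)]
    by (intro image_eqI[of _ _ "u @ w"]) simp_all
qed

lemma parabolic_inv:
  assumes "J \<subseteq> R" "x \<in> parabolic J"
  shows "inv x \<in> parabolic J"
proof -
  obtain u where "u \<in> lists J" "ev u = x"
    using assms by (auto simp: parabolic_def)
  then show ?thesis
    unfolding parabolic_def using lists_subset[OF assms(1)]
    by (intro image_eqI[of _ _ "rev u"]) (simp_all add: ev_rev)
qed

text \<open>Multiplying by a letter either lengthens a reduced word or, by the exchange condition,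
  deletes one of its letters; neither leaves \<open>J\<close>.\<close>

lemma parabolic_reduced:
  assumes "J \<subseteq> R" "x \<in> parabolic J"
  shows "\<exists>w\<in>lists J. reduced w \<and> ev w = x"
proof -
  have "\<exists>v\<in>lists J. reduced v \<and> ev v = ev w" if "w \<in> lists J" for w
    using that
  proof induction
    case Nil
    show ?case by (intro bexI[of _ "[]"]) auto
  next
    case (Cons j w)
    then obtain v where v: "v \<in> lists J" "reduced v" "ev v = ev w" by blast
    have j: "j \<in> R" using Cons assms by blast
    have vR: "v \<in> lists R" using v by (simp add: reduced_in_lists)
    show ?case
    proof (cases "len (ev v) < len (j \<otimes> ev v)")
      case True
      then have "reduced (j # v)" using v j by (simp add: reduced_Cons_iff)
      then show ?thesis using v Cons by (intro bexI[of _ "j # v"]) auto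
    next
      case False
      then have less: "len (ev v) = len (j \<otimes> ev v) + 1"
        using len_gen_mult_cases[of "ev v" j] vR j by auto
      then obtain i where i: "i < length v" "j \<otimes> ev v = ev (take i v @ drop (Suc i) v)"
        using exchange[OF vR j] by auto
      then have "reduced (take i v @ drop (Suc i) v)"
        using v(2) less vR by (simp add: reduced_def)
      then show ?thesis
        using i v by (intro bexI[of _ "take i v @ drop (Suc i) v"]) auto
    qed
  qed
  then show ?thesis using assms by (auto simp: parabolic_def)
qed

lemma act_fixes_coordinate: "s \<notin> set w \<Longrightarrow> act w v s = v s"
  by (induction w) (auto simp: refl_def alpha_def)

lemma coroot_nonpos_if_nonneg:
  assumes "s \<in> R" "nonneg v" "v s = 0"
  shows "coroot s v \<le> 0"
  unfolding coroot_def
proof (rule sum_nonpos)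
  fix i assume "i \<in> R"
  then show "cart s i * v i \<le> 0"
    using cart_nonpos[of s i] assms by (cases "i = s") (auto simp: nonneg_def mult_le_0_iff)
qed

lemma rho_alpha_nonzero:
  assumes "x \<in> carrier G" "s \<in> R" "nonneg (rho x (alpha s))" "nonneg (\<lambda>i. - rho x (alpha s) i)"
  shows False
proof -
  have "rho x (alpha s) = (\<lambda>i. 0)"
    using assms(3,4) by (auto simp: nonneg_def fun_eq_iff intro: antisym)
  then have "form (rho x (alpha s)) (rho x (alpha s)) = 0" by simp
  then show False using assms(1,2) by simp
qed

end

section \<open>Positive roots and their integrality\<close>

locale simply_laced_coxeter_system = irreducible_finite_coxeter_system +
  assumes simply_laced: "adj a b \<Longrightarrow> m a b = 3"
begin

lemma cart_adj: "adj r s \<Longrightarrow> cart r s = -1"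
  using simply_laced cart_3 by blast

lemma braid: "adj r s \<Longrightarrow> r \<otimes> s \<otimes> r = s \<otimes> r \<otimes> s"
proof -
  assume a: "adj r s"
  then have rs: "r \<in> R" "s \<in> R" by (auto simp: adj_def)
  have "r \<otimes> (s \<otimes> (r \<otimes> (s \<otimes> (r \<otimes> s)))) = \<one>"
    using ev_relator[of r s] simply_laced[OF a] rs by (simp add: relator_def numeral_3_eq_3)
  then have "r \<otimes> (s \<otimes> (r \<otimes> (s \<otimes> (r \<otimes> s)))) \<otimes> s \<otimes> r \<otimes> s = s \<otimes> r \<otimes> s" using rs by simp
  then show ?thesis using rs by (simp add: m_assoc)
qed

text \<open>Induction over \<open>x = y \<otimes> t\<close>. If \<open>s\<close> and
  \<open>t\<close> commute, \<open>t\<close> fixes \<open>alpha s\<close>. If they are adjacent,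
  \<open>t\<close> sends \<open>alpha s\<close> to \<open>alpha s + alpha t\<close>, which settles
  the case where \<open>s\<close> lengthens \<open>y\<close>; otherwise
  \<open>y = z \<otimes> s\<close>, and \<open>s \<otimes> t\<close> sends \<open>alpha s\<close> to
  \<open>alpha t\<close>, with the braid relation showing that \<open>t\<close> lengthens
  \<open>z\<close>.\<close>

lemma rho_alpha_nonneg:
  assumes "x \<in> carrier G" "s \<in> R" "len x < len (x \<otimes> s)"
  shows "nonneg (rho x (alpha s))"
  using assms
proof (induction "len x" arbitrary: x s rule: less_induct)
  case less
  show ?case
  proof (cases "x = \<one>")
    case True
    then show ?thesis by (simp add: nonneg_def alpha_def)
  next
    case False
    then have "inv x \<noteq> \<one>" using less.prems by (metis inv_inv inv_one)
    then obtain t where t: "t \<in> R" "len (t \<otimes> inv x) < len (inv x)"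
      using ex_left_descent[of "inv x"] less.prems by auto
    define y where "y = x \<otimes> t"
    have y: "y \<in> carrier G" and xy: "x = y \<otimes> t" using t less.prems by (simp_all add: y_def)
    have "inv y = t \<otimes> inv x" using t less.prems by (simp add: y_def inv_mult_group)
    then have ly: "len x = len y + 1"
      using t len_mult_gen_cases[of x t] less.prems len_inv[of y] y by (auto simp: y_def)
    have st: "s \<noteq> t"
      using less.prems ly xy y t by auto
    have rho_x: "rho x v = rho y (refl t v)" for v
      using y t by (simp add: xy rho_mult)
    show ?thesis
    proof (cases "adj s t")
      case False
      then have comm: "t \<otimes> s = s \<otimes> t" using gen_commute[of t s] adj_sym[of t s] less.prems t by blast
      have "len y < len (y \<otimes> s)"
      proof (rule ccontr)
        assume "\<not> ?thesis"
        then have "len y = len (y \<otimes> s) + 1" using len_mult_gen_cases[of y s] y less.prems by auto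
        moreover have "x \<otimes> s = y \<otimes> s \<otimes> t" using comm y t less.prems by (simp add: xy m_assoc)
        ultimately show False
          using len_mult_le[of "y \<otimes> s" t] y t less.prems ly by simp
      qed
      then have "nonneg (rho y (alpha s))" using less.hyps[of y s] ly y less.prems by simp
      moreover have "refl t (alpha s) = alpha s"
      proof -
        have "\<not> adj t s" using False adj_sym by blast
        then have "cart t s = 0" using not_adj_cart[of t s] st t less.prems by simp
        then show ?thesis using less.prems by (simp add: refl_def)
      qed
      ultimately show ?thesis by (simp add: rho_x)
    next
      case True
      have c: "cart t s = -1" using cart_adj adj_sym True by blast
      show ?thesis
      proof (cases "len y < len (y \<otimes> s)")
        case ys: True
        have "nonneg (rho y (alpha s))" using less.hyps[of y s] ly y less.prems ys by simp
        moreover have "nonneg (rho y (alpha t))"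
          using less.hyps[of y t] ly y t xy by simp
        moreover have "refl t (alpha s) = (\<lambda>i. alpha s i + alpha t i)"
          using c less.prems by (simp add: refl_def)
        ultimately show ?thesis by (simp add: rho_x rho_add nonneg_def)
      next
        case False
        then have lys: "len y = len (y \<otimes> s) + 1" using len_mult_gen_cases[of y s] y less.prems by auto
        define z where "z = y \<otimes> s"
        have z: "z \<in> carrier G" and yz: "y = z \<otimes> s" using y less.prems by (simp_all add: z_def)
        have "len z < len (z \<otimes> t)"
        proof (rule ccontr)
          assume "\<not> ?thesis"
          then have "len z = len (z \<otimes> t) + 1" using len_mult_gen_cases[of z t] z t by auto
          moreover have "x \<otimes> s = z \<otimes> t \<otimes> s \<otimes> t"
            using braid[OF True] z t less.prems by (simp add: xy yz m_assoc)
          ultimately show False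
            using len_mult_le[of "z \<otimes> t \<otimes> s" t] len_mult_le[of "z \<otimes> t" s] z t less.prems ly lys
            by (simp add: z_def[symmetric])
        qed
        then have "nonneg (rho z (alpha t))"
          using less.hyps[of z t] z t ly lys by (simp add: z_def)
        moreover have "rho x (alpha s) = rho z (refl s (refl t (alpha s)))"
          using z less.prems by (simp add: rho_x) (simp add: yz rho_mult)
        moreover have "refl s (refl t (alpha s)) = alpha t"
          using c cart_adj[OF True] less.prems t by (simp add: refl_def fun_eq_iff)
        ultimately show ?thesis by simp
      qed
    qed
  qed
qed

lemma rho_alpha_nonpos:
  assumes "x \<in> carrier G" "s \<in> R" "len (x \<otimes> s) < len x"
  shows "nonneg (\<lambda>i. - rho x (alpha s) i)"
proof -
  have "nonneg (rho (x \<otimes> s) (alpha s))"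
    using rho_alpha_nonneg[of "x \<otimes> s" s] assms by simp
  moreover have "refl s (alpha s) = (\<lambda>i. - alpha s i)"
    using assms by (simp add: refl_def fun_eq_iff)
  ultimately show ?thesis using assms by (simp add: rho_mult rho_uminus)
qed

lemma rho_alpha_sign:
  assumes "x \<in> carrier G" "s \<in> R"
  shows "nonneg (rho x (alpha s)) \<or> nonneg (\<lambda>i. - rho x (alpha s) i)"
  using rho_alpha_nonneg[of x s] rho_alpha_nonpos[of x s] len_mult_gen_cases[of x s] assms by auto

lemma rho_inv_alpha_nonneg:
  assumes "x \<in> carrier G" "s \<in> R" "len x < len (s \<otimes> x)"
  shows "nonneg (rho (inv x) (alpha s))"
proof -
  have "len (inv x \<otimes> s) = len (s \<otimes> x)"
    using assms len_inv[of "s \<otimes> x"] by (simp add: inv_mult_group)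
  then show ?thesis using rho_alpha_nonneg[of "inv x" s] assms by simp
qed

definition integral :: "('a \<Rightarrow> real) \<Rightarrow> bool" where
  "integral v \<longleftrightarrow> (\<forall>i. v i \<in> \<int>)"

lemma cart_int: "r \<in> R \<Longrightarrow> s \<in> R \<Longrightarrow> cart r s \<in> \<int>"
  using cart_adj[of r s] not_adj_cart[of r s] by (cases "r = s"; cases "adj r s") auto

lemma coroot_int: "r \<in> R \<Longrightarrow> integral v \<Longrightarrow> coroot r v \<in> \<int>"
  unfolding coroot_def integral_def by (intro Ints_sum Ints_mult cart_int) auto

lemma form_int: "integral v \<Longrightarrow> integral w \<Longrightarrow> form v w \<in> \<int>"
  unfolding form_def by (intro Ints_sum Ints_mult coroot_int) (auto simp: integral_def)

lemma integral_alpha [simp]: "integral (alpha r)"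
  by (simp add: integral_def alpha_def)

lemma integral_refl [simp]: "s \<in> R \<Longrightarrow> integral v \<Longrightarrow> integral (refl s v)"
  using coroot_int[of s v] integral_alpha[of s] by (simp add: integral_def refl_def)

lemma integral_act [simp]: "w \<in> lists R \<Longrightarrow> integral v \<Longrightarrow> integral (act w v)"
  by (induction w) auto

lemma Ints_gt_minus_2: "k \<in> \<int> \<Longrightarrow> -2 < k \<Longrightarrow> -1 \<le> (k :: real)"
proof -
  assume "k \<in> \<int>" "-2 < k"
  then obtain z where "k = of_int z" "-2 < z" by (auto elim!: Ints_cases)
  then show ?thesis by simp
qed

text \<open>\<open>v + w\<close> is nonzero because of the coordinate \<open>i\<close>, so its norm
  \<open>4 + 2 * form v w\<close> is positive; integrality improves the bound -2.\<close>

lemma form_ge_minus_1: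
  assumes "supported v" "supported w" "integral v" "integral w" "form v v = 2" "form w w = 2"
    and "i \<in> R" "v i + w i \<noteq> 0"
  shows "form v w \<ge> -1"
proof -
  have "form (\<lambda>i. v i + w i) (\<lambda>i. v i + w i) > 0"
    using assms by (intro form_pos[of _ i]) (auto simp: supported_def)
  then have "form v w > -2" using assms form_sym[of w v] by simp
  then show ?thesis using Ints_gt_minus_2 form_int assms by blast
qed

section \<open>A repeated letter yields an involutive prefix\<close>

text \<open>The witness \<open>g\<close> is a product of reflections in pairwise orthogonal roots \<open>\<gamma>\<close> with
  \<open>v \<alpha>\<^sub>s = \<alpha>\<^sub>s + \<Sum> \<gamma>\<close>; the last conjunct is what remains of this description in the induction.\<close>

lemma ex_swapping_element:
  assumes "s \<in> R" "reduced v" "s \<notin> set v"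
  shows "\<exists>g\<in>parabolic (R - {s}). rho g (alpha s) = act v (alpha s) \<and>
    rho g (act v (alpha s)) = alpha s \<and>
    (\<forall>\<beta>. supported \<beta> \<longrightarrow> integral \<beta> \<longrightarrow> form \<beta> \<beta> = 2 \<longrightarrow> \<beta> s = 0 \<longrightarrow> coroot s \<beta> = -1 \<longrightarrow>
      form (act v (alpha s)) \<beta> = -1 \<longrightarrow> rho g \<beta> = \<beta>)"
  using assms(2,3)
proof (induction v)
  case Nil
  show ?case by (intro bexI[of _ \<one>]) simp_all
next
  case (Cons j v)
  let ?J = "R - {s}"
  have J: "?J \<subseteq> R" by blast
  define y where "y = act v (alpha s)"
  have j: "j \<in> R" "j \<noteq> s" "reduced v" "len (ev v) < len (j \<otimes> ev v)" "s \<notin> set v"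
    using Cons.prems by (auto simp: reduced_Cons_iff)
  have vR: "v \<in> lists R" using j by (simp add: reduced_in_lists)
  obtain g where g: "g \<in> parabolic ?J" "rho g (alpha s) = y" "rho g y = alpha s"
    and fix_g: "\<And>\<beta>. supported \<beta> \<Longrightarrow> integral \<beta> \<Longrightarrow> form \<beta> \<beta> = 2 \<Longrightarrow> \<beta> s = 0 \<Longrightarrow> coroot s \<beta> = -1 \<Longrightarrow>
      form y \<beta> = -1 \<Longrightarrow> rho g \<beta> = \<beta>"
    using Cons.IH j unfolding y_def[symmetric] by blast
  have gc: "g \<in> carrier G" using parabolic_closed[OF J g(1)] .
  have jp: "j \<in> parabolic ?J" using parabolic_gen[OF J] j by simp
  have y: "supported y" "integral y" "form y y = 2" "y s = 1"
    using vR assms(1) j(5) by (simp_all add: y_def act_fixes_coordinate) (simp add: alpha_def)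
  \<comment> \<open>Pulling back by \<open>v\<close> turns \<open>alpha j\<close> into a nonnegative
    root with \<open>s\<close>-coordinate 0, which pairs nonpositively with \<open>alpha s\<close>.
    With \<open>form_ge_minus_1\<close> only the values 0 and -1 remain.\<close>
  have "coroot j y = form (rho (inv (ev v)) (alpha j)) (alpha s)"
  proof -
    have "form (rho (inv (ev v)) (alpha j)) (rho (inv (ev v)) y) = form (alpha j) y"
      using vR by simp
    moreover have "rho (inv (ev v)) y = alpha s"
      using vR rho_inv_cancel[of "ev v" "alpha s"] by (simp add: y_def rho_ev)
    ultimately show ?thesis using j by simp
  qed
  moreover have "nonneg (rho (inv (ev v)) (alpha j))"
    using rho_inv_alpha_nonneg[of "ev v" j] vR j by simp
  moreover have "rho (inv (ev v)) (alpha j) s = 0"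
    using act_fixes_coordinate[of s "rev v" "alpha j"] rho_ev[of "rev v"] vR j
    by (simp add: ev_rev alpha_def)
  ultimately have "coroot j y \<le> 0"
    using coroot_nonpos_if_nonneg[OF assms(1)] assms(1) by simp
  moreover have "coroot j y \<in> \<int>" using coroot_int j y by simp
  moreover have "coroot j y \<ge> -1"
  proof -
    have "alpha j s = 0" using j by (simp add: alpha_def)
    then show ?thesis using form_ge_minus_1[of y "alpha j" s] y j assms(1) by simp
  qed
  ultimately have cases: "coroot j y = 0 \<or> coroot j y = -1"
    by (auto elim!: Ints_cases)
  have act_jv: "act (j # v) (alpha s) = refl j y" by (simp add: y_def)
  show ?case unfolding act_jv
  proof (cases "coroot j y = 0")
    case True
    then have "refl j y = y" by (simp add: refl_def)
    then show "\<exists>g\<in>parabolic ?J. rho g (alpha s) = refl j y \<and> rho g (refl j y) = alpha s \<and>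
      (\<forall>\<beta>. supported \<beta> \<longrightarrow> integral \<beta> \<longrightarrow> form \<beta> \<beta> = 2 \<longrightarrow> \<beta> s = 0 \<longrightarrow> coroot s \<beta> = -1 \<longrightarrow>
        form (refl j y) \<beta> = -1 \<longrightarrow> rho g \<beta> = \<beta>)"
      using g fix_g by (intro bexI[of _ g]) simp_all
  next
    case False
    then have m1: "coroot j y = -1" using cases by simp
    show "\<exists>g\<in>parabolic ?J. rho g (alpha s) = refl j y \<and> rho g (refl j y) = alpha s \<and>
      (\<forall>\<beta>. supported \<beta> \<longrightarrow> integral \<beta> \<longrightarrow> form \<beta> \<beta> = 2 \<longrightarrow> \<beta> s = 0 \<longrightarrow> coroot s \<beta> = -1 \<longrightarrow>
        form (refl j y) \<beta> = -1 \<longrightarrow> rho g \<beta> = \<beta>)"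
    proof (cases "adj j s")
      case False
      then have c0: "cart j s = 0" "cart s j = 0"
        using not_adj_cart[of j s] cart_sym[of j s] j assms(1) by auto
      have js: "refl j (alpha s) = alpha s" using c0 assms(1) by (simp add: refl_def)
      \<comment> \<open>As \<open>j\<close> fixes \<open>alpha s\<close>, the conjugate of
        \<open>g\<close> by \<open>j\<close> swaps \<open>alpha s\<close> and
        \<open>refl j y\<close>; it fixes \<open>\<beta>\<close> since \<open>g\<close> fixes
        \<open>refl j \<beta>\<close>.\<close>
      have rho': "rho (j \<otimes> g \<otimes> j) v = refl j (rho g (refl j v))" for v
        using j gc by (simp add: rho_mult)
      have "rho (j \<otimes> g \<otimes> j) \<beta> = \<beta>"
        if b: "supported \<beta>" "integral \<beta>" "form \<beta> \<beta> = 2" "\<beta> s = 0" "coroot s \<beta> = -1"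
          "form (refl j y) \<beta> = -1" for \<beta>
      proof -
        have "form y (refl j \<beta>) = form (refl j y) \<beta>"
          using form_refl[of j "refl j y" \<beta>] j by simp
        then have "rho g (refl j \<beta>) = refl j \<beta>"
          using b j c0 by (intro fix_g) (simp_all add: coroot_refl, simp add: refl_def alpha_def)
        then show ?thesis using j by (simp add: rho')
      qed
      then show ?thesis
        using g js j gc jp
        by (intro bexI[of _ "j \<otimes> g \<otimes> j"] parabolic_mult[OF J]) (simp_all add: rho')
    next
      case True
      then have cm: "cart j s = -1" "cart s j = -1"
        using cart_adj adj_sym by blast+
      have rho': "rho (j \<otimes> g) v = refl j (rho g v)" for v
        using j gc by (simp add: rho_mult)
      have jy: "refl j y = (\<lambda>i. y i + alpha j i)" using m1 by (simp add: refl_def)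
      \<comment> \<open>\<open>alpha j\<close> itself meets the conditions on
        \<open>\<beta>\<close>, so the last conjunct of the induction hypothesis applies to it; this
        makes \<open>j \<otimes> g\<close> the next swapping element.\<close>
      have gj: "rho g (alpha j) = alpha j"
        using j cm m1 by (intro fix_g) (simp_all, simp add: alpha_def)
      have "rho g (refl j y) = (\<lambda>i. alpha s i + alpha j i)"
        by (simp add: jy rho_add gj g)
      then have "rho (j \<otimes> g) (refl j y) = alpha s"
        using j cm assms(1) by (simp add: rho') (simp add: refl_def)
      moreover have "rho (j \<otimes> g) \<beta> = \<beta>"
        if b: "supported \<beta>" "integral \<beta>" "form \<beta> \<beta> = 2" "\<beta> s = 0" "coroot s \<beta> = -1"
          "form (refl j y) \<beta> = -1" for \<beta>
      proof -
        \<comment> \<open>Both \<open>form ?a \<beta>\<close> and \<open>form y \<beta>\<close> are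
          at least -1. The first bound gives \<open>coroot j \<beta> \<ge> 0\<close>, and since
          \<open>form y \<beta> + coroot j \<beta>\<close> is -1, both bounds are attained; hence
          \<open>j\<close> as well as \<open>g\<close> fixes \<open>\<beta>\<close>.\<close>
        let ?a = "\<lambda>i. alpha s i + alpha j i"
        have "form ?a \<beta> \<ge> -1"
        proof (rule form_ge_minus_1[of _ _ s])
          show "supported ?a"
            using supported_alpha[OF assms(1)] supported_alpha[OF j(1)] by (simp add: supported_def)
          show "integral ?a"
            using integral_alpha[of s] integral_alpha[of j] by (simp add: integral_def)
          show "form ?a ?a = 2" using cm j assms(1) by simp
          show "?a s + \<beta> s \<noteq> 0" using b j by (simp add: alpha_def)
        qed (use b assms(1) in simp_all)
        then have "coroot j \<beta> \<ge> 0" using b j assms(1) by simp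
        moreover have "form y \<beta> \<ge> -1"
          using y b assms(1) by (intro form_ge_minus_1[of _ _ s]) simp_all
        moreover have "form y \<beta> + coroot j \<beta> = -1"
          using b(6) j by (simp add: jy)
        ultimately have "coroot j \<beta> = 0" "form y \<beta> = -1" by linarith+
        then show ?thesis
          using fix_g[of \<beta>] b by (simp add: rho') (simp add: refl_def)
      qed
      ultimately show ?thesis
        using g jp by (intro bexI[of _ "j \<otimes> g"] parabolic_mult[OF J]) (simp_all add: rho')
    qed
  qed
qed

text \<open>These generators commute with \<open>s\<close>; together they generate the stabilizer of
  \<open>alpha s\<close> in the parabolic subgroup of \<open>R - {s}\<close>.\<close>

definition far :: "'a \<Rightarrow> 'a set" where
  "far s = {c \<in> R. c \<noteq> s \<and> \<not> adj c s}"

lemma far_subset: "far s \<subseteq> R" "far s \<subseteq> R - {s}"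
  by (auto simp: far_def)

text \<open>Consider the last letter \<open>j\<close> of a reduced word \<open>w @ [j]\<close>
  fixing \<open>alpha s\<close>. Were it adjacent to \<open>s\<close>, then
  \<open>act w (alpha s)\<close>, which is \<open>alpha s - act w (alpha j)\<close>, would have
  \<open>s\<close>-coordinate 1 and hence be nonnegative, squeezing the nonnegative root
  \<open>act w (alpha j)\<close> to 0. So \<open>j\<close> fixes \<open>alpha s\<close> and can be
  stripped.\<close>

lemma stabilizer_in_parabolic:
  assumes "s \<in> R" "x \<in> parabolic (R - {s})" "rho x (alpha s) = alpha s"
  shows "x \<in> parabolic (far s)"
proof -
  have "ev w \<in> parabolic (far s)"
    if "reduced w" "s \<notin> set w" "act w (alpha s) = alpha s" for w
    using that
  proof (induction w rule: rev_induct)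
    case (snoc j w)
    have j: "j \<in> R" "reduced w" "len (ev w) < len (ev w \<otimes> j)" "j \<noteq> s" "s \<notin> set w"
      using snoc.prems by (auto simp: reduced_snoc_iff)
    have wR: "w \<in> lists R" using j by (simp add: reduced_in_lists)
    have nn: "nonneg (act w (alpha j))"
      using rho_alpha_nonneg[of "ev w" j] wR j by (simp add: rho_ev)
    have far: "j \<in> far s"
    proof (rule ccontr)
      assume "j \<notin> far s"
      then have "adj j s" using j by (simp add: far_def)
      then have c: "cart j s = -1" by (rule cart_adj)
      have "refl j (alpha s) = (\<lambda>i. alpha s i + alpha j i)"
        using c assms(1) by (simp add: refl_def)
      then have "alpha s = (\<lambda>i. act w (alpha s) i + act w (alpha j) i)"
        using snoc.prems(3) by (simp add: act_add)
      then have e: "act w (alpha s) i = alpha s i - act w (alpha j) i" for i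
        by (metis add_diff_cancel_right')
      have s1: "act w (alpha s) s = 1"
        using act_fixes_coordinate[OF j(5)] by (simp add: alpha_def)
      have "nonneg (act w (alpha s))"
        using rho_alpha_sign[of "ev w" s] wR assms(1) s1 by (auto simp: rho_ev nonneg_def dest: spec[of _ s])
      then have "act w (alpha j) i \<le> alpha s i" for i
      proof -
        have "0 \<le> act w (alpha s) i" using \<open>nonneg (act w (alpha s))\<close> by (simp add: nonneg_def)
        then show ?thesis using e[of i] by linarith
      qed
      moreover have "alpha s i = 0" if "i \<noteq> s" for i using that by (simp add: alpha_def)
      moreover have "act w (alpha j) s = 0"
        using act_fixes_coordinate[OF j(5)] j(4) by (simp add: alpha_def)
      ultimately have "act w (alpha j) i = 0" for i
        using nn by (cases "i = s") (simp, metis antisym nonneg_def)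
      then have "act w (alpha j) = (\<lambda>i. 0)" by blast
      then have "form (act w (alpha j)) (act w (alpha j)) = 0" by simp
      then show False using wR j by simp
    qed
    then have "\<not> adj j s" "j \<noteq> s" by (auto simp: far_def)
    then have "refl j (alpha s) = alpha s"
      using not_adj_cart[of j s] j assms(1) by (simp add: refl_def)
    then have "ev w \<in> parabolic (far s)" using snoc.IH snoc.prems j by simp
    then show ?case
      using parabolic_mult[OF far_subset(1) _ parabolic_gen[OF far_subset(1) far]] wR j by simp
  qed simp
  moreover obtain w where "w \<in> lists (R - {s})" "reduced w" "ev w = x"
    using parabolic_reduced[OF _ assms(2)] by blast
  ultimately show ?thesis
    using assms(3) rho_ev[of w] by (auto simp: in_lists_conv_set reduced_in_lists)
qed

lemma antidominant_unique:
  assumes "C \<subseteq> R" "reduced w" "set w \<subseteq> C" "\<And>j. j \<in> C \<Longrightarrow> coroot j X \<le> 0"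
    and "\<And>j. j \<in> C \<Longrightarrow> coroot j (act w X) \<le> 0"
  shows "act w X = X"
  using assms(2-)
proof (induction w rule: rev_induct)
  case (snoc j w)
  let ?w = "w @ [j]" and ?Z = "act (w @ [j]) X"
  have wR: "?w \<in> lists R" using snoc.prems(1) by (rule reduced_in_lists)
  have j: "j \<in> C" "j \<in> R" "reduced w" "set w \<subseteq> C" "len (ev w) < len (ev w \<otimes> j)"
    using snoc.prems(1,2) by (auto simp: reduced_snoc_iff)
  let ?d = "act ?w (alpha j)"
  have "len (ev ?w \<otimes> j) < len (ev ?w)" using j wR by simp
  then have neg: "nonneg (\<lambda>i. - ?d i)"
    using rho_alpha_nonpos[of "ev ?w" j] j wR by (simp add: rho_ev[OF wR] del: act_append ev_append)
  have "?d i * coroot i ?Z \<ge> 0" if "i \<in> R" for i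
  proof (cases "i \<in> C")
    case True
    then show ?thesis
      using neg snoc.prems(4)[OF True] by (simp add: nonneg_def mult_nonpos_nonpos del: act_append)
  next
    case False
    then have "i \<notin> set ?w" "i \<noteq> j" using snoc.prems(2) j by auto
    then show ?thesis using act_fixes_coordinate[of i ?w "alpha j"] by (simp add: alpha_def)
  qed
  then have "form ?d ?Z \<ge> 0" unfolding form_def by (intro sum_nonneg)
  then have "coroot j X \<ge> 0" using form_act[OF wR] j by (simp del: act_append)
  then have "refl j X = X" using snoc.prems(3)[OF j(1)] by (simp add: refl_def)
  then show ?case using snoc.IH[OF j(3,4)] snoc.prems(3,4) by simp
qed simp

text \<open>Such a \<open>v\<close> is the shortest element of its double coset of the stabilizer of \<open>\<alpha>\<^sub>s\<close> in the
  parabolic subgroup, and swapping \<open>\<alpha>\<^sub>s\<close> and \<open>v \<alpha>\<^sub>s\<close> shows that this double coset is closed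
  under inversion.\<close>

lemma minimal_double_coset_involutive:
  assumes s: "s \<in> R" and v: "reduced v" "s \<notin> set v"
    and left: "\<And>c. c \<in> far s \<Longrightarrow> len (ev v) < len (c \<otimes> ev v)"
    and right: "\<And>c. c \<in> far s \<Longrightarrow> len (ev v) < len (ev v \<otimes> c)"
  shows "ev v \<otimes> ev v = \<one>"
proof -
  let ?J = "R - {s}" and ?C = "far s" and ?x = "ev v"
  have J: "?J \<subseteq> R" by blast
  have vR: "v \<in> lists R" using v by (simp add: reduced_in_lists)
  have vJ: "v \<in> lists ?J" using v vR by (auto simp: in_lists_conv_set)
  then have xJ: "?x \<in> parabolic ?J" by (simp add: parabolic_def)
  have xc: "?x \<in> carrier G" using vR by simp
  obtain g where g: "g \<in> parabolic ?J" "rho g (alpha s) = rho ?x (alpha s)"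
    "rho g (rho ?x (alpha s)) = alpha s"
    using ex_swapping_element[OF s v] rho_ev[OF vR] by auto
  have gc: "g \<in> carrier G" using parabolic_closed[OF J g(1)] .
  \<comment> \<open>\<open>inv y\<close> takes \<open>alpha j\<close> to a nonnegative root with
    \<open>s\<close>-coordinate 0, because \<open>j\<close> lengthens \<open>y\<close> and
    \<open>inv y\<close> has a word without \<open>s\<close>; such a root pairs nonpositively with
    \<open>alpha s\<close>.\<close>
  have antidom: "coroot j (rho y (alpha s)) \<le> 0"
    if y: "y \<in> parabolic ?J" "len y < len (j \<otimes> y)" and j: "j \<in> ?C" for y j
  proof -
    have yc: "y \<in> carrier G" using parabolic_closed[OF J y(1)] .
    have jR: "j \<in> R" "j \<noteq> s" using j by (auto simp: far_def)
    have "form (rho (inv y) (alpha j)) (rho (inv y) (rho y (alpha s))) = coroot j (rho y (alpha s))"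
      using yc jR by (simp del: rho_inv_cancel)
    then have "coroot j (rho y (alpha s)) = coroot s (rho (inv y) (alpha j))"
      using yc s by simp
    moreover have "nonneg (rho (inv y) (alpha j))"
      using rho_inv_alpha_nonneg[OF yc jR(1) y(2)] .
    moreover have "rho (inv y) (alpha j) s = 0"
    proof -
      obtain w where w: "w \<in> lists ?J" "ev w = inv y"
        using parabolic_inv[OF J y(1)] by (auto simp: parabolic_def)
      then show ?thesis
        using act_fixes_coordinate[of s w "alpha j"] rho_ev[OF lists_subset[OF J w(1)]] jR
        by (auto simp: in_lists_conv_set alpha_def)
    qed
    ultimately show ?thesis using coroot_nonpos_if_nonneg[OF s] by simp
  qed
  \<comment> \<open>\<open>c\<close> fixes \<open>alpha s\<close>, so it lies in the subgroup
    generated by \<open>far s\<close>. As \<open>inv c \<otimes> g = inv ?x\<close>, the images of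
    \<open>alpha s\<close> under \<open>?x\<close> and \<open>inv ?x\<close> lie in one orbit of
    that subgroup; both are antidominant for it, hence equal.\<close>
  define c where "c = g \<otimes> ?x"
  have "c \<in> parabolic ?C"
    using g gc xc xJ by (intro stabilizer_in_parabolic[OF s]) (simp_all add: c_def rho_mult parabolic_mult[OF J])
  then obtain w where w: "w \<in> lists ?C" "reduced w" "ev w = inv c"
    using parabolic_reduced[OF far_subset(1) parabolic_inv[OF far_subset(1)]] by blast
  have cc: "c \<in> carrier G" using gc xc by (simp add: c_def)
  have "inv c \<otimes> g = inv ?x" using gc xc by (simp add: c_def inv_mult_group m_assoc)
  then have eq: "act w (rho ?x (alpha s)) = rho (inv ?x) (alpha s)"
    using rho_mult[of "inv c" g "alpha s"] cc gc g(2) rho_ev[of w] w by (simp add: reduced_in_lists)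
  have "act w (rho ?x (alpha s)) = rho ?x (alpha s)"
  proof (rule antidominant_unique[OF far_subset(1) w(2)])
    show "set w \<subseteq> ?C" using w by (auto simp: in_lists_conv_set)
    show "coroot j (rho ?x (alpha s)) \<le> 0" if "j \<in> ?C" for j
      using antidom[OF xJ left] that by blast
    show "coroot j (act w (rho ?x (alpha s))) \<le> 0" if j: "j \<in> ?C" for j
    proof -
      have "len (inv ?x) < len (j \<otimes> inv ?x)"
        using right[OF j] xc j len_inv[of "?x \<otimes> j"] by (simp add: inv_mult_group far_def)
      then show ?thesis unfolding eq using antidom[OF parabolic_inv[OF J xJ]] j by blast
    qed
  qed
  with eq have fixed: "rho (?x \<otimes> ?x) (alpha s) = alpha s"
    using rho_cancel_inv[OF xc, of "alpha s"] xc by (simp add: rho_mult)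
  have "?x \<otimes> ?x \<in> parabolic ?C"
    using stabilizer_in_parabolic[OF s parabolic_mult[OF J xJ xJ] fixed] .
  then obtain u where u: "u \<in> lists ?C" "reduced u" "ev u = ?x \<otimes> ?x"
    using parabolic_reduced[OF far_subset(1)] by blast
  show ?thesis
  proof (cases u rule: rev_cases)
    case Nil
    then show ?thesis using u by simp
  next
    case (snoc u' j)
    have uR: "u \<in> lists R" using u by (simp add: reduced_in_lists)
    have j: "j \<in> ?C" "j \<in> R" using u snoc by (auto simp: far_def)
    have "len (ev u \<otimes> j) < len (ev u)"
      using u(2) uR by (simp add: snoc reduced_snoc_iff)
    then have neg: "nonneg (\<lambda>i. - act u (alpha j) i)"
      using rho_alpha_nonpos[of "ev u" j] uR j by (simp add: rho_ev)
    have pos: "nonneg (rho (inv ?x) (alpha i))" if "i \<in> ?C" for i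
      using rho_inv_alpha_nonneg[OF xc _ left[OF that]] that by (simp add: far_def)
    \<comment> \<open>With \<open>j\<close> the last letter of the reduced word \<open>u\<close> for
      \<open>?x \<otimes> ?x\<close>, the root \<open>act u (alpha j)\<close> is a nonpositive
      combination of simple roots in \<open>far s\<close>, all of which \<open>inv ?x\<close> keeps
      nonnegative. So \<open>?x\<close> would make \<open>alpha j\<close> nonpositive, against
      \<open>right\<close>.\<close>
    have eq: "rho ?x (alpha j) i = (\<Sum>r\<in>R. act u (alpha j) r * rho (inv ?x) (alpha r) i)" for i
    proof -
      have "inv ?x \<otimes> ev u = ?x" using u xc by (simp add: m_assoc)
      then have "rho ?x (alpha j) = rho (inv ?x) (act u (alpha j))"
        using rho_mult[of "inv ?x" "ev u" "alpha j"] uR xc by (simp add: rho_ev)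
      then show ?thesis using rho_expand[of "act u (alpha j)" "inv ?x" i] uR j by simp
    qed
    have "rho ?x (alpha j) i \<le> 0" for i
      unfolding eq
    proof (rule sum_nonpos)
      fix r assume "r \<in> R"
      show "act u (alpha j) r * rho (inv ?x) (alpha r) i \<le> 0"
      proof (cases "r \<in> ?C")
        case True
        then show ?thesis using neg pos[OF True] by (simp add: nonneg_def mult_le_0_iff)
      next
        case False
        then have "r \<notin> set u" "r \<noteq> j" using u j by (auto simp: in_lists_conv_set)
        then show ?thesis using act_fixes_coordinate[of r u "alpha j"] by (simp add: alpha_def)
      qed
    qed
    then have "nonneg (\<lambda>i. - rho ?x (alpha j) i)" by (simp add: nonneg_def)
    moreover have "nonneg (rho ?x (alpha j))"
      using rho_alpha_nonneg[OF xc j(2) right[OF j(1)]] .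
    ultimately show ?thesis using rho_alpha_nonzero[OF xc j(2)] by blast
  qed
qed

text \<open>Among the reduced prefixes \<open>s v s\<close> of \<open>u\<close> with no
  \<open>s\<close> in \<open>v\<close>, a shortest one is chosen; this makes \<open>v\<close>
  minimal in its double coset. A left descent of \<open>v\<close> in \<open>far s\<close> would
  commute with \<open>s\<close> and be a second involutive prefix of \<open>u\<close>. So
  \<open>v\<close> squares to \<open>\<one>\<close>, and so does \<open>s v s\<close>, an involutive
  prefix longer than \<open>s\<close>.\<close>

lemma letter_occurs_once:
  assumes red: "reduced (s # w)" and inv1: "{y \<in> involutions G. prefix_of y (ev (s # w))} = {s}"
  shows "s \<notin> set w"
proof
  let ?u = "ev (s # w)"
  have s: "s \<in> R" and wR: "w \<in> lists R" using reduced_in_lists[OF red] by auto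
  have uc: "?u \<in> carrier G" using s wR by simp
  define Q where "Q v \<longleftrightarrow> s \<notin> set v \<and> reduced (s # v @ [s]) \<and> prefix_of (ev (s # v @ [s])) ?u" for v
  assume "s \<in> set w"
  then obtain v1 w2 where v1: "w = v1 @ s # w2" "s \<notin> set v1" using split_list_first by metis
  have "(s # v1 @ [s]) @ w2 = s # w" using v1 by simp
  then have "Q v1"
    using v1(2) red prefix_of_reduced_append[of "s # v1 @ [s]" w2] reduced_append[of "s # v1 @ [s]" w2]
    by (simp add: Q_def)
  then obtain v where "Q v" and min: "\<And>v'. Q v' \<Longrightarrow> length v \<le> length v'"
    using ex_has_least_nat[of Q v1 length] by blast
  then have v: "s \<notin> set v" "reduced (s # v @ [s])" "prefix_of (ev (s # v @ [s])) ?u"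
    by (auto simp: Q_def)
  let ?x = "ev v" and ?y = "ev (s # v @ [s])"
  have vR: "v \<in> lists R" using reduced_in_lists[OF v(2)] by simp
  have xc: "?x \<in> carrier G" using vR by simp
  have vred: "reduced v" using v(2) reduced_ConsD reduced_append by blast
  have y: "?y = s \<otimes> ?x \<otimes> s" "?y \<in> carrier G" "len ?y = length v + 2" "len ?x = length v"
    using s vR v(2) vred by (auto simp: m_assoc reduced_def simp del: ev_Cons, simp_all add: m_assoc)
  have only: "z = s" if "z \<in> involutions G" "prefix_of z ?y" for z
  proof -
    have "z \<in> carrier G" using that by (simp add: involutions_iff)
    then have "prefix_of z ?u" using prefix_of_trans[OF _ y(2) uc that(2) v(3)] by simp
    then have "z \<in> {y \<in> involutions G. prefix_of y ?u}" using that by simp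
    then show ?thesis unfolding inv1 by simp
  qed
  have comm: "c \<otimes> s = s \<otimes> c" "c \<in> R" "c \<noteq> s" if "c \<in> far s" for c
    using that gen_commute[of c s] s by (auto simp: far_def)
  have "?x \<otimes> ?x = \<one>"
  proof (rule minimal_double_coset_involutive[OF s vred v(1)])
    fix c assume c: "c \<in> far s"
    note cs = comm[OF c]
    show "len ?x < len (c \<otimes> ?x)"
    proof (rule ccontr)
      assume "\<not> ?thesis"
      then have "len ?x = len (c \<otimes> ?x) + 1" using len_gen_mult_cases[of ?x c] xc cs by auto
      moreover have "c \<otimes> ?y = s \<otimes> (c \<otimes> ?x) \<otimes> s"
        using cs s xc unfolding y(1) by (simp add: m_assoc[symmetric])
      ultimately have "len (c \<otimes> ?y) < len ?y"
        using len_mult_le[of "s \<otimes> (c \<otimes> ?x)" s] len_mult_le[of s "c \<otimes> ?x"] s xc cs y(3,4) by simp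
      then have "prefix_of c ?y" using prefix_of_gen_iff[of c ?y] cs y(2) by simp
      then show False using only[of c] cs by simp
    qed
    \<comment> \<open>A right descent \<open>c\<close> of \<open>v\<close> commutes with the final
      \<open>s\<close>, so removing it leaves a shorter prefix \<open>s v' s\<close> of
      \<open>u\<close>, against the choice of \<open>v\<close>.\<close>
    show "len ?x < len (?x \<otimes> c)"
    proof (rule ccontr)
      assume "\<not> ?thesis"
      then have l: "len ?x = len (?x \<otimes> c) + 1" using len_mult_gen_cases[of ?x c] xc cs by auto
      then obtain i where i: "i < length v" "?x \<otimes> c = ev (take i v @ drop (Suc i) v)"
        using exchange_right[OF vR cs(2)] by auto
      define v' where "v' = take i v @ drop (Suc i) v"
      have v': "v' \<in> lists R" "length v' + 1 = length v" "ev v' = ?x \<otimes> c" "s \<notin> set v'"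
        using i vR v(1) by (auto simp: v'_def dest: in_set_takeD in_set_dropD)
      let ?y' = "ev (s # v' @ [s])"
      have yl: "s # v' @ [s] \<in> lists R" using v' s by simp
      have y': "?y' = s \<otimes> (?x \<otimes> c) \<otimes> s" "?y' \<in> carrier G"
        using v' s xc cs by (simp_all add: m_assoc)
      have yy': "?y = ?y' \<otimes> c"
        using cs s xc unfolding y(1) y'(1) by (simp add: m_assoc)
      have "len ?y' = length v' + 2"
        using len_mult_le[of ?y' c] y' cs yy' y(3) v'(2) len_le[OF yl] by simp
      then have "Q v'"
      proof -
        have "reduced (s # v' @ [s])" using yl \<open>len ?y' = length v' + 2\<close> by (simp add: reduced_def)
        moreover have "prefix_of ?y' ?y"
          unfolding yy' using y' cs \<open>len ?y' = length v' + 2\<close> y(3) v'(2) yy'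
          by (intro prefix_ofI) simp_all
        then have "prefix_of ?y' ?u" using prefix_of_trans[OF y'(2) y(2) uc _ v(3)] by simp
        ultimately show ?thesis using v'(4) by (simp add: Q_def)
      qed
      from min[OF this] show False using v'(2) by simp
    qed
  qed
  then have "?y \<otimes> ?y = \<one>" using s xc unfolding y(1) by (simp add: m_assoc) (simp flip: m_assoc)
  moreover have "?y \<noteq> \<one>" using y(3) by force
  moreover have "prefix_of ?y ?y" using y(2) by (simp add: prefix_of_def)
  ultimately have "?y = s" using only[of ?y] y(2) by (simp add: involutions_iff)
  then show False using y(3) s by simp
qed

end

section \<open>Descents, inversions and fundamental weights\<close>

context coxeter_system
begin

definition descents :: "'a \<Rightarrow> 'a set" where
  "descents x = {r \<in> R. len (r \<otimes> x) < len x}"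

lemma descents_Cons: "reduced (r # w) \<Longrightarrow> r \<in> descents (ev (r # w))"
  by (auto simp: descents_def reduced_Cons_iff reduced_in_lists)

lemma descents_snoc: "reduced (w @ [r]) \<Longrightarrow> r \<in> descents (inv (ev (w @ [r])))"
proof -
  assume red: "reduced (w @ [r])"
  have "reduced (r # rev w)" using reduced_rev[of "w @ [r]"] red by simp
  then have "r \<in> descents (ev (rev (w @ [r])))" using descents_Cons[of r "rev w"] by simp
  then show ?thesis unfolding ev_rev[OF reduced_in_lists[OF red]] .
qed

lemma ex_descent: "x \<in> carrier G \<Longrightarrow> x \<noteq> \<one> \<Longrightarrow> descents x \<noteq> {}"
  using ex_left_descent[of x] by (auto simp: descents_def)

lemma descents_prefix:
  assumes "y \<in> carrier G" "u \<in> carrier G" "prefix_of y u"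
  shows "descents y \<subseteq> descents u"
proof
  fix r assume r: "r \<in> descents y"
  then have "prefix_of r y" "r \<in> R" using prefix_of_gen_iff assms by (auto simp: descents_def)
  then have "prefix_of r u" using prefix_of_trans[of r y u] assms by simp
  then show "r \<in> descents u" using \<open>r \<in> R\<close> prefix_of_gen_iff assms by (simp add: descents_def)
qed

end

context finite_coxeter_system
begin

lemma descents_opp: "x \<in> carrier G \<Longrightarrow> descents (opp x) = opp ` descents x"
proof -
  have sub: "opp ` descents y \<subseteq> descents (opp y)" if "y \<in> carrier G" for y
    using that len_opp by (auto simp: descents_def opp_mult[symmetric])
  assume x: "x \<in> carrier G"
  have "descents (opp x) \<subseteq> opp ` descents x"
  proof
    fix r assume r: "r \<in> descents (opp x)"
    then have "opp r \<in> descents x" using sub[of "opp x"] x by auto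
    then show "r \<in> opp ` descents x"
      using r by (intro image_eqI[of _ _ "opp r"]) (simp_all add: descents_def)
  qed
  with sub[OF x] show ?thesis by blast
qed

primrec nu :: "'a set \<Rightarrow> 'a list \<Rightarrow> 'a \<Rightarrow> real" where
  "nu T [] = (\<lambda>i. 0)"
| "nu T (j # w) = (\<lambda>i. of_bool (j \<in> T) * alpha j i + refl j (nu T w) i)"

text \<open>If \<open>\<omega>\<close> is the sum of the fundamental weights indexed by \<open>T\<close>, then \<open>nu T w\<close> is \<open>\<omega> - w \<omega>\<close>,
  so \<open>\<omega>\<close> and \<open>w \<omega>\<close> having the same norm amounts to the following identity.\<close>

lemma form_nu:
  assumes "w \<in> lists R" "T \<subseteq> R"
  shows "form (nu T w) (nu T w) = 2 * (\<Sum>t\<in>T. nu T w t)"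
  using assms(1)
proof induction
  case (Cons j w)
  let ?d = "of_bool (j \<in> T) :: real" and ?N = "nu T w"
  have dd: "?d * ?d = ?d" by simp
  have fin: "finite T" using assms(2) finite_R finite_subset by blast
  have "(\<Sum>t\<in>T. alpha j t) = (\<Sum>t\<in>T. if t = j then 1 else 0)"
    by (simp add: alpha_def)
  then have s: "(\<Sum>t\<in>T. alpha j t) = ?d" using fin by simp
  have "(\<Sum>t\<in>T. nu T (j # w) t) = ?d * (\<Sum>t\<in>T. alpha j t) + (\<Sum>t\<in>T. ?N t) - coroot j ?N * (\<Sum>t\<in>T. alpha j t)"
    by (simp add: refl_def sum.distrib sum_subtractf sum_distrib_left)
  also have "\<dots> = ?d + (\<Sum>t\<in>T. ?N t) - coroot j ?N * ?d"
    unfolding s dd ..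
  finally have sum: "(\<Sum>t\<in>T. nu T (j # w) t) = ?d + (\<Sum>t\<in>T. ?N t) - coroot j ?N * ?d" .
  have "form (refl j ?N) (alpha j) = - coroot j ?N" "coroot j (refl j ?N) = - coroot j ?N"
    using Cons.hyps by (simp_all add: coroot_refl)
  moreover have "form (nu T (j # w)) (nu T (j # w)) =
      ?d * ?d * 2 + 2 * ?d * coroot j (refl j ?N) + form (refl j ?N) (refl j ?N)"
    using Cons.hyps by (simp add: algebra_simps)
  ultimately have "form (nu T (j # w)) (nu T (j # w)) = 2 * ?d - 2 * ?d * coroot j ?N + form ?N ?N"
    using Cons.hyps unfolding dd by simp
  then show ?case using Cons.IH unfolding sum by (simp add: algebra_simps)
qed simp

lemma nu_fixes_coordinate: "s \<notin> set w \<Longrightarrow> nu T w s = 0"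
  by (induction w) (auto simp: refl_def alpha_def)

lemma supported_nu: "w \<in> lists R \<Longrightarrow> supported (nu T w)"
  using nu_fixes_coordinate by (auto simp: supported_def in_lists_conv_set)

end

context simply_laced_coxeter_system
begin

lemma integral_nu: "w \<in> lists R \<Longrightarrow> integral (nu T w)"
proof (induction rule: lists.induct)
  case (Cons j w)
  then have "integral (refl j (nu T w))" by simp
  then show ?case using integral_alpha[of j] by (simp add: integral_def)
qed (simp add: integral_def)

text \<open>If \<open>c\<close> does not occur in \<open>w\<close>, the inverse of \<open>w\<close>
  keeps the \<open>c\<close>-coordinate of \<open>alpha c\<close> equal to 1, whereas for a descent
  \<open>c\<close> it makes this root nonpositive.\<close>

lemma descents_subset_letters:
  assumes "w \<in> lists R"
  shows "descents (ev w) \<subseteq> set w"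
proof
  fix c assume c: "c \<in> descents (ev w)"
  then have cR: "c \<in> R" by (simp add: descents_def)
  have "len (inv (ev w) \<otimes> c) < len (inv (ev w))"
    using c assms len_inv[of "c \<otimes> ev w"] by (simp add: descents_def inv_mult_group)
  then have "nonneg (\<lambda>i. - act (rev w) (alpha c) i)"
    using rho_alpha_nonpos[of "inv (ev w)" c] assms cR rho_ev[of "rev w"] by (simp add: ev_rev)
  then have "act (rev w) (alpha c) c \<le> 0" by (simp add: nonneg_def)
  then show "c \<in> set w"
    using act_fixes_coordinate[of c "rev w" "alpha c"] by (force simp: alpha_def)
qed

text \<open>The root \<open>act p (alpha j)\<close> is an inversion: \<open>inv x\<close> makes it
  nonpositive, for \<open>x\<close> the value of the whole word. If its coordinates at the descents
  of \<open>x\<close> all vanished, it would be a nonnegative combination of simple roots that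
  \<open>inv x\<close> keeps nonnegative. Integrality turns a positive coordinate sum into one that
  is at least 1.\<close>

lemma inversion_meets_descents:
  assumes b: "reduced (p @ j # q)"
  shows "nonneg (act p (alpha j))" "(\<Sum>a\<in>descents (ev (p @ j # q)). act p (alpha j) a) \<ge> 1"
proof -
  let ?b = "p @ j # q" and ?x = "ev (p @ j # q)" and ?\<beta> = "act p (alpha j)"
  have bR: "?b \<in> lists R" using b by (rule reduced_in_lists)
  then have R: "p \<in> lists R" "j \<in> R" "q \<in> lists R" by simp_all
  have pj: "reduced (p @ [j])" using reduced_append[of "p @ [j]" q] b by simp
  have jq: "reduced (rev q @ [j])"
    using reduced_append[of p "j # q"] b reduced_rev[of "j # q"] by simp
  show nn: "nonneg ?\<beta>"
    using rho_alpha_nonneg[of "ev p" j] R pj by (simp add: rho_ev reduced_snoc_iff)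
  let ?A = "descents ?x"
  have AR: "?A \<subseteq> R" "finite ?A" using finite_R by (auto simp: descents_def)
  have int: "(\<Sum>a\<in>?A. ?\<beta> a) \<in> \<int>"
    using integral_act[OF R(1) integral_alpha[of j]] unfolding integral_def by (intro Ints_sum) blast
  have nn2: "(\<Sum>a\<in>?A. ?\<beta> a) \<ge> 0" using nn by (intro sum_nonneg) (simp add: nonneg_def)
  have "(\<Sum>a\<in>?A. ?\<beta> a) \<noteq> 0"
  proof
    assume "(\<Sum>a\<in>?A. ?\<beta> a) = 0"
    then have zero: "?\<beta> a = 0" if "a \<in> ?A" for a
      using that AR nn sum_nonneg_eq_0_iff[of ?A ?\<beta>] by (simp add: nonneg_def)
    have "rho (inv ?x) ?\<beta> i \<ge> 0" for i
      unfolding rho_expand[OF supported_act[OF R(1) supported_alpha[OF R(2)]]]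
    proof (rule sum_nonneg)
      fix r assume r: "r \<in> R"
      show "?\<beta> r * rho (inv ?x) (alpha r) i \<ge> 0"
      proof (cases "r \<in> ?A")
        case False
        then have "len ?x < len (r \<otimes> ?x)"
          using r bR len_gen_mult_cases[of ?x r] by (auto simp: descents_def)
        then have "nonneg (rho (inv ?x) (alpha r))"
          using rho_inv_alpha_nonneg[of ?x r] r bR by simp
        then show ?thesis using nn by (simp add: nonneg_def)
      qed (simp add: zero)
    qed
    moreover have "rho (inv ?x) ?\<beta> = (\<lambda>i. - act (rev q) (alpha j) i)"
    proof -
      have "rho (inv ?x) = act (rev ?b)"
        using rho_ev[of "rev ?b"] bR by (simp only: ev_rev rev_in_lists_iff)
      then have "rho (inv ?x) ?\<beta> = act (rev q) (refl j (act (rev p) ?\<beta>))" by simp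
      also have "act (rev p) ?\<beta> = alpha j"
        using rho_inv_cancel[of "ev p" "alpha j"] R rho_ev[of p] rho_ev[of "rev p"] by (simp add: ev_rev)
      also have "refl j (alpha j) = (\<lambda>i. - alpha j i)"
        using R by (simp add: refl_def fun_eq_iff)
      finally show ?thesis by (simp add: act_uminus)
    qed
    ultimately have "nonneg (\<lambda>i. - rho (ev (rev q)) (alpha j) i)"
      using R by (simp add: nonneg_def rho_ev)
    moreover have "nonneg (rho (ev (rev q)) (alpha j))"
      using rho_alpha_nonneg[of "ev (rev q)" j] R jq by (simp add: reduced_snoc_iff)
    ultimately show False using rho_alpha_nonzero[of "ev (rev q)" j] R by simp
  qed
  with int nn2 show "(\<Sum>a\<in>?A. ?\<beta> a) \<ge> 1" by (auto elim!: Ints_cases)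
qed

text \<open>\<open>nu T q\<close> adds up the inversions of \<open>q\<close> at its letters in
  \<open>T\<close>, and \<open>p\<close> carries them to inversions of \<open>p @ q\<close>; each
  contributes at least 1. The free prefix \<open>p\<close> serves the induction.\<close>

lemma nu_lower_bound:
  assumes "reduced (p @ q)"
  shows "nonneg (act p (nu T q)) \<and>
    (\<Sum>a\<in>descents (ev (p @ q)). act p (nu T q) a) \<ge> real (length (filter (\<lambda>j. j \<in> T) q))"
  using assms
proof (induction q arbitrary: p)
  case Nil
  then show ?case by (simp add: act_zero nonneg_def)
next
  case (Cons j q)
  let ?d = "of_bool (j \<in> T) :: real" and ?A = "descents (ev (p @ j # q))"
  note r = inversion_meets_descents[OF Cons.prems]
  have eq: "act p (nu T (j # q)) = (\<lambda>i. ?d * act p (alpha j) i + act (p @ [j]) (nu T q) i)"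
    by (simp add: act_add act_scale)
  have IH: "nonneg (act (p @ [j]) (nu T q))"
    "(\<Sum>a\<in>?A. act (p @ [j]) (nu T q) a) \<ge> real (length (filter (\<lambda>j. j \<in> T) q))"
    using Cons.IH[of "p @ [j]"] Cons.prems by simp_all
  have "(\<Sum>a\<in>?A. act p (nu T (j # q)) a) =
      ?d * (\<Sum>a\<in>?A. act p (alpha j) a) + (\<Sum>a\<in>?A. act (p @ [j]) (nu T q) a)"
    unfolding eq by (simp add: sum.distrib sum_distrib_left)
  then show ?case using r IH unfolding eq nonneg_def by (cases "j \<in> T") auto
qed

lemma coroot_le_neighbours:
  assumes "s \<in> R" "nonneg v" "v s = 0" "A \<subseteq> R" "\<And>a. a \<in> A \<Longrightarrow> adj a s"
  shows "coroot s v \<le> - (\<Sum>a\<in>A. v a)"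
proof -
  have "coroot s v \<le> (\<Sum>a\<in>A. cart s a * v a)"
    unfolding coroot_def
  proof (rule sum_le_subset_nonpos[OF finite_R assms(4)])
    fix i assume "i \<in> R - A"
    then show "cart s i * v i \<le> 0"
      using cart_nonpos[of s i] assms by (cases "i = s") (auto simp: nonneg_def mult_le_0_iff)
  qed
  also have "\<dots> = (\<Sum>a\<in>A. - v a)"
    by (intro sum.cong refl) (use assms(5) adj_sym cart_adj in fastforce)
  finally show ?thesis by (simp add: sum_negf)
qed

text \<open>Positivity of the form on \<open>2 N + F \<alpha>\<^sub>s + E \<alpha>\<^sub>s'\<close> with \<open>s' = opp s\<close> gives
  \<open>F\<^sup>2 + E\<^sup>2 < 4 E\<close>, whence \<open>F = 1\<close>.\<close>

lemma unique_descent: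
  assumes s: "s \<in> R" "opp s \<noteq> s" and b: "reduced b" "b \<noteq> []" "s \<notin> set b" "opp s \<notin> set b"
    and tw: "opp (ev b) = inv (ev b)" and A: "\<And>a. a \<in> descents (ev b) \<Longrightarrow> adj a s"
  shows "\<exists>r. descents (ev b) = {r} \<and> length (filter (\<lambda>j. j = opp r) b) = 1"
proof -
  let ?A = "descents (ev b)" and ?s' = "opp s"
  \<comment> \<open>Since \<open>opp\<close> inverts \<open>ev b\<close>, \<open>T\<close> is the
    set of right descents of \<open>b\<close>. Using it to index the weights gives
    \<open>F \<ge> n\<close>, with \<open>n\<close> the number of letters of \<open>b\<close> in
    \<open>T\<close>, while \<open>form N N = 2 * E\<close> by the norm identity.\<close>
  define T where "T = opp ` ?A"
  define N where "N = nu T b"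
  define F where "F = (\<Sum>a\<in>?A. N a)"
  define E where "E = (\<Sum>t\<in>T. N t)"
  define n where "n = length (filter (\<lambda>j. j \<in> T) b)"
  have bR: "b \<in> lists R" using b by (simp add: reduced_in_lists)
  have AR: "?A \<subseteq> R" "finite ?A" using finite_R by (auto simp: descents_def)
  have s': "?s' \<in> R" using s by simp
  have TR: "T \<subseteq> R" "finite T" using AR by (auto simp: T_def)
  have adjT: "adj t ?s'" if "t \<in> T" for t using that A adj_opp by (auto simp: T_def)
  have T: "T = descents (inv (ev b))"
    using descents_opp[of "ev b"] bR by (simp add: T_def tw)
  have Tb: "T \<subseteq> set b"
    using descents_subset_letters[of "rev b"] bR by (simp add: T ev_rev)
  have card: "card T = card ?A"
    unfolding T_def by (rule card_image) (use AR in \<open>auto simp: inj_on_def opp_eq_iff subset_iff\<close>)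
  have "card T \<le> card (set (filter (\<lambda>j. j \<in> T) b))"
    using Tb by (intro card_mono) auto
  then have n: "card T \<le> n" unfolding n_def using card_length le_trans by blast
  have "ev b \<noteq> \<one>" using b by (auto simp: reduced_def)
  then have "?A \<noteq> {}" using ex_descent bR by simp
  then have c1: "card ?A \<ge> 1" using AR by (simp add: Suc_leI card_gt_0_iff)
  have nn: "nonneg N" and Fn: "F \<ge> real n"
    using nu_lower_bound[of "[]" b T] b(1) by (simp_all add: N_def F_def n_def)
  have supp: "supported N" and int: "integral N"
    using supported_nu integral_nu bR by (simp_all add: N_def)
  have Ns: "N s = 0" "N ?s' = 0" using nu_fixes_coordinate b by (simp_all add: N_def)
  have F1: "F \<ge> 1" using Fn n c1 card by linarith
  then obtain a where "a \<in> ?A" "N a \<noteq> 0"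
    unfolding F_def by (metis not_one_le_zero sum.neutral)
  then have "form N N > 0" using form_pos[OF supp] AR by blast
  moreover have NN: "form N N = 2 * E" unfolding N_def E_def using form_nu[OF bR TR(1)] .
  ultimately have E0: "E > 0" by simp
  have cs: "coroot s N \<le> - F"
    unfolding F_def using coroot_le_neighbours[OF s(1) nn Ns(1) AR(1)] A by blast
  have cs': "coroot ?s' N \<le> - E"
    unfolding E_def using coroot_le_neighbours[OF s' nn Ns(2) TR(1)] adjT by blast
  \<comment> \<open>With nonnegative coefficients \<open>x\<close> and \<open>y\<close> of the two
    simple roots added to \<open>N\<close>, the norm is at most
    \<open>2 * E - 2 * x * F - 2 * y * E + 2 * x^2 + 2 * y^2\<close>, smallest at
    \<open>x = F / 2\<close> and \<open>y = E / 2\<close>; this is that vector doubled.\<close>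
  let ?z = "\<lambda>i. 2 * N i + (F * alpha s i + E * alpha ?s' i)"
  have "supported ?z"
    using supp supported_alpha[OF s(1)] supported_alpha[OF s'] by (simp add: supported_def)
  moreover have "?z s \<noteq> 0" using Ns s F1 by (simp add: alpha_def)
  ultimately have "form ?z ?z > 0" using form_pos s(1) by blast
  also have "form ?z ?z = 8 * E + 4 * (F * coroot s N) + 4 * (E * coroot ?s' N) + 2 * F\<^sup>2 + 2 * E\<^sup>2
      + 2 * (F * E * cart s ?s')"
    using s s' NN cart_sym[of ?s' s] by (simp add: power2_eq_square) (simp add: algebra_simps)
  also have "\<dots> \<le> 8 * E + 4 * (F * - F) + 4 * (E * - E) + 2 * F\<^sup>2 + 2 * E\<^sup>2 + 0"
  proof -
    have "F * coroot s N \<le> F * - F" using cs F1 by (intro mult_left_mono) auto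
    moreover have "E * coroot ?s' N \<le> E * - E" using cs' E0 by (intro mult_left_mono) auto
    moreover have "F * E * cart s ?s' \<le> 0"
      using cart_nonpos[of s ?s'] s s' F1 E0 by (intro mult_nonneg_nonpos) auto
    ultimately show ?thesis by linarith
  qed
  finally have "F\<^sup>2 + E\<^sup>2 < 4 * E" by (simp add: power2_eq_square)
  \<comment> \<open>\<open>4 * E - E^2\<close> is at most 4, its value at
    \<open>E = 2\<close>.\<close>
  then have "F\<^sup>2 < 4" using zero_le_power2[of "E - 2"] by (simp add: power2_diff)
  then have "F < 2" using F1 abs_square_less_1 power2_less_imp_less[of F 2] by simp
  then have "n \<le> 1" using Fn by linarith
  then have "card ?A = 1" "n = 1" using n c1 card by linarith+
  then obtain r where r: "?A = {r}" by (meson card_1_singletonE)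
  then have "T = {opp r}" by (simp add: T_def)
  with \<open>n = 1\<close> r show ?thesis by (simp add: n_def)
qed

section \<open>Solutions of the twisted equation and paths\<close>

lemma twisted_strip:
  assumes "s \<in> R" "x \<in> carrier G" "opp (s \<otimes> x \<otimes> opp s) = inv (s \<otimes> x \<otimes> opp s)"
  shows "opp x = inv x"
proof -
  have "opp s \<otimes> opp x \<otimes> s = opp s \<otimes> inv x \<otimes> s"
    using assms by (simp add: opp_mult inv_mult_group m_assoc)
  then have "opp s \<otimes> (opp s \<otimes> opp x \<otimes> s) \<otimes> s = opp s \<otimes> (opp s \<otimes> inv x \<otimes> s) \<otimes> s" by simp
  then show ?thesis using assms(1,2) by (simp add: m_assoc)
qed

text \<open>A descent \<open>a\<close> of \<open>b\<close> is adjacent to \<open>s\<close>, as it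
  would otherwise commute with \<open>s\<close> and be a descent of the whole word besides
  \<open>s\<close>. So \<open>unique_descent\<close> applies: \<open>b\<close> is a single letter or
  again of the form \<open>r # b3 @ [opp r]\<close> with neither \<open>r\<close> nor
  \<open>opp r\<close> in \<open>b3\<close>, and the induction continues.\<close>

lemma twisted_word_is_path:
  assumes "reduced (s # b @ [opp s])" "opp s \<noteq> s" "s \<notin> set b" "opp s \<notin> set b"
    and "opp (ev b) = inv (ev b)" "descents (ev (s # b @ [opp s])) = {s}"
  shows "is_path (s # b @ [opp s])"
  using assms
proof (induction "length b" arbitrary: s b rule: less_induct)
  case less
  let ?s' = "opp s" and ?u = "ev (s # b @ [opp s])" and ?x = "ev b"
  have s: "s \<in> R" "?s' \<in> R" and bR: "b \<in> lists R"
    using reduced_in_lists[OF less.prems(1)] by auto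
  have b: "reduced b" using less.prems(1) reduced_ConsD reduced_append by blast
  have u: "?u = s \<otimes> ?x \<otimes> ?s'" "len ?u = length b + 2" "len ?x = length b"
    using s bR less.prems(1) b by (simp_all add: m_assoc reduced_def)
  show ?case
  proof (cases "b = []")
    case True
    \<comment> \<open>If \<open>s\<close> and \<open>opp s\<close> commuted, \<open>opp s\<close>
      would be a second descent.\<close>
    have "adj s ?s'"
    proof (rule ccontr)
      assume "\<not> adj s ?s'"
      then have "s \<otimes> ?s' = ?s' \<otimes> s" using gen_commute[OF s] by blast
      then have "?u = ?s' \<otimes> s" using True s by simp
      then have "len (?s' \<otimes> ?u) < len ?u" using u(2) s by simp
      then have "?s' \<in> descents ?u" using s by (simp add: descents_def)
      then show False using less.prems by simp
    qed
    then show ?thesis using True s less.prems(2) by (auto simp: is_path_def)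
  next
    case False
    have A: "adj a s" if a: "a \<in> descents ?x" for a
    proof (rule ccontr)
      assume na: "\<not> adj a s"
      have aR: "a \<in> R" and ab: "a \<in> set b"
        using a descents_subset_letters[OF bR] by (auto simp: descents_def)
      have "a \<otimes> ?u = s \<otimes> (a \<otimes> ?x) \<otimes> ?s'"
        using gen_commute[OF aR s(1) na] s aR bR unfolding u(1) by (simp add: m_assoc[symmetric])
      then have "len (a \<otimes> ?u) < len ?u"
        using len_mult_le[of "s \<otimes> (a \<otimes> ?x)" ?s'] len_mult_le[of s "a \<otimes> ?x"] s aR bR u(2,3) a
        by (simp add: descents_def)
      then have "a \<in> descents ?u" using aR by (simp add: descents_def)
      then show False using less.prems(3,6) ab by auto
    qed
    obtain r where r: "descents ?x = {r}" "length (filter (\<lambda>j. j = opp r) b) = 1"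
      using unique_descent[OF s(1) less.prems(2) b False less.prems(3,4,5) A] by blast
    have rR: "r \<in> R" "adj r s" using r(1) A[of r] by (auto simp: descents_def)
    \<comment> \<open>Reversed and mapped by \<open>opp\<close>, \<open>b\<close> becomes another
      reduced word of the same element; the count of \<open>opp r\<close> in it is the count of
      \<open>r\<close> in \<open>b\<close>.\<close>
    let ?b2 = "rev (map opp b)"
    have b2: "reduced ?b2" "ev ?b2 = ?x"
      using reduced_map_opp[OF b] opp_word[OF bR] less.prems(5) bR by (simp_all add: ev_rev)
    have inb2: "t \<in> set ?b2 \<longleftrightarrow> opp t \<in> set b" if "t \<in> R" for t
      using that bR by (auto simp: in_lists_conv_set image_iff) (metis gen_closed opp_opp)
    have "length (filter (\<lambda>j. j = opp r) ?b2) = 1"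
      using unique_descent[OF s(1) less.prems(2) b2(1)] b2(2) False inb2[OF s(1)] inb2[OF s(2)]
        less.prems(3,4,5) A r(1) s by auto
    moreover have "filter (\<lambda>j. j = opp r) (map opp b) = map opp (filter (\<lambda>j. j = r) b)"
      using bR rR by (induction b) (auto simp: opp_eq_iff)
    ultimately have r1: "length (filter (\<lambda>j. j = r) b) = 1"
      by (metis length_map length_rev rev_filter)
    obtain h b' where hb: "b = h # b'" using False by (cases b) auto
    then have "h = r" using descents_Cons[of h b'] b r(1) by simp
    obtain l b'' where lb: "b = b'' @ [l]" using False by (cases b rule: rev_cases) auto
    then have "l \<in> descents (inv ?x)" using descents_snoc[of b'' l] b by simp
    also have "descents (inv ?x) = {opp r}"
      using descents_opp[of ?x] bR less.prems(5) r(1) by simp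
    finally have "l = opp r" by simp
    have pb: "is_path b"
    proof (cases "opp r = r")
      case True
      \<comment> \<open>\<open>r\<close> is both the first and the last letter of \<open>b\<close>,
        but occurs only once.\<close>
      have "b' = []"
      proof (rule ccontr)
        assume "b' \<noteq> []"
        then obtain b3 where "b' = b3 @ [l]" using hb lb by (cases b' rule: rev_cases) auto
        then show False using r1 hb \<open>h = r\<close> \<open>l = opp r\<close> True by simp
      qed
      then show ?thesis using hb \<open>h = r\<close> rR by (simp add: is_path_def)
    next
      case ne: False
      then have "b' \<noteq> []" using hb lb \<open>h = r\<close> \<open>l = opp r\<close> by auto
      then obtain b3 where b3: "b = r # b3 @ [opp r]"
        using hb lb \<open>h = r\<close> \<open>l = opp r\<close> by (cases b' rule: rev_cases) auto
      have b3R: "b3 \<in> lists R" using bR b3 by simp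
      have n: "r \<notin> set b3" "opp r \<notin> set b3"
        using r1 r(2) ne unfolding b3 by (auto simp: filter_empty_conv)
      have "?x = r \<otimes> ev b3 \<otimes> opp r" using b3 b3R rR by (simp add: m_assoc)
      then have "opp (ev b3) = inv (ev b3)"
        using twisted_strip[of r "ev b3"] less.prems(5) rR b3R by simp
      moreover have "length b3 < length b" using b3 by simp
      ultimately show ?thesis
        using less.hyps[of b3 r] b n ne r(1) unfolding b3 by blast
    qed
    have "hd b = r" using hb \<open>h = r\<close> by simp
    moreover have "last b = opp r" using lb \<open>l = opp r\<close> by simp
    moreover have "adj s r" "adj (opp r) ?s'" using rR adj_sym adj_opp by blast+
    ultimately show ?thesis
      using pb less.prems(2-4) s False
      by (auto simp: is_path_def successively_Cons successively_append_iff)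
  qed
qed

lemma twisted_involution_word:
  assumes w: "reduced w" and tw: "opp (ev w) = inv (ev w)"
    and inv1: "{y \<in> involutions G. prefix_of y (ev w)} = {s}" and s: "s \<in> R"
  shows "is_path w \<and> hd w = s \<and> last w = opp s"
proof -
  have wR: "w \<in> lists R" using w by (rule reduced_in_lists)
  have D: "descents (ev w) = {s}"
  proof -
    have "r \<in> descents (ev w) \<longleftrightarrow> r \<in> R \<and> r \<in> {y \<in> involutions G. prefix_of y (ev w)}" for r
      using prefix_of_gen_iff[of r "ev w"] wR by (auto simp: descents_def)
    then show ?thesis unfolding inv1 using s by auto
  qed
  have "w \<noteq> []" using D by (auto simp: descents_def)
  then obtain h w' where "w = h # w'" by (cases w) auto
  then have ww: "w = s # w'" using descents_Cons[of h w'] w D by simp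
  have sw': "s \<notin> set w'" using letter_occurs_once[of s w'] w inv1 ww by simp
  obtain l w'' where lw: "w = w'' @ [l]" using \<open>w \<noteq> []\<close> by (cases w rule: rev_cases) auto
  then have "l \<in> descents (inv (ev w))" using descents_snoc[of w'' l] w by simp
  also have "descents (inv (ev w)) = {opp s}"
    using descents_opp[of "ev w"] wR tw D by simp
  finally have l: "l = opp s" by simp
  show ?thesis
  proof (cases "w' = []")
    case True
    then show ?thesis using ww lw l s by (auto simp: is_path_def)
  next
    case False
    then obtain b where b: "w' = b @ [opp s]" using ww lw l by (cases w' rule: rev_cases) auto
    have ne: "opp s \<noteq> s" "s \<notin> set b" using sw' b by auto
    have bR: "b \<in> lists R" using wR ww b by simp
    let ?w2 = "rev (map opp w)"
    have "reduced ?w2" "ev ?w2 = ev w"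
      using reduced_map_opp[OF w] opp_word[OF wR] tw wR by (simp_all add: ev_rev)
    moreover have "?w2 = s # rev (map opp b) @ [opp s]" using ww b s by simp
    ultimately have "s \<notin> set (rev (map opp b))"
      using letter_occurs_once[of s "rev (map opp b) @ [opp s]"] inv1 by simp
    then have "opp s \<notin> set b" using s by (auto simp: image_iff)
    moreover have "ev w = s \<otimes> ev b \<otimes> opp s" using ww b bR s by (simp add: m_assoc)
    then have "opp (ev b) = inv (ev b)" using twisted_strip[OF s] tw bR by simp
    ultimately have "is_path w"
      using twisted_word_is_path[of s b] w ne D ww b by simp
    then show ?thesis using ww b by simp
  qed
qed

text \<open>The head \<open>r\<close> is new, so it is no descent of the tail and the word stays
  reduced. A further descent \<open>c\<close> adjacent to \<open>r\<close> is impossible, as the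
  \<open>r\<close>-coordinate of \<open>refl r (alpha c)\<close> stays 1 under the tail; one not
  adjacent to \<open>r\<close> would be a descent of the tail, hence its head, which is adjacent to
  \<open>r\<close>.\<close>

lemma path_reduced: "is_path p \<Longrightarrow> reduced p \<and> descents (ev p) = {hd p}"
proof (induction p)
  case (Cons r q)
  have r: "r \<in> R" "r \<notin> set q" using Cons.prems by (auto simp: is_path_Cons_iff)
  show ?case
  proof (cases "q = []")
    case True
    have "c = r" if "c \<in> R" "len (c \<otimes> r) < 1" for c
    proof -
      have "c \<otimes> r = \<one>" using that r len_eq_0_iff[of "c \<otimes> r"] by simp
      then have "c \<otimes> r \<otimes> r = r" using r by simp
      then show ?thesis using that r by simp
    qed
    then show ?thesis using True r by (auto simp: descents_def reduced_def)
  next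
    case False
    with Cons have q: "reduced q" "descents (ev q) = {hd q}" "adj r (hd q)" and qR: "q \<in> lists R"
      by (auto simp: is_path_Cons_iff reduced_in_lists)
    have "r \<notin> descents (ev q)" using q(2) r(2) False by auto
    then have red: "reduced (r # q)"
      using q(1) r qR len_gen_mult_cases[of "ev q" r] by (auto simp: reduced_Cons_iff descents_def)
    have "c = r" if c: "c \<in> descents (ev (r # q))" for c
    proof (rule ccontr)
      assume "c \<noteq> r"
      have cR: "c \<in> R" using c by (simp add: descents_def)
      let ?x = "ev (r # q)"
      have xc: "?x \<in> carrier G" using r qR by simp
      have "len (inv ?x \<otimes> c) < len (inv ?x)"
        using c xc cR len_inv[of "c \<otimes> ?x"] by (simp add: descents_def inv_mult_group del: ev_Cons)
      then have "nonneg (\<lambda>i. - rho (inv ?x) (alpha c) i)"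
        using rho_alpha_nonpos[of "inv ?x" c] xc cR by simp
      moreover have "rho (inv ?x) = act (rev (r # q))"
        using rho_ev[of "rev (r # q)"] ev_rev[of "r # q"] r qR by (simp del: ev_Cons)
      ultimately have nn: "nonneg (\<lambda>i. - act (rev q) (refl r (alpha c)) i)" by simp
      show False
      proof (cases "adj r c")
        case True
        then have "refl r (alpha c) = (\<lambda>i. alpha c i + alpha r i)"
          using cart_adj[OF True] cR by (simp add: refl_def)
        then have "act (rev q) (refl r (alpha c)) r = 1"
          using act_fixes_coordinate[of r "rev q"] r(2) \<open>c \<noteq> r\<close> by (simp add: alpha_def)
        then show False using nn by (auto simp: nonneg_def dest: spec[of _ r])
      next
        case False
        then have "refl r (alpha c) = alpha c"
          using not_adj_cart[of r c] r cR \<open>c \<noteq> r\<close> by (simp add: refl_def)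
        then have nn': "nonneg (\<lambda>i. - rho (inv (ev q)) (alpha c) i)"
          using nn rho_ev[of "rev q"] qR by (simp add: ev_rev)
        have "c \<in> descents (ev q)"
        proof (rule ccontr)
          assume "c \<notin> descents (ev q)"
          then have "nonneg (rho (inv (ev q)) (alpha c))"
            using rho_inv_alpha_nonneg[of "ev q" c] len_gen_mult_cases[of "ev q" c] cR qR
            by (auto simp: descents_def)
          then show False using rho_alpha_nonzero[of "inv (ev q)" c] nn' cR qR by simp
        qed
        then show False using q(2,3) False by simp
      qed
    qed
    then show ?thesis using red descents_Cons[OF red] by auto
  qed
qed (simp add: is_path_def)

text \<open>The descents of a prefix are among those of \<open>ev p\<close>, so a nontrivial prefix
  must begin with the head of the path, which is then stripped.\<close>

lemma path_prefix:
  "p = [] \<or> is_path p \<Longrightarrow> y \<in> carrier G \<Longrightarrow> prefix_of y (ev p) \<Longrightarrow> \<exists>i\<le>length p. y = ev (take i p)"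
proof (induction p arbitrary: y)
  case Nil
  then show ?case using len_eq_0_iff[of y] by (simp add: prefix_of_def)
next
  case (Cons r q)
  then have p: "is_path (r # q)" by simp
  have r: "r \<in> R" and qR: "q \<in> lists R" and q: "q = [] \<or> is_path q"
    using p unfolding is_path_Cons_iff by (auto simp: is_path_def in_lists_conv_set)
  have red: "reduced (r # q)" "descents (ev (r # q)) = {r}" using path_reduced[OF p] by auto
  show ?case
  proof (cases "y = \<one>")
    case True
    then show ?thesis by (intro exI[of _ 0]) simp
  next
    case False
    have "descents y \<subseteq> {r}"
      using descents_prefix[OF Cons.prems(2) _ Cons.prems(3)] red(2) r qR by simp
    then have "r \<in> descents y" using ex_descent[OF Cons.prems(2) False] by blast
    define z where "z = r \<otimes> y"
    have z: "z \<in> carrier G" "y = r \<otimes> z" "len y = len z + 1"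
      using r Cons.prems(2) \<open>r \<in> descents y\<close> len_gen_mult_cases[of y r]
      by (auto simp: z_def descents_def)
    have "inv y \<otimes> ev (r # q) = inv z \<otimes> ev q"
      using z(1,2) r qR by (simp add: inv_mult_group m_assoc)
    moreover have "len (ev (r # q)) = len (ev q) + 1"
      using red(1) reduced_ConsD[OF red(1)] by (simp add: reduced_def)
    ultimately have "prefix_of z (ev q)"
      using Cons.prems(3) z(3) by (simp add: prefix_of_def)
    then obtain i where "i \<le> length q" "z = ev (take i q)" using Cons.IH[OF q z(1)] by blast
    then show ?thesis using z(2) by (intro exI[of _ "Suc i"]) simp
  qed
qed

text \<open>A prefix is an initial segment of the path. If it is an involution, the reversed segment
  is a path with the same value, so first and last letter are both its only descent; without
  repetitions the segment has one letter.\<close>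

lemma path_involutive_prefixes:
  assumes p: "is_path p"
  shows "{y \<in> involutions G. prefix_of y (ev p)} = {hd p}"
proof -
  have pR: "p \<in> lists R" "p \<noteq> []" using p by (auto simp: is_path_def in_lists_conv_set)
  have "y = hd p" if y: "y \<in> involutions G" "prefix_of y (ev p)" for y
  proof -
    have yc: "y \<in> carrier G" "y \<noteq> \<one>" "y \<otimes> y = \<one>" using y by (auto simp: involutions_iff)
    obtain i where i: "i \<le> length p" "y = ev (take i p)" using path_prefix[of p y] p yc y by blast
    define t where "t = take i p"
    have t: "y = ev t" "p = t @ drop i p" using i by (simp_all add: t_def)
    then have t0: "t \<noteq> []" using yc(2) by auto
    then have "is_path t" using is_path_append[of t "drop i p"] p t(2) by simp
    have "ev (rev t) = y"
      using ev_rev[of t] pR t(1) yc inv_equality[of y y] by (simp add: t_def)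
    then have "descents y = {hd (rev t)}"
      using path_reduced[of "rev t"] \<open>is_path t\<close> is_path_rev by simp
    moreover have "descents y = {hd t}" using path_reduced[OF \<open>is_path t\<close>] t(1) by simp
    ultimately have "hd t = last t" using t0 by (simp add: hd_rev)
    then have "t = [hd t]" using \<open>is_path t\<close> t0 by (cases t) (auto simp: is_path_def split: if_splits)
    moreover have "hd t = hd p" using t(2) t0 by (metis hd_append2)
    moreover have "hd p \<in> R" using pR by (cases p) auto
    ultimately show ?thesis using t(1) by (metis ev_Cons ev_Nil gen_closed r_one)
  qed
  moreover have "hd p \<in> R" "hd p \<in> descents (ev p)"
    using path_reduced[OF p] pR by (cases p, auto)
  then have "hd p \<in> involutions G" "prefix_of (hd p) (ev p)"
    using prefix_of_gen_iff[of "hd p" "ev p"] pR by (auto simp: descents_def)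
  ultimately show ?thesis by blast
qed

text \<open>Reversing the path from \<open>s\<close> to \<open>opp s\<close> and applying
  \<open>opp\<close> gives a path with the same ends, hence the same path; this is why its product
  is inverted by \<open>opp\<close>.\<close>

lemma ex1_twisted_simply_laced:
  assumes s: "s \<in> R"
  shows "\<exists>!u. u \<in> carrier G \<and> opp u = inv u \<and> {y \<in> involutions G. prefix_of y u} = {s}"
proof -
  obtain p where "is_path p" "set p \<inter> {s} = {hd p}" "set p \<inter> {opp s} = {last p}"
    using ex_path[of "{s}" "{opp s}"] s by auto
  then have p: "is_path p" "hd p = s" "last p = opp s" by auto
  have pR: "p \<in> lists R" "p \<noteq> []" using p(1) by (auto simp: is_path_def in_lists_conv_set)
  have r1: "is_path (rev (map opp p))" using is_path_map_opp[OF p(1)] is_path_rev by blast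
  have r2: "hd (rev (map opp p)) = s" "last (rev (map opp p)) = opp s"
    using p pR s by (simp_all add: hd_rev last_map last_rev hd_map)
  have "rev (map opp p) = p"
    by (rule path_unique[OF r1 p(1)]) (simp_all only: r2 p(2,3))
  then have "inv (opp (ev p)) = ev p"
    using opp_word[OF pR(1)] ev_rev[of "map opp p"] by simp
  then have "opp (ev p) = inv (ev p)" using pR by (metis ev_closed inv_inv opp_closed)
  then have ex: "ev p \<in> carrier G \<and> opp (ev p) = inv (ev p) \<and> {y \<in> involutions G. prefix_of y (ev p)} = {s}"
    using path_involutive_prefixes[OF p(1)] p(2) pR by simp
  moreover have "u = ev p"
    if u: "u \<in> carrier G \<and> opp u = inv u \<and> {y \<in> involutions G. prefix_of y u} = {s}" for u
  proof -
    obtain w where w: "reduced w" "ev w = u" using u ex_reduced[of u] by blast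
    then have w': "is_path w" "hd w = s" "last w = opp s"
      using twisted_involution_word[OF w(1) _ _ s] u by blast+
    have "w = p"
      by (rule path_unique[OF w'(1) p(1)]) (simp_all only: w'(2,3) p(2,3))
    then show ?thesis using w(2) by simp
  qed
  ultimately show ?thesis by blast
qed

end

section \<open>Pendant elements\<close>

context finite_coxeter_system
begin

text \<open>In rank at least 2, and for \<open>s\<close> in \<open>R\<close>, these are the
  \<open>u\<close> for which \<open>u \<otimes> w0\<close> is a pendant element with
  \<open>s\<close> as the only member of its \<open>Delta1\<close>.\<close>

definition twisted_pendant :: "'a \<Rightarrow> 'a \<Rightarrow> bool" where
  "twisted_pendant s u \<longleftrightarrow>
    u \<in> carrier G \<and> opp u = inv u \<and> {y \<in> involutions G. prefix_of y u} = {s}"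

lemma prefix_of_refl: "u \<in> carrier G \<Longrightarrow> prefix_of u u"
  by (simp add: prefix_of_def)

lemma twisted_pendantD:
  assumes "twisted_pendant s u"
  shows "u \<in> carrier G" "opp u = inv u" "prefix_of s u"
    and "\<And>y. y \<in> involutions G \<Longrightarrow> prefix_of y u \<Longrightarrow> y = s"
proof -
  have e: "{y \<in> involutions G. prefix_of y u} = {s}"
    using assms by (simp add: twisted_pendant_def)
  have "s \<in> {y \<in> involutions G. prefix_of y u}" unfolding e by simp
  then show "prefix_of s u" by simp
  show "y = s" if "y \<in> involutions G" "prefix_of y u" for y
  proof -
    have "y \<in> {y \<in> involutions G. prefix_of y u}" using that by simp
    then show ?thesis unfolding e by simp
  qed
qed (use assms in \<open>simp_all add: twisted_pendant_def\<close>)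

lemma twisted_pendantI:
  assumes "u \<in> carrier G" "opp u = inv u" "s \<in> involutions G" "prefix_of s u"
    and "\<And>y. y \<in> involutions G \<Longrightarrow> prefix_of y u \<Longrightarrow> y = s"
  shows "twisted_pendant s u"
proof -
  have "{y \<in> involutions G. prefix_of y u} = {s}"
  proof (rule Set.set_eqI)
    fix y
    have "y \<in> involutions G \<and> prefix_of y u \<Longrightarrow> y = s" by (rule assms(5)) simp_all
    then show "y \<in> {y \<in> involutions G. prefix_of y u} \<longleftrightarrow> y \<in> {s}"
      using assms(3,4) by auto
  qed
  then show ?thesis using assms(1,2) by (simp add: twisted_pendant_def)
qed

lemma len_involution_pos: "y \<in> involutions G \<Longrightarrow> len y > 0"
  using len_eq_0_iff[of y] by (auto simp: involutions_iff)

lemma ex1_twisted_pendant_opp_trivial: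
  assumes triv: "\<And>r. r \<in> R \<Longrightarrow> opp r = r" and s: "s \<in> R"
  shows "\<exists>!u. twisted_pendant s u"
proof
  have opp: "opp x = x" if x: "x \<in> carrier G" for x
  proof -
    obtain w where w: "w \<in> lists R" "ev w = x" using ex_word[OF x] by blast
    have "map opp w = w" using w triv by (intro map_idI) (auto simp: in_lists_conv_set)
    then show ?thesis using opp_word[OF w(1)] w by simp
  qed
  show "twisted_pendant s s"
  proof (rule twisted_pendantI)
    fix y assume y: "y \<in> involutions G" "prefix_of y s"
    then have yc: "y \<in> carrier G" by (simp add: involutions_iff)
    have "len (inv y \<otimes> s) = 0"
      using y s len_involution_pos[of y] by (simp add: prefix_of_def)
    then have "inv y \<otimes> s = \<one>" using yc s len_eq_0_iff[of "inv y \<otimes> s"] by simp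
    then have "y \<otimes> (inv y \<otimes> s) = y" using yc by simp
    then show "y = s" using yc s by simp
  qed (use s opp in \<open>simp_all add: prefix_of_refl\<close>)
  fix u assume u: "twisted_pendant s u"
  note d = twisted_pendantD[OF u]
  have "u = inv u" using d(1,2) opp by simp
  then have "u \<otimes> u = u \<otimes> inv u" by simp
  then have "u \<otimes> u = \<one>" using d(1) by simp
  moreover have "u \<noteq> \<one>" using d(3) s by (auto simp: prefix_of_def)
  ultimately have "u \<in> involutions G" using d(1) by (simp add: involutions_iff)
  then show "u = s" using d(4) prefix_of_refl[OF d(1)] by blast
qed

text \<open>The two products act differently on \<open>alpha r\<close>: the
  \<open>s\<close>-coordinates of its images are \<open>cart s r\<close> and
  \<open>- cart s r\<close>.\<close>

lemma adj_not_commute: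
  assumes "adj s r"
  shows "s \<otimes> r \<noteq> r \<otimes> s"
proof
  assume comm: "s \<otimes> r = r \<otimes> s"
  have sr: "s \<in> R" "r \<in> R" "s \<noteq> r" using assms by (auto simp: adj_def)
  have "refl s (refl r (alpha r)) = rho (s \<otimes> r) (alpha r)" using sr by (simp add: rho_mult)
  also have "\<dots> = refl r (refl s (alpha r))" unfolding comm using sr by (simp add: rho_mult)
  finally have "refl s (refl r (alpha r)) s = refl r (refl s (alpha r)) s" by simp
  moreover have "refl r (alpha r) = (\<lambda>i. - alpha r i)" using sr by (simp add: refl_def fun_eq_iff)
  ultimately have "- refl s (alpha r) s = refl r (refl s (alpha r)) s"
    by (simp add: refl_uminus)
  moreover have "alpha r s = 0" "alpha s s = 1" using sr by (simp_all add: alpha_def)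
  then have "refl s (alpha r) s = - cart s r" "refl r (refl s (alpha r)) s = refl s (alpha r) s"
    using sr by (simp_all add: refl_def)
  ultimately have "cart s r = - cart s r" by simp
  then show False using adj_cart[OF assms] by simp
qed

text \<open>Reduced words alternate between \<open>s\<close> and \<open>r\<close>. The word
  \<open>s\<close> is excluded because \<open>opp s\<close> is \<open>r\<close>, and any word
  beginning with \<open>s r s\<close> has this involution as a prefix; so
  \<open>s \<otimes> r\<close> is the only candidate.\<close>

lemma ex1_twisted_pendant_dihedral:
  assumes R: "R = {s, r}" and adj: "adj s r" and opp: "opp s = r" "opp r = s"
  shows "\<exists>!u. twisted_pendant s u"
proof
  have sr: "s \<in> R" "r \<in> R" "s \<noteq> r" using adj by (auto simp: adj_def)
  note nc = adj_not_commute[OF adj]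
  let ?u = "s \<otimes> r"
  have "?u \<noteq> \<one>"
  proof
    assume "?u = \<one>"
    then have "s \<otimes> (s \<otimes> r) = s" using sr by simp
    then show False using sr by simp
  qed
  then have lu: "len ?u = 2"
    using len_gen_mult_cases[of r s] len_eq_0_iff[of ?u] sr by auto
  show "twisted_pendant s ?u"
  proof (rule twisted_pendantI)
    show "opp ?u = inv ?u" using sr opp by (simp add: opp_mult inv_mult_group)
    show "prefix_of s ?u" using prefix_of_gen_iff[of s ?u] sr lu by simp
    fix y assume y: "y \<in> involutions G" "prefix_of y ?u"
    then have yc: "y \<in> carrier G" "y \<otimes> y = \<one>" by (auto simp: involutions_iff)
    have iy: "inv y = y" using yc inv_equality by simp
    have l: "len y + len (y \<otimes> ?u) = 2" using y(2) lu iy by (simp add: prefix_of_def)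
    then consider "len y = 1" | "len y = 2" using len_involution_pos[OF y(1)] by linarith
    then show "y = s"
    proof cases
      case 1
      then have "y \<in> R" using len_eq_1 yc by blast
      moreover have "y \<noteq> r"
      proof
        assume "y = r"
        then have "r \<otimes> s \<otimes> r \<in> R" using l 1 len_eq_1[of "y \<otimes> ?u"] sr by (simp add: m_assoc)
        then have "r \<otimes> s \<otimes> r = s \<or> r \<otimes> s \<otimes> r = r" using R by blast
        then have "r \<otimes> s \<otimes> r \<otimes> r = s \<otimes> r \<or> r \<otimes> s \<otimes> r \<otimes> r = r \<otimes> r" by auto
        then have "r \<otimes> s = s \<otimes> r \<or> r \<otimes> s = \<one>" using sr by simp
        then have "r \<otimes> (r \<otimes> s) = r" using nc sr by force
        then show False using sr by simp
      qed
      ultimately show ?thesis using R by blast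
    next
      case 2
      then have "y \<otimes> ?u = \<one>" using l len_eq_0_iff[of "y \<otimes> ?u"] yc sr by simp
      then have "y \<otimes> (y \<otimes> ?u) = y" using yc by simp
      then have "?u = y" using yc sr by (simp flip: m_assoc)
      then have "?u = inv ?u" using iy by simp
      then show ?thesis using nc sr by (simp add: inv_mult_group)
    qed
  qed (use sr in simp_all)
  fix u assume "twisted_pendant s u"
  note d = twisted_pendantD[OF this]
  have "len (s \<otimes> u) < len u" using d(1,3) prefix_of_gen_iff sr by blast
  then obtain w where w: "reduced (s # w)" "ev (s # w) = u"
    using reduced_word_starting[OF d(1) sr(1)] by blast
  have nosq: "a \<noteq> c" if "reduced (p @ a # c # q)" for p a c q
  proof
    assume "a = c"
    have "reduced [a, c]"
      using that reduced_append[of p "a # c # q"] reduced_append[of "[a, c]" q] by simp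
    then show False using \<open>a = c\<close> by (auto simp: reduced_def)
  qed
  have other: "c = (if a = s then r else s)" if "reduced (p @ a # c # q)" for p a c q
  proof -
    have "a \<in> R" "c \<in> R" using reduced_in_lists[OF that] by auto
    then show ?thesis using nosq[OF that] R by auto
  qed
  show "u = ?u"
  proof (cases w)
    case Nil
    then have "u = s" using w sr by simp
    then show ?thesis using d(2) opp sr by simp
  next
    case (Cons t w')
    then have t: "t = r" using other[of "[]" s t w'] w(1) by simp
    show ?thesis
    proof (cases w')
      case Nil
      then show ?thesis using w(2) Cons t sr by simp
    next
      case (Cons t' w'')
      then have "t' = s" using other[of "[s]" r t' w''] w(1) \<open>w = t # w'\<close> t sr by simp
      then have red: "reduced ([s, r, s] @ w'')" and eu: "ev ([s, r, s] @ w'') = u"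
        using w Cons \<open>w = t # w'\<close> t by simp_all
      let ?y = "ev [s, r, s]"
      have "prefix_of ?y u" using prefix_of_reduced_append[OF red] eu by simp
      moreover have "len ?y = length [s, r, s]"
        using reduced_append[OF red] unfolding reduced_def by blast
      then have l: "len ?y = 3" by (simp del: ev_Cons)
      have "?y \<otimes> ?y = \<one>" using sr by (simp add: m_assoc)
      then have "?y \<in> involutions G" using l sr len_one by (auto simp: involutions_iff)
      ultimately have "?y = s" using d(4) by blast
      then show ?thesis using l sr by (simp del: ev_Cons)
    qed
  qed
qed

end

context irreducible_finite_coxeter_system
begin

lemma ex1_twisted_pendant:
  assumes n: "card R \<ge> 2" and s: "s \<in> R"
  shows "\<exists>!u. twisted_pendant s u"
proof (cases "\<forall>r\<in>R. opp r = r")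
  case True
  then show ?thesis using ex1_twisted_pendant_opp_trivial s by blast
next
  case False
  then obtain c where c: "c \<in> R" "opp c \<noteq> c" by blast
  show ?thesis
  proof (cases "card R \<ge> 3")
    case True
    interpret simply_laced_coxeter_system G R m
      by unfold_locales (rule simply_laced_if_opp_nontrivial[OF True c])
    show ?thesis unfolding twisted_pendant_def using ex1_twisted_simply_laced[OF s] .
  next
    case False
    then have "card R = 2" using n by simp
    then obtain r where R: "R = {s, r}" "s \<noteq> r" using s by (auto simp: card_2_iff)
    have "opp s \<noteq> opp r" using R opp_eq_iff[of s r] by auto
    moreover have "opp s \<in> {s, r}" "opp r \<in> {s, r}" using R opp_gen by blast+
    ultimately have opp: "opp s = r" "opp r = s" using c R by auto
    have "(s, r) \<in> (coxeter_graph R m)\<^sup>*"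
      using irreducible R by (simp add: coxeter_irreducible_def)
    then obtain z where "(s, z) \<in> coxeter_graph R m" using R(2) by (meson converse_rtranclE)
    then have z: "adj s z" by (simp add: coxeter_graph_def adj_def)
    then have "z \<in> R" "s \<noteq> z" by (simp_all add: adj_def)
    then have "z = r" using R(1) by blast
    then show ?thesis using ex1_twisted_pendant_dihedral[OF R(1) _ opp] z by blast
  qed
qed

text \<open>Right multiplication by \<open>w0\<close> turns additivity of lengths into the weak order.\<close>

lemma Delta1_eq:
  assumes u: "u \<in> carrier G" "opp u = inv u"
  shows "Delta1 G R (u \<otimes> w0) = {y \<in> involutions G. prefix_of y u}"
proof -
  have "len (u \<otimes> w0 \<otimes> y) = len (u \<otimes> w0) + len y \<longleftrightarrow> prefix_of y u"
    if y: "y \<in> involutions G" for y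
  proof -
    have yc: "y \<in> carrier G" "y \<otimes> y = \<one>" using y by (auto simp: involutions_iff)
    then have iy: "inv y = y" using inv_equality by simp
    have "w0 \<otimes> inv u = w0 \<otimes> (w0 \<otimes> u \<otimes> w0)" using u(2) by (simp add: opp_def)
    then have iw: "inv (u \<otimes> w0) = u \<otimes> w0" using u(1) by (simp add: inv_mult_group m_assoc)
    have "inv (u \<otimes> w0 \<otimes> y) = inv y \<otimes> inv (u \<otimes> w0)"
      using u(1) yc(1) by (intro inv_mult_group) simp_all
    also have "\<dots> = y \<otimes> u \<otimes> w0" unfolding iw iy using u(1) yc(1) by (simp add: m_assoc)
    finally have "inv (u \<otimes> w0 \<otimes> y) = y \<otimes> u \<otimes> w0" .
    then have "len (u \<otimes> w0 \<otimes> y) = len (y \<otimes> u \<otimes> w0)"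
      using len_inv[of "u \<otimes> w0 \<otimes> y"] u(1) yc(1) by simp
    moreover have "len (y \<otimes> u \<otimes> w0) + len (y \<otimes> u) = len w0" "len (u \<otimes> w0) + len u = len w0"
      using len_mult_w0 u(1) yc(1) by simp_all
    ultimately show ?thesis unfolding prefix_of_def iy by linarith
  qed
  then show ?thesis by (auto simp: Delta1_def)
qed

lemma pendants_eq:
  assumes n: "card R \<ge> 2"
  shows "pendants G R = (\<lambda>s. (THE u. twisted_pendant s u) \<otimes> w0) ` R" (is "_ = ?f ` R")
proof
  show "?f ` R \<subseteq> pendants G R"
  proof
    fix w assume "w \<in> ?f ` R"
    then obtain s where s: "s \<in> R" "w = ?f s" by blast
    define u where "u = (THE u. twisted_pendant s u)"
    have tp: "twisted_pendant s u"
      unfolding u_def by (rule theI'[OF ex1_twisted_pendant[OF n s(1)]])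
    note d = twisted_pendantD[OF tp]
    have w: "w = u \<otimes> w0" using s(2) by (simp add: u_def)
    have D: "Delta1 G R w = {s}"
      using Delta1_eq[OF d(1,2)] tp unfolding w twisted_pendant_def by simp
    have "w \<otimes> w = u \<otimes> opp u" using d(1) unfolding w by (simp add: opp_def m_assoc)
    then have "w \<otimes> w = \<one>" using d(1,2) by simp
    \<comment> \<open>Otherwise \<open>u\<close> would be \<open>w0\<close>, which has every
      generator as an involutive prefix; this is excluded in rank 2 and above.\<close>
    moreover have "w \<noteq> \<one>"
    proof
      assume "w = \<one>"
      then have "u \<otimes> w0 \<otimes> w0 = w0" unfolding w by simp
      then have "u = w0" using d(1) by (simp add: m_assoc)
      then have "R \<subseteq> {s}"
        using d(4) prefix_of_gen_iff[of _ w0] w0_left_descent by auto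
      then have "card R \<le> 1" using card_mono[of "{s}" R] by simp
      then show False using n by simp
    qed
    ultimately have "w \<in> involutions G" using d(1) w by (simp add: involutions_iff)
    then show "w \<in> pendants G R" using D by (simp add: pendants_def)
  qed
  show "pendants G R \<subseteq> ?f ` R"
  proof
    fix w assume "w \<in> pendants G R"
    then have w: "w \<in> involutions G" and c: "card (Delta1 G R w) = 1" by (auto simp: pendants_def)
    have wc: "w \<in> carrier G" "w \<otimes> w = \<one>" using w by (auto simp: involutions_iff)
    define u where "u = w \<otimes> w0"
    have u: "u \<in> carrier G" "u \<otimes> w0 = w" using wc by (simp_all add: u_def m_assoc)
    have "inv w = w" using wc inv_equality by simp
    then have tw: "opp u = inv u" using wc by (simp add: u_def opp_def inv_mult_group m_assoc)
    obtain y where "Delta1 G R w = {y}" using c by (meson card_1_singletonE)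
    then have y: "{y \<in> involutions G. prefix_of y u} = {y}" using Delta1_eq[OF u(1) tw] u(2) by simp
    then have "y \<in> {y \<in> involutions G. prefix_of y u}" by simp
    then have "len u > 0" using len_involution_pos[of y] by (auto simp: prefix_of_def)
    then have "u \<noteq> \<one>" by auto
    \<comment> \<open>Any descent of \<open>u\<close> is an involutive prefix, so the single element
      of \<open>Delta1 G R w\<close> is a generator.\<close>
    then obtain s where s: "s \<in> R" "len (s \<otimes> u) < len u" using ex_left_descent u(1) by blast
    then have "s \<in> {y \<in> involutions G. prefix_of y u}"
      using prefix_of_gen_iff u(1) by simp
    then have "s = y" unfolding y by simp
    then have "twisted_pendant s u" using y u(1) tw by (simp add: twisted_pendant_def)
    then have "(THE u. twisted_pendant s u) = u"
      using ex1_twisted_pendant[OF n s(1)] by (intro the1_equality)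
    then show "w \<in> ?f ` R" using s(1) u(2) by (intro image_eqI[of _ _ s]) simp_all
  qed
qed

text \<open>\<open>s\<close> is recovered from \<open>u\<close> as its only involutive prefix, so
  different generators give different pendant elements.\<close>

lemma card_pendants:
  assumes n: "card R \<ge> 2"
  shows "card (pendants G R) = card R"
  unfolding pendants_eq[OF n]
proof (rule card_image, rule inj_onI)
  fix s t assume st: "s \<in> R" "t \<in> R"
    and eq: "(THE u. twisted_pendant s u) \<otimes> w0 = (THE u. twisted_pendant t u) \<otimes> w0"
  have s: "twisted_pendant s (THE u. twisted_pendant s u)"
    and t: "twisted_pendant t (THE u. twisted_pendant t u)"
    using theI'[OF ex1_twisted_pendant[OF n]] st by blast+
  then have eq': "(THE u. twisted_pendant s u) = (THE u. twisted_pendant t u)"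
    using eq right_cancel[OF w0_closed twisted_pendantD(1)[OF s] twisted_pendantD(1)[OF t]] by blast
  have "twisted_pendant t (THE u. twisted_pendant s u)" unfolding eq' by (rule t)
  from twisted_pendantD(4)[OF this gen_involution[OF st(1)] twisted_pendantD(3)[OF s]]
  show "s = t" .
qed

end

theorem corollary1p7:
  fixes G :: "('a, 'b) monoid_scheme"
    and R :: "'a set"
    and m :: "'a \<Rightarrow> 'a \<Rightarrow> nat"
    and n :: nat
  assumes "coxeter_system G R m"
    and "finite (carrier G)"
    and "coxeter_irreducible R m"
    and "n = card R"
    and "n \<ge> 2"
  shows "card (pendants G R) = n"
proof -
  interpret coxeter_system G R m by fact
  interpret irreducible_finite_coxeter_system G R m
    by unfold_locales fact+
  show ?thesis using card_pendants assms by simp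
qed

end
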